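(* Consider a monotone-separable network with $\gamma(0)<a$ satisfying (IA), (AA), (SE) and (H) (all defined in the context). Let $b^{(j)}=\mathbf{E}Y_1^{(j)}$ and $$\underline R=\max_{j=1,\ldots,r}\ \sup_{n\le0}\Bigl(\sum_{i=n}^0Y_i^{(j)}-\sum_{i=n}^{-1}\tau_i\Bigr).$$ Then $$\liminf_{x\to\infty}\frac{\mathbf{P}(Z>x)}{\overline{F}^s(x)}\ge\lim_{x\to\infty}\frac{\mathbf{P}(\underline R>x)}{\overline{F}^s(x)}=\sum_{j=1}^r\frac{d^{(j)}}{a-b^{(j)}}.$$
   Context: Asymptotic notation ($x\to\infty$): for $c>0$, $f\sim cg$ means $f(x)/g(x)\to c$; $f\sim cg$ with $c=0$ means $f(x)=o(g(x))$. Empty sums are $0$. Monotone-separable network. The input $N=\{T_n\}_{n\in\mathbb{Z}}$ is a nondecreasing real sequence of arrival epochs, $\tau_n=T_{n+1}-T_n$, and $\{\zeta_n\}_{n\in\mathbb{Z}}$ is a sequence with values in a measurable space $K$ (service times and routing decisions). There are measurable functions $f_l:\mathbb{R}^l\times K^l\to\mathbb{R}$, $l\ge1$, and for $m\le n$ one puts $X_{[m,n]}(N)=f_{n-m+1}\{(T_l,\zeta_l),\,m\le l\le n\}$ (the finite time of last activity when the network starts empty and is fed by $T_m,\ldots,T_n$). For all inputs $N$ and all $m\le n$ it is required that: (causality) $X_{[m,n]}(N)\ge T_n$; (external monotonicity) $X_{[m,n]}(N')\ge X_{[m,n]}(N)$ whenever $T'_k\ge T_k$ for all $k$; (homogeneity)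 $X_{[m,n]}(c+N)=X_{[m,n]}(N)+c$ for all $c\in\mathbb{R}$; (separability) for $m\le l<n$, if $X_{[m,l]}(N)\le T_{l+1}$ then $X_{[m,n]}(N)=X_{[l+1,n]}(N)$. Maximal daters: $Z_{[m,n]}(N)=X_{[m,n]}(N)-T_n$; $Z_n=Z_{[n,n]}(N)$ (which does not depend on $N$). The sequence $Z_{[-n,0]}(N)$ is nondecreasing in $n$, and $Z=Z_{(-\infty,0]}=\lim_{n\to\infty}Z_{[-n,0]}(N)$ is the stationary maximal dater. Stochastic assumptions: $\{(\tau_n,\zeta_n)\}$ is stationary and ergodic, $\mathbf{E}\tau_n=a=\lambda^{-1}<\infty$, $\mathbf{E}Z_n<\infty$. With $Q$ the degenerate input with all points equal to $0$, $\gamma(0)=\lim_n Z_{[-n,-1]}(Q)/n=\lim_n\mathbf{E}Z_{[-n,-1]}(Q)/n$ a.s. (these limits exist and are constant). Stability: $\gamma(0)<a$. (IA): the sequences $\{\zeta_n\}$ and $\{\tau_n\}$ are mutually independent and each consists of i.i.d. random variables. (AA): for all $i$, $Z_i=Y_i^{(1)}+\cdots+Y_i^{(r)}$, where the $Y_i^{(j)}$ are nonnegative, independent of the interarrival times, and the vectors $(Y_i^{(1)},\ldots,Y_i^{(r)})$ are i.i.d. in $i$ (with arbitrary dependence between the components of a vector); in addition, for all $n\le 0$, $Z_{[n,0]}(Q)\ge\max_{j}\sum_{i=n}^0Y_i^{(j)}$ a.s. (SE): $F$ is a distribution function on $\mathbb{R}^+$ such that (a) $F$ is subexponential with finite mean;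 (b) the integrated tail distribution $F^s$, with tail $\overline{F}^s(x)=1-F^s(x)=\min\{1,\int_x^\infty\overline{F}(u)\,du\}$, $\overline{F}=1-F$, is subexponential; (c) for all $j$, $\mathbf{P}(Y_1^{(j)}>x)\sim d^{(j)}\overline{F}(x)$ as $x\to\infty$, with $d^{(j)}\ge0$ and $d=\sum_jd^{(j)}>0$. (H): as $x\to\infty$, $\mathbf{P}(\sum_{j=1}^rY_1^{(j)}>x)\sim\mathbf{P}(\max_{j}Y_1^{(j)}>x)\sim\sum_{j=1}^r\mathbf{P}(Y_1^{(j)}>x)\sim\sum_{j=1}^rd^{(j)}\overline{F}(x)$. *)

theory Defs
  imports "HOL-Probability.Probability" "HOL-Library.Landau_Symbols"
begin

text \<open>
  The function \<open>f l\<close> takes the \<open>l\<close> pairs (arrival epoch, mark) as one extensional function on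
  \<open>{..<l}\<close>; \<open>z\<close> is the sequence of marks and \<open>T\<close> the input. The degenerate input is \<open>\<lambda>_. 0\<close>.
\<close>

definition last_activity ::
  "(nat \<Rightarrow> (nat \<Rightarrow> real \<times> 'k) \<Rightarrow> real) \<Rightarrow> (int \<Rightarrow> 'k) \<Rightarrow> (int \<Rightarrow> real) \<Rightarrow> int \<Rightarrow> int \<Rightarrow> real" where
  "last_activity f z T m n =
     f (nat (n - m + 1)) (\<lambda>i\<in>{..<nat (n - m + 1)}. (T (m + int i), z (m + int i)))"

definition network_measurable ::
  "'k measure \<Rightarrow> (nat \<Rightarrow> (nat \<Rightarrow> real \<times> 'k) \<Rightarrow> real) \<Rightarrow> bool" where
  "network_measurable K f \<longleftrightarrow>
     (\<forall>l\<ge>1. f l \<in> borel_measurable (\<Pi>\<^sub>M i\<in>{..<l}. borel \<Otimes>\<^sub>M K))"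

definition monotone_separable ::
  "(nat \<Rightarrow> (nat \<Rightarrow> real \<times> 'k) \<Rightarrow> real) \<Rightarrow> (int \<Rightarrow> 'k) \<Rightarrow> bool" where
  "monotone_separable f z \<longleftrightarrow>
     (\<forall>T m n. mono T \<longrightarrow> m \<le> n \<longrightarrow>
        T n \<le> last_activity f z T m n \<and>
        (\<forall>T'. mono T' \<longrightarrow> (\<forall>k. T k \<le> T' k) \<longrightarrow> last_activity f z T m n \<le> last_activity f z T' m n) \<and>
        (\<forall>c. last_activity f z (\<lambda>k. c + T k) m n = last_activity f z T m n + c) \<and>
        (\<forall>l. m \<le> l \<longrightarrow> l < n \<longrightarrow> last_activity f z T m l \<le> T (l + 1) \<longrightarrow>
               last_activity f z T m n = last_activity f z T (l + 1) n))"

definition maximal_dater ::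
  "(nat \<Rightarrow> (nat \<Rightarrow> real \<times> 'k) \<Rightarrow> real) \<Rightarrow> (int \<Rightarrow> 'k) \<Rightarrow> (int \<Rightarrow> real) \<Rightarrow> int \<Rightarrow> int \<Rightarrow> real" where
  "maximal_dater f z T m n = last_activity f z T m n - T n"

definition stationary_maximal_dater ::
  "(nat \<Rightarrow> (nat \<Rightarrow> real \<times> 'k) \<Rightarrow> real) \<Rightarrow> (int \<Rightarrow> 'k) \<Rightarrow> (int \<Rightarrow> real) \<Rightarrow> ereal" where
  "stationary_maximal_dater f z T = lim (\<lambda>n. ereal (maximal_dater f z T (- int n) 0))"

definition interarrival :: "(int \<Rightarrow> 'w \<Rightarrow> real) \<Rightarrow> int \<Rightarrow> 'w \<Rightarrow> real" where
  "interarrival T n w = T (n + 1) w - T n w"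

definition is_gamma0 ::
  "'w measure \<Rightarrow> (nat \<Rightarrow> (nat \<Rightarrow> real \<times> 'k) \<Rightarrow> real) \<Rightarrow> (int \<Rightarrow> 'w \<Rightarrow> 'k) \<Rightarrow> real \<Rightarrow> bool" where
  "is_gamma0 M f \<zeta> g \<longleftrightarrow>
     (AE w in M. (\<lambda>n. maximal_dater f (\<lambda>i. \<zeta> i w) (\<lambda>_. 0) (- int n) (- 1) / real n) \<longlonglongrightarrow> g) \<and>
     (\<lambda>n. (LINT w|M. maximal_dater f (\<lambda>i. \<zeta> i w) (\<lambda>_. 0) (- int n) (- 1)) / real n) \<longlonglongrightarrow> g"

definition process_law ::
  "'w measure \<Rightarrow> 's measure \<Rightarrow> (int \<Rightarrow> 'w \<Rightarrow> 's) \<Rightarrow> (int \<Rightarrow> 's) measure" where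
  "process_law M S X = distr M (\<Pi>\<^sub>M n\<in>UNIV. S) (\<lambda>w n. X n w)"

definition stationary_process :: "'w measure \<Rightarrow> 's measure \<Rightarrow> (int \<Rightarrow> 'w \<Rightarrow> 's) \<Rightarrow> bool" where
  "stationary_process M S X \<longleftrightarrow>
     (\<forall>n. X n \<in> measurable M S) \<and> process_law M S (\<lambda>n. X (n + 1)) = process_law M S X"

definition ergodic_process :: "'w measure \<Rightarrow> 's measure \<Rightarrow> (int \<Rightarrow> 'w \<Rightarrow> 's) \<Rightarrow> bool" where
  "ergodic_process M S X \<longleftrightarrow>
     (\<forall>A \<in> sets (\<Pi>\<^sub>M n\<in>(UNIV :: int set). S).
        (\<lambda>x n. x (n + 1)) -` A \<inter> space (\<Pi>\<^sub>M n\<in>(UNIV :: int set). S) = A \<longrightarrow>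
        measure (process_law M S X) A \<in> {0, 1})"

definition iid_process :: "'w measure \<Rightarrow> 's measure \<Rightarrow> (int \<Rightarrow> 'w \<Rightarrow> 's) \<Rightarrow> bool" where
  "iid_process M S X \<longleftrightarrow>
     prob_space.indep_vars M (\<lambda>_. S) X UNIV \<and> (\<forall>n. distr M S (X n) = distr M S (X 0))"

text \<open>\<open>indep_var\<close> would force both processes to have the same value type, hence \<open>indep_set\<close>
  on the generated sigma-algebras.\<close>

definition indep_processes ::
  "'w measure \<Rightarrow> 's measure \<Rightarrow> (int \<Rightarrow> 'w \<Rightarrow> 's) \<Rightarrow> 't measure \<Rightarrow> (int \<Rightarrow> 'w \<Rightarrow> 't) \<Rightarrow> bool" where
  "indep_processes M S X S' X' \<longleftrightarrow>
     (\<forall>n. X n \<in> measurable M S) \<and> (\<forall>n. X' n \<in> measurable M S') \<and>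
     prob_space.indep_set M
       {(\<lambda>w n. X n w) -` A \<inter> space M | A. A \<in> sets (\<Pi>\<^sub>M n\<in>(UNIV :: int set). S)}
       {(\<lambda>w n. X' n w) -` A \<inter> space M | A. A \<in> sets (\<Pi>\<^sub>M n\<in>(UNIV :: int set). S')}"

definition distribution_function_nonneg :: "(real \<Rightarrow> real) \<Rightarrow> bool" where
  "distribution_function_nonneg F \<longleftrightarrow>
     mono F \<and> (\<forall>x. continuous (at_right x) F) \<and> (\<forall>x<0. F x = 0) \<and> (F \<longlongrightarrow> 1) at_top"

definition subexponential :: "(real \<Rightarrow> real) \<Rightarrow> bool" where
  "subexponential F \<longleftrightarrow>
     distribution_function_nonneg F \<and> (\<forall>x. F x < 1) \<and>
     ((\<lambda>x. (1 - cdf (interval_measure F \<star> interval_measure F) x) / (1 - F x)) \<longlongrightarrow> 2) at_top"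

definition finite_mean :: "(real \<Rightarrow> real) \<Rightarrow> bool" where
  "finite_mean F \<longleftrightarrow> integrable (interval_measure F) (\<lambda>x. x)"

text \<open>
  The integrated tail distribution is again a distribution on the nonnegative half-line. When the
  mean of \<open>F\<close> is below 1, the formula with the minimum describes it only for \<open>x \<ge> 0\<close> (there is
  then an atom at 0); on the negative half-line the distribution function is 0.
\<close>

definition integrated_tail_df :: "(real \<Rightarrow> real) \<Rightarrow> real \<Rightarrow> real" where
  "integrated_tail_df F x =
     (if x < 0 then 0 else 1 - min 1 (LBINT u:{x..}. 1 - F u))"

definition tail_equiv :: "(real \<Rightarrow> real) \<Rightarrow> real \<Rightarrow> (real \<Rightarrow> real) \<Rightarrow> bool" where
  "tail_equiv f c g \<longleftrightarrow>
     (if c = 0 then f \<in> o[at_top](g) else ((\<lambda>x. f x / g x) \<longlongrightarrow> c) at_top)"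

text \<open>In the following \<open>Y j i\<close>, with \<open>j \<in> {1..r}\<close>, is the variable written with upper index \<open>j\<close> and
  lower index \<open>i\<close> in the literature.\<close>

definition cond_IA ::
  "'w measure \<Rightarrow> 'k measure \<Rightarrow> (int \<Rightarrow> 'w \<Rightarrow> 'k) \<Rightarrow> (int \<Rightarrow> 'w \<Rightarrow> real) \<Rightarrow> bool" where
  "cond_IA M K \<zeta> \<tau> \<longleftrightarrow>
     indep_processes M K \<zeta> borel \<tau> \<and> iid_process M K \<zeta> \<and> iid_process M borel \<tau>"

definition cond_AA ::
  "'w measure \<Rightarrow> (nat \<Rightarrow> (nat \<Rightarrow> real \<times> 'k) \<Rightarrow> real) \<Rightarrow> (int \<Rightarrow> 'w \<Rightarrow> 'k) \<Rightarrow> (int \<Rightarrow> 'w \<Rightarrow> real) \<Rightarrow>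
   nat \<Rightarrow> (nat \<Rightarrow> int \<Rightarrow> 'w \<Rightarrow> real) \<Rightarrow> bool" where
  "cond_AA M f \<zeta> T r Y \<longleftrightarrow>
     1 \<le> r \<and>
     (\<forall>i. AE w in M. maximal_dater f (\<lambda>k. \<zeta> k w) (\<lambda>k. T k w) i i = (\<Sum>j=1..r. Y j i w)) \<and>
     (\<forall>j\<in>{1..r}. \<forall>i. AE w in M. 0 \<le> Y j i w) \<and>
     iid_process M (\<Pi>\<^sub>M j\<in>{1..r}. borel) (\<lambda>i w. \<lambda>j\<in>{1..r}. Y j i w) \<and>
     indep_processes M (\<Pi>\<^sub>M j\<in>{1..r}. borel) (\<lambda>i w. \<lambda>j\<in>{1..r}. Y j i w) borel (interarrival T) \<and>
     (\<forall>n\<le>0. AE w in M.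
        (MAX j\<in>{1..r}. \<Sum>i=n..0. Y j i w) \<le> maximal_dater f (\<lambda>k. \<zeta> k w) (\<lambda>_. 0) n 0)"

definition cond_SE ::
  "'w measure \<Rightarrow> nat \<Rightarrow> (nat \<Rightarrow> int \<Rightarrow> 'w \<Rightarrow> real) \<Rightarrow> (real \<Rightarrow> real) \<Rightarrow> (nat \<Rightarrow> real) \<Rightarrow> bool" where
  "cond_SE M r Y F d \<longleftrightarrow>
     distribution_function_nonneg F \<and>
     subexponential F \<and> finite_mean F \<and>
     subexponential (integrated_tail_df F) \<and>
     (\<forall>j\<in>{1..r}. 0 \<le> d j \<and>
        tail_equiv (\<lambda>x. measure M {w \<in> space M. Y j 1 w > x}) (d j) (\<lambda>x. 1 - F x)) \<and>
     (\<Sum>j=1..r. d j) > 0"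

definition cond_H ::
  "'w measure \<Rightarrow> nat \<Rightarrow> (nat \<Rightarrow> int \<Rightarrow> 'w \<Rightarrow> real) \<Rightarrow> (real \<Rightarrow> real) \<Rightarrow> (nat \<Rightarrow> real) \<Rightarrow> bool" where
  "cond_H M r Y F d \<longleftrightarrow>
     tail_equiv (\<lambda>x. measure M {w \<in> space M. (\<Sum>j=1..r. Y j 1 w) > x}) 1
                (\<lambda>x. measure M {w \<in> space M. (MAX j\<in>{1..r}. Y j 1 w) > x}) \<and>
     tail_equiv (\<lambda>x. measure M {w \<in> space M. (MAX j\<in>{1..r}. Y j 1 w) > x}) 1
                (\<lambda>x. \<Sum>j=1..r. measure M {w \<in> space M. Y j 1 w > x}) \<and>
     tail_equiv (\<lambda>x. \<Sum>j=1..r. measure M {w \<in> space M. Y j 1 w > x}) (\<Sum>j=1..r. d j)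
                (\<lambda>x. 1 - F x)"

definition R_lower ::
  "nat \<Rightarrow> (nat \<Rightarrow> int \<Rightarrow> 'w \<Rightarrow> real) \<Rightarrow> (int \<Rightarrow> 'w \<Rightarrow> real) \<Rightarrow> 'w \<Rightarrow> ereal" where
  "R_lower r Y \<tau> w =
     (MAX j\<in>{1..r}. SUP n\<in>{..0::int}. ereal ((\<Sum>i=n..0. Y j i w) - (\<Sum>i=n..-1. \<tau> i w)))"

end

theory Submission
  imports Defs "HOL-Real_Asymp.Real_Asymp"
begin

text \<open>
  By external monotonicity \<open>Z\<close> dominates \<open>R_lower\<close>, and \<open>b j \<le> \<gamma>0 < a\<close> follows by
  taking expectations in (AA), so everything reduces to the tail of the maximum of \<open>r\<close> coupled random
  walks with drifts \<open>b j - a < 0\<close>.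

  Upper bound: by the union bound, one walk suffices (Veraverbeke's theorem, following Zachary). Let
  \<open>m = a - b j\<close> and restart the walk whenever it first exceeds the line \<open>L - n (m - \<epsilon>)\<close>. For
  large \<open>L\<close> this happens with probability at most \<open>\<epsilon>\<close>, and the height at that moment has tail
  asymptotically at most \<open>d j / (m - \<epsilon>)\<close> times the integrated tail. Subexponentiality turns the
  resulting inequality for \<open>P (max > x)\<close> into a contraction.

  Lower bound: a single jump \<open>Y j (- n) > x + C + n (a - b j + \<epsilon>)\<close> makes the maximum exceed \<open>x\<close>
  unless the walk has deviated from the law of large numbers; by independence and (H) two such jumps
  have negligible probability, so the probabilities add up.
\<close>

section \<open>Subexponential distributions\<close>

text \<open>The contraction presupposes a bound of order \<open>G\<close> on the very probability
  that is to be estimated. It is obtained from walks with finite horizon, by induction on the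
  horizon with one constant for all of them; hence the convolution estimate has to be uniform in the
  function to which it is applied. The slope of the line is \<open>m - \<epsilon>\<close> and not
  \<open>m\<close> because a walk with drift \<open>- m\<close> then moves away from the line: a
  high line is rarely crossed, and letting \<open>\<epsilon>\<close> tend to 0 restores the constant
  \<open>d j / m\<close>. The increments are not identically distributed: \<open>Y j 0\<close>
  enters without an interarrival time. Its tail is at most of the order of the tail of
  \<open>F\<close>, hence negligible against the integrated tail, and one more convolution absorbs
  it. In the lower bound, independence settles two jumps at different indices; components at the
  same index may depend on each other in any way, and only there (H) is needed. Grouping
  \<open>Y j (- n)\<close> with \<open>\<tau> (- n - 1)\<close> makes a jump independent of the
  drift accumulated before it.\<close>

lemma (in finite_measure) finite_measure_Union3:
  assumes "A \<in> sets M" "B \<in> sets M" "C \<in> sets M" "A \<inter> B = {}" "A \<inter> C = {}" "B \<inter> C = {}"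
  shows "measure M (A \<union> B \<union> C) = measure M A + measure M B + measure M C"
  using assms by (simp add: finite_measure_Union Int_Un_distrib2)

locale subexponential_df =
  fixes F :: "real \<Rightarrow> real"
  assumes subexponential: "subexponential F"
begin

abbreviation \<nu> :: "real measure" where "\<nu> \<equiv> interval_measure F"

abbreviation G :: "real \<Rightarrow> real" where "G x \<equiv> 1 - F x"

lemma mono_F: "mono F" and right_cont: "continuous (at_right x) F" and F_neg: "x < 0 \<Longrightarrow> F x = 0"
  and F_lim: "(F \<longlongrightarrow> 1) at_top" and F_less_1: "F x < 1"
  using subexponential by (auto simp: subexponential_def distribution_function_nonneg_def)

lemma G_pos: "0 < G x"
  using F_less_1[of x] by auto

lemma G_antimono: "x \<le> y \<Longrightarrow> G y \<le> G x"
  using monoD[OF mono_F] by auto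

lemma G_lim: "(G \<longlongrightarrow> 0) at_top"
  using tendsto_diff[OF tendsto_const F_lim, of 1] by simp

lemma F_lim_bot: "(F \<longlongrightarrow> 0) at_bot"
  by (rule tendsto_eventually) (auto simp: eventually_at_bot_dense intro!: exI[of _ 0] F_neg)

sublocale nu: real_distribution \<nu>
  by (intro real_distribution_interval_measure monoD[OF mono_F] right_cont F_lim_bot F_lim)

sublocale nunu: pair_prob_space \<nu> \<nu> ..

lemma measure_Iic: "measure \<nu> {..x} = F x"
  by (intro measure_interval_measure_Iic monoD[OF mono_F] right_cont F_lim_bot)

lemma measure_Ioi: "measure \<nu> {x<..} = G x"
proof -
  have "{x<..} = space \<nu> - {..x}" by auto
  then show ?thesis using nu.prob_compl[of "{..x}"] measure_Iic[of x] by simp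
qed

lemma AE_nonneg: "AE x in \<nu>. 0 \<le> x"
proof -
  have "AE x in \<nu>. \<forall>n. x \<notin> {.. - 1 / Suc n}"
  proof (subst AE_all_countable, intro allI)
    fix n
    have "measure \<nu> {.. - 1 / real (Suc n)} = 0"
      by (simp only: measure_Iic) (auto intro!: F_neg)
    then show "AE x in \<nu>. x \<notin> {.. - 1 / real (Suc n)}"
      by (intro AE_not_in) (auto simp: null_sets_def nu.emeasure_eq_measure)
  qed
  then show ?thesis
  proof eventually_elim
    case (elim x)
    show ?case
    proof (rule ccontr)
      assume "\<not> 0 \<le> x"
      then obtain n where "inverse (real (Suc n)) < - x"
        using reals_Archimedean[of "- x"] by auto
      then show False using elim[rule_format, of n] by (auto simp: field_simps)
    qed
  qed
qed

lemma measure_nonneg_part: "B \<in> sets borel \<Longrightarrow> measure \<nu> ({0..} \<inter> B) = measure \<nu> B"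
  by (intro nu.finite_measure_eq_AE) (use AE_nonneg in \<open>auto\<close>)

lemma measure_Icc0: "measure \<nu> {0..x} = F x"
  using measure_nonneg_part[of "{..x}"] by (simp add: measure_Iic Int_atMost atLeastAtMost_def)

lemma measure_Ici: "0 \<le> x \<Longrightarrow> measure \<nu> {0..} = 1"
  using measure_nonneg_part[of UNIV] nu.prob_space by simp

lemma sum_set: "{(y, z). x < y + z} \<in> sets (\<nu> \<Otimes>\<^sub>M \<nu>)"
proof -
  have "{w \<in> space (\<nu> \<Otimes>\<^sub>M \<nu>). x < fst w + snd w} \<in> sets (\<nu> \<Otimes>\<^sub>M \<nu>)" by measurable
  also have "{w \<in> space (\<nu> \<Otimes>\<^sub>M \<nu>). x < fst w + snd w} = {(y, z). x < y + z}"
    by (auto simp: space_pair_measure)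
  finally show ?thesis .
qed

lemma conv_tail: "1 - cdf (\<nu> \<star> \<nu>) x = measure (\<nu> \<Otimes>\<^sub>M \<nu>) {(y, z). x < y + z}"
proof -
  have "cdf (\<nu> \<star> \<nu>) x = measure (\<nu> \<Otimes>\<^sub>M \<nu>) ((\<lambda>(y, z). y + z) -` {..x} \<inter> space (\<nu> \<Otimes>\<^sub>M \<nu>))"
    unfolding cdf_def convolution_def by (rule measure_distr) auto
  also have "(\<lambda>(y, z). y + z) -` {..x} \<inter> space (\<nu> \<Otimes>\<^sub>M \<nu>) = space (\<nu> \<Otimes>\<^sub>M \<nu>) - {(y, z). x < y + z}"
    by (auto simp: space_pair_measure)
  finally have "cdf (\<nu> \<star> \<nu>) x = measure (\<nu> \<Otimes>\<^sub>M \<nu>) (space (\<nu> \<Otimes>\<^sub>M \<nu>) - {(y, z). x < y + z})" .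
  then show ?thesis
    using sum_set nunu.prob_compl[of "{(y, z). x < y + z}"] by simp
qed

lemma conv_ratio: "((\<lambda>x. measure (\<nu> \<Otimes>\<^sub>M \<nu>) {(y, z). x < y + z} / G x) \<longlongrightarrow> 2) at_top"
  using subexponential by (simp add: subexponential_def conv_tail)

lemma both_set: "{(y, z). A < y \<and> A < z \<and> x < y + z} \<in> sets (\<nu> \<Otimes>\<^sub>M \<nu>)"
proof -
  have "{w \<in> space (\<nu> \<Otimes>\<^sub>M \<nu>). A < fst w \<and> A < snd w \<and> x < fst w + snd w} \<in> sets (\<nu> \<Otimes>\<^sub>M \<nu>)"
    by measurable
  also have "{w \<in> space (\<nu> \<Otimes>\<^sub>M \<nu>). A < fst w \<and> A < snd w \<and> x < fst w + snd w}
    = {(y, z). A < y \<and> A < z \<and> x < y + z}"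
    by (auto simp: space_pair_measure)
  finally show ?thesis .
qed

lemma measure_times: "B \<in> sets borel \<Longrightarrow> C \<in> sets borel \<Longrightarrow> measure (\<nu> \<Otimes>\<^sub>M \<nu>) (B \<times> C) = measure \<nu> B * measure \<nu> C"
  by (simp add: measure_def nu.emeasure_pair_measure_Times enn2real_mult)

text \<open>Three disjoint parts of \<open>x < y + z\<close>: \<open>y\<close> beyond
  \<open>x\<close>; \<open>y\<close> at most \<open>A\<close> and \<open>z\<close> beyond
  \<open>x\<close>; \<open>y\<close> in \<open>(A, x]\<close> and \<open>z\<close> beyond
  \<open>x - A\<close>. Only the last one involves \<open>G (x - A)\<close>, the quantity that
  \<open>long_tailed\<close> has to control.\<close>

lemma conv_ge_long:
  assumes A: "0 \<le> A" "A \<le> x"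
  shows "G x + F A * G x + (F x - F A) * G (x - A) \<le> measure (\<nu> \<Otimes>\<^sub>M \<nu>) {(y, z). x < y + z}"
proof -
  let ?P = "\<nu> \<Otimes>\<^sub>M \<nu>"
  have 1: "measure ?P ({x<..} \<times> {0..}) = G x"
    by (subst measure_times) (use A in \<open>auto simp: measure_Ioi measure_Ici\<close>)
  have 2: "measure ?P ({0..A} \<times> {x<..}) = F A * G x"
    by (subst measure_times) (auto simp: measure_Ioi measure_Icc0)
  have 3: "measure ?P ({A<..x} \<times> {x - A<..}) = (F x - F A) * G (x - A)"
  proof -
    have "measure \<nu> {A<..x} = F x - F A"
      using measure_interval_measure_Ioc[of A x F] A monoD[OF mono_F] right_cont by auto
    then show ?thesis by (subst measure_times) (auto simp: measure_Ioi)
  qed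
  have "measure ?P ({x<..} \<times> {0..}) + measure ?P ({0..A} \<times> {x<..}) + measure ?P ({A<..x} \<times> {x - A<..})
    = measure ?P ({x<..} \<times> {0..} \<union> {0..A} \<times> {x<..} \<union> {A<..x} \<times> {x - A<..})"
    using A by (intro nunu.finite_measure_Union3[symmetric]) auto
  also have "\<dots> \<le> measure ?P {(y, z). x < y + z}"
    by (intro nunu.finite_measure_mono sum_set) auto
  finally show ?thesis by (simp only: 1 2 3)
qed

text \<open>The two disjoint parts where one coordinate alone passes \<open>x\<close> have mass
  \<open>F A * G x\<close> each. What is left of the limit 2 then bounds the event that both
  coordinates are large.\<close>

lemma conv_ge_both:
  assumes A: "0 \<le> A" "A \<le> x"
  shows "2 * F A * G x + measure (\<nu> \<Otimes>\<^sub>M \<nu>) {(y, z). A < y \<and> A < z \<and> x < y + z}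
     \<le> measure (\<nu> \<Otimes>\<^sub>M \<nu>) {(y, z). x < y + z}"
proof -
  let ?P = "\<nu> \<Otimes>\<^sub>M \<nu>" and ?B = "{(y, z). A < y \<and> A < z \<and> x < y + z}"
  have 1: "measure ?P ({x<..} \<times> {0..A}) = F A * G x"
    by (subst measure_times) (auto simp: measure_Ioi measure_Icc0)
  have 2: "measure ?P ({0..A} \<times> {x<..}) = F A * G x"
    by (subst measure_times) (auto simp: measure_Ioi measure_Icc0)
  have "measure ?P ({x<..} \<times> {0..A}) + measure ?P ({0..A} \<times> {x<..}) + measure ?P ?B
    = measure ?P ({x<..} \<times> {0..A} \<union> {0..A} \<times> {x<..} \<union> ?B)"
    using A both_set[of A x] by (intro nunu.finite_measure_Union3[symmetric]) auto
  also have "\<dots> \<le> measure ?P {(y, z). x < y + z}"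
    by (intro nunu.finite_measure_mono sum_set) auto
  finally show ?thesis by (simp add: 1 2)
qed

text \<open>Solving \<open>conv_ge_long\<close> for \<open>G (x - A)\<close> bounds it by
  \<open>G x\<close> times \<open>(K x - 1 - F A) / (F x - F A)\<close>. As \<open>K\<close> tends
  to 2 and \<open>F\<close> to 1, this factor tends to 1.\<close>

lemma long_tailed:
  assumes A: "0 \<le> A" and c: "1 < c"
  shows "eventually (\<lambda>x. G (x - A) \<le> c * G x) at_top"
proof -
  define K where "K x = measure (\<nu> \<Otimes>\<^sub>M \<nu>) {(y, z). x < y + z} / G x" for x
  have "((\<lambda>x. (K x - 1 - F A) / (F x - F A)) \<longlongrightarrow> (2 - 1 - F A) / (1 - F A)) at_top"
    using F_less_1[of A] conv_ratio unfolding K_def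
    by (intro tendsto_intros F_lim) auto
  then have "((\<lambda>x. (K x - 1 - F A) / (F x - F A)) \<longlongrightarrow> 1) at_top"
    using F_less_1[of A] by simp
  from order_tendstoD(2)[OF this c]
    have "eventually (\<lambda>x. (K x - 1 - F A) / (F x - F A) < c) at_top" .
  moreover have "eventually (\<lambda>x. F A < F x) at_top"
    using order_tendstoD(1)[OF F_lim F_less_1] .
  ultimately show ?thesis using eventually_ge_at_top[of A]
  proof eventually_elim
    case (elim x)
    have "(F x - F A) * G (x - A) \<le> (K x - 1 - F A) * G x"
    proof -
      have "K x * G x = measure (\<nu> \<Otimes>\<^sub>M \<nu>) {(y, z). x < y + z}"
        using G_pos[of x] by (simp add: K_def)
      then show ?thesis using conv_ge_long[of A x] A elim by (simp add: left_diff_distrib)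
    qed
    also have "\<dots> \<le> c * (F x - F A) * G x"
      using elim G_pos[of x] by (intro mult_right_mono) (auto simp: field_simps)
    finally have "(F x - F A) * G (x - A) \<le> (F x - F A) * (c * G x)" by (simp add: mult_ac)
    then show ?case using elim by (simp add: mult_le_cancel_left_pos)
  qed
qed

text \<open>The convolution tail is eventually below \<open>(2 + G A) * G x\<close>; subtracting
  \<open>2 * F A * G x\<close> leaves \<open>3 * G A * G x\<close>. One of the three
  \<open>G A\<close> is the slack granted to the limit.\<close>

lemma both_large:
  assumes A: "0 \<le> A"
  shows "eventually (\<lambda>x. measure (\<nu> \<Otimes>\<^sub>M \<nu>) {(y, z). A < y \<and> A < z \<and> x < y + z} \<le> 3 * G A * G x) at_top"
proof -
  have "eventually (\<lambda>x. measure (\<nu> \<Otimes>\<^sub>M \<nu>) {(y, z). x < y + z} / G x < 2 + G A) at_top"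
    using G_pos[of A] by (intro order_tendstoD(2)[OF conv_ratio]) simp
  then show ?thesis using eventually_ge_at_top[of A]
  proof eventually_elim
    case (elim x)
    have "measure (\<nu> \<Otimes>\<^sub>M \<nu>) {(y, z). x < y + z} \<le> (2 + G A) * G x"
      using elim G_pos[of x] by (simp add: field_simps)
    then show ?case using conv_ge_both[of A x] A elim by (simp add: algebra_simps)
  qed
qed

end

section \<open>Convolution with a subexponential tail\<close>

lemma nn_integral_add3:
  assumes [measurable]: "f \<in> borel_measurable M" "g \<in> borel_measurable M" "h \<in> borel_measurable M"
  shows "(\<integral>\<^sup>+w. f w + g w + h w \<partial>M) = (\<integral>\<^sup>+w. f w \<partial>M) + (\<integral>\<^sup>+w. g w \<partial>M) + (\<integral>\<^sup>+w. h w \<partial>M)"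
  by (simp add: nn_integral_add)

context subexponential_df begin

lemma emeasure_Ioi: "emeasure \<nu> {x<..} = ennreal (G x)"
  by (simp add: nu.emeasure_eq_measure measure_Ioi)

text \<open>A jump exceeding \<open>x - A\<close> costs \<open>\<kappa> G x\<close>; jumps at most \<open>A\<close> leave the job to \<open>h\<close>; the
  intermediate jumps are negligible by \<open>both_large\<close>.\<close>

lemma convolution_bound:
  fixes M :: "'w measure" and \<phi> :: "'w \<Rightarrow> real"
  assumes "prob_space M" and E[measurable]: "E \<in> sets M" and [measurable]: "\<phi> \<in> borel_measurable M"
    and \<kappa>: "0 \<le> \<kappa>" and \<epsilon>: "0 < \<epsilon>"
    and tail: "eventually (\<lambda>y. measure M {w \<in> E. y < \<phi> w} \<le> \<kappa> * G y) at_top"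
  shows "eventually (\<lambda>A. eventually (\<lambda>x. \<forall>h \<beta>. 0 \<le> \<beta> \<longrightarrow> (\<forall>y. h y \<le> 1) \<longrightarrow> (\<forall>y\<ge>A. h y \<le> \<beta> * G y) \<longrightarrow>
     (\<integral>\<^sup>+w. indicator E w * ennreal (h (x - \<phi> w)) \<partial>M)
       \<le> ennreal (((1 + \<epsilon>) * \<kappa> + ((1 + \<epsilon>) * measure M E + \<epsilon>) * \<beta>) * G x)) at_top) at_top"
proof -
  interpret M: prob_space M by fact
  interpret P: pair_prob_space M \<nu> ..
  have m1[measurable, simp]: "{w \<in> E. c < \<phi> w} \<in> sets M" for c
  proof -
    have "{w \<in> E. c < \<phi> w} = E \<inter> {w \<in> space M. c < \<phi> w}"
      using sets.sets_into_space[OF E] by auto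
    then show ?thesis by simp
  qed
  obtain y0 where y0: "\<And>y. y \<ge> y0 \<Longrightarrow> measure M {w \<in> E. y < \<phi> w} \<le> \<kappa> * G y"
    using tail by (auto simp: eventually_at_top_linorder)
  \<comment> \<open>The 3 is that of \<open>both_large\<close>: for such \<open>A\<close> the
    intermediate jumps contribute at most \<open>\<beta> * \<epsilon> * G x\<close>.\<close>
  have "((\<lambda>A. 3 * \<kappa> * G A) \<longlongrightarrow> 3 * \<kappa> * 0) at_top"
    by (intro tendsto_mult tendsto_const G_lim)
  then have "eventually (\<lambda>A. 3 * \<kappa> * G A < \<epsilon>) at_top"
    using \<epsilon> by (intro order_tendstoD(2)) auto
  then show ?thesis using eventually_ge_at_top[of y0] eventually_ge_at_top[of 0]
  proof eventually_elim
    case (elim A)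
    note A = elim
    have long: "eventually (\<lambda>x. G (x - A) \<le> (1 + \<epsilon>) * G x) at_top"
      using A \<epsilon> by (intro long_tailed) auto
    \<comment> \<open>The threshold for \<open>x\<close> is fixed before \<open>h\<close> and
      \<open>\<beta>\<close> are chosen, so one threshold serves all horizons of a walk.\<close>
    show ?case using long both_large[OF A(3)] eventually_ge_at_top[of "2 * A"] 
    proof eventually_elim
      case (elim x)
      show ?case
      proof (intro allI impI)
        fix h :: "real \<Rightarrow> real" and \<beta> :: real
        assume \<beta>: "0 \<le> \<beta>" and h1: "\<forall>y. h y \<le> 1" and h: "\<forall>y\<ge>A. h y \<le> \<beta> * G y"
        let ?c1 = "\<lambda>w. indicator {w \<in> E. x - A < \<phi> w} w :: ennreal"
        let ?c2 = "\<lambda>w. ennreal (\<beta> * G (x - A)) * indicator E w"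
        let ?J = "\<lambda>w. indicator E w * indicator {w. A < \<phi> w \<and> \<phi> w \<le> x - A} w :: ennreal"
        let ?c3 = "\<lambda>w. ennreal \<beta> * (?J w * emeasure \<nu> {x - \<phi> w<..})"
        \<comment> \<open>Beyond \<open>x - A\<close> only \<open>h \<le> 1\<close> is used. In the
          other two cases the argument of \<open>h\<close> is at least \<open>A\<close>, for
          \<open>\<phi> w \<le> A\<close> because \<open>2 * A \<le> x\<close>, so the bound by
          \<open>\<beta> * G\<close> applies.\<close>
        have pw: "indicator E w * ennreal (h (x - \<phi> w)) \<le> ?c1 w + ?c2 w + ?c3 w" for w
        proof (cases "w \<in> E")
          case True
          consider "x - A < \<phi> w" | "\<phi> w \<le> A" | "A < \<phi> w" "\<phi> w \<le> x - A" by linarith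
          then show ?thesis
          proof cases
            case 1
            have "ennreal (h (x - \<phi> w)) \<le> 1" using h1 by (simp add: ennreal_le_1)
            then have "indicator E w * ennreal (h (x - \<phi> w)) \<le> ?c1 w" using True 1 by simp
            then show ?thesis by (meson add_increasing2 order_trans zero_le)
          next
            case 2
            have "h (x - \<phi> w) \<le> \<beta> * G (x - \<phi> w)" using h 2 elim by auto
            also have "\<dots> \<le> \<beta> * G (x - A)" using 2 \<beta> by (intro mult_left_mono G_antimono) auto
            finally have "indicator E w * ennreal (h (x - \<phi> w)) \<le> ?c2 w" using True
              by (simp add: ennreal_leI)
            then show ?thesis by (meson add_increasing2 add_increasing order_trans zero_le)
          next
            case 3
            have "h (x - \<phi> w) \<le> \<beta> * G (x - \<phi> w)" using h 3 elim by auto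
            then have "indicator E w * ennreal (h (x - \<phi> w)) \<le> ?c3 w" using True 3 \<beta> G_pos[of "x - \<phi> w"]
              by (simp add: emeasure_Ioi ennreal_mult[symmetric] less_imp_le ennreal_leI del: G_pos)
            then show ?thesis by (meson add_increasing2 add_increasing order_trans zero_le)
          qed
        qed simp
        have mB: "(\<lambda>(w, z). indicator E w * indicator {(y, z). A < y \<and> A < z \<and> x < y + z} (\<phi> w, z) :: ennreal)
            \<in> borel_measurable (M \<Otimes>\<^sub>M \<nu>)"
        proof -
          have "(\<lambda>p. (\<phi> (fst p), snd p)) \<in> measurable (M \<Otimes>\<^sub>M \<nu>) (\<nu> \<Otimes>\<^sub>M \<nu>)" by measurable
          from measurable_compose[OF this borel_measurable_indicator[OF both_set[of A x]]]
          have "(\<lambda>p. indicator {(y, z). A < y \<and> A < z \<and> x < y + z} (\<phi> (fst p), snd p) :: ennreal)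
              \<in> borel_measurable (M \<Otimes>\<^sub>M \<nu>)" .
          then show ?thesis by (simp add: split_beta' borel_measurable_times_ennreal)
        qed
        have mG[measurable]: "(\<lambda>w. emeasure \<nu> {x - \<phi> w<..}) \<in> borel_measurable M"
        proof -
          have "G \<in> borel_measurable borel"
            using borel_measurable_mono[OF mono_F] by simp
          then have "(\<lambda>w. ennreal (G (x - \<phi> w))) \<in> borel_measurable M"
            by (intro measurable_compose[OF _ measurable_ennreal] measurable_compose[where f="\<lambda>w. x - \<phi> w" and g=G]) auto
          then show ?thesis by (simp add: emeasure_Ioi)
        qed
        have "(\<integral>\<^sup>+w. ?J w * emeasure \<nu> {x - \<phi> w<..} \<partial>M)
            = (\<integral>\<^sup>+w. (\<integral>\<^sup>+z. ?J w * indicator {z. x < \<phi> w + z} z \<partial>\<nu>) \<partial>M)"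
        proof (intro nn_integral_cong)
          fix w
          have "{z. x < \<phi> w + z} = {x - \<phi> w<..}" by auto
          then show "?J w * emeasure \<nu> {x - \<phi> w<..} = (\<integral>\<^sup>+z. ?J w * indicator {z. x < \<phi> w + z} z \<partial>\<nu>)"
            by (subst nn_integral_cmult) auto
        qed
        also have "\<dots> \<le> (\<integral>\<^sup>+w. (\<integral>\<^sup>+z. indicator E w * indicator {(y, z). A < y \<and> A < z \<and> x < y + z} (\<phi> w, z) \<partial>\<nu>) \<partial>M)"
          by (intro nn_integral_mono) (auto simp: indicator_def)
        \<comment> \<open>With the order of integration exchanged, only the tail of
          \<open>\<phi>\<close> matters for fixed \<open>z\<close>. It is bounded by
          \<open>\<kappa>\<close> times the tail of \<open>\<nu>\<close>, so a second independent
          variable with law \<open>\<nu>\<close> takes the place of \<open>\<phi>\<close>.\<close>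
        also have "\<dots> = (\<integral>\<^sup>+z. (\<integral>\<^sup>+w. indicator E w * indicator {(y, z). A < y \<and> A < z \<and> x < y + z} (\<phi> w, z) \<partial>M) \<partial>\<nu>)"
          by (intro P.Fubini'[symmetric] mB)
        also have "\<dots> \<le> (\<integral>\<^sup>+z. ennreal \<kappa> * (\<integral>\<^sup>+y. indicator {(y, z). A < y \<and> A < z \<and> x < y + z} (z, y) \<partial>\<nu>) \<partial>\<nu>)"
        proof (intro nn_integral_mono)
          fix z
          \<comment> \<open>For \<open>A < z\<close> the two conditions on \<open>\<phi> w\<close>
            merge into exceeding \<open>?m\<close>, and \<open>y0 \<le> A \<le> ?m\<close> makes the
            tail bound available at this level.\<close>
          let ?m = "max A (x - z)"
          show "(\<integral>\<^sup>+w. indicator E w * indicator {(y, z). A < y \<and> A < z \<and> x < y + z} (\<phi> w, z) \<partial>M)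
            \<le> ennreal \<kappa> * (\<integral>\<^sup>+y. indicator {(y, z). A < y \<and> A < z \<and> x < y + z} (z, y) \<partial>\<nu>)"
          proof (cases "A < z")
            case True
            have "(\<integral>\<^sup>+w. indicator E w * indicator {(y, z). A < y \<and> A < z \<and> x < y + z} (\<phi> w, z) \<partial>M)
              = (\<integral>\<^sup>+w. indicator {w \<in> E. ?m < \<phi> w} w \<partial>M)"
              using True by (intro nn_integral_cong) (auto simp: indicator_def)
            also have "\<dots> = ennreal (measure M {w \<in> E. ?m < \<phi> w})"
              by (simp add: M.emeasure_eq_measure)
            also have "\<dots> \<le> ennreal (\<kappa> * G ?m)"
              using A by (intro ennreal_leI y0) auto
            also have "\<dots> = ennreal \<kappa> * emeasure \<nu> {?m<..}"
              using \<kappa> G_pos[of ?m] by (simp add: emeasure_Ioi ennreal_mult)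
            also have "emeasure \<nu> {?m<..} = (\<integral>\<^sup>+y. indicator {?m<..} y \<partial>\<nu>)" by simp
            also have "\<dots> = (\<integral>\<^sup>+y. indicator {(y, z). A < y \<and> A < z \<and> x < y + z} (z, y) \<partial>\<nu>)"
              using True by (intro nn_integral_cong) (auto simp: indicator_def)
            finally show ?thesis .
          qed (simp add: indicator_def)
        qed
        also have "\<dots> = ennreal \<kappa> * (\<integral>\<^sup>+z. (\<integral>\<^sup>+y. indicator {(y, z). A < y \<and> A < z \<and> x < y + z} (z, y) \<partial>\<nu>) \<partial>\<nu>)"
          by (intro nn_integral_cmult nu.borel_measurable_nn_integral)
            (use borel_measurable_indicator[OF both_set[of A x]] in \<open>simp add: split_beta'\<close>)
        also have "\<dots> = ennreal \<kappa> * emeasure (\<nu> \<Otimes>\<^sub>M \<nu>) {(y, z). A < y \<and> A < z \<and> x < y + z}"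
          using both_set[of A x] by (subst nu.emeasure_pair_measure) auto
        also have "\<dots> = ennreal (\<kappa> * measure (\<nu> \<Otimes>\<^sub>M \<nu>) {(y, z). A < y \<and> A < z \<and> x < y + z})"
          using \<kappa> by (simp add: nunu.emeasure_eq_measure ennreal_mult)
        also have "\<dots> \<le> ennreal (\<kappa> * (3 * G A * G x))"
          using elim \<kappa> by (intro ennreal_leI mult_left_mono) auto
        also have "\<dots> \<le> ennreal (\<epsilon> * G x)"
          using mult_right_mono[of "3 * \<kappa> * G A" \<epsilon> "G x"] A G_pos[of x] by (intro ennreal_leI) (simp add: mult_ac)
        finally have i3: "(\<integral>\<^sup>+w. ?c3 w \<partial>M) \<le> ennreal (\<beta> * (\<epsilon> * G x))"
          using \<beta> \<epsilon> G_pos[of x] by (subst nn_integral_cmult) (auto simp: ennreal_mult intro!: mult_left_mono)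
        have "(\<integral>\<^sup>+w. ?c1 w \<partial>M) = ennreal (measure M {w \<in> E. x - A < \<phi> w})"
          by (simp add: M.emeasure_eq_measure)
        also have "\<dots> \<le> ennreal (\<kappa> * G (x - A))"
          using A elim y0[of A]  by (intro ennreal_leI y0) auto
        also have "\<dots> \<le> ennreal (\<kappa> * ((1 + \<epsilon>) * G x))"
          using elim \<kappa> by (intro ennreal_leI mult_left_mono) auto
        finally have i1: "(\<integral>\<^sup>+w. ?c1 w \<partial>M) \<le> ennreal (\<kappa> * ((1 + \<epsilon>) * G x))" .
        have "(\<integral>\<^sup>+w. ?c2 w \<partial>M) = ennreal (\<beta> * G (x - A) * measure M E)"
          using \<beta> G_pos[of "x - A"] by (subst nn_integral_cmult) (auto simp: M.emeasure_eq_measure ennreal_mult[symmetric] less_imp_le)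
        also have "\<dots> \<le> ennreal (\<beta> * ((1 + \<epsilon>) * G x) * measure M E)"
          using elim \<beta> by (intro ennreal_leI mult_left_mono mult_right_mono) auto
        finally have i2: "(\<integral>\<^sup>+w. ?c2 w \<partial>M) \<le> ennreal (\<beta> * ((1 + \<epsilon>) * G x) * measure M E)" .
        have "(\<integral>\<^sup>+w. indicator E w * ennreal (h (x - \<phi> w)) \<partial>M) \<le> (\<integral>\<^sup>+w. ?c1 w + ?c2 w + ?c3 w \<partial>M)"
          by (intro nn_integral_mono pw)
        also have "\<dots> = (\<integral>\<^sup>+w. ?c1 w \<partial>M) + (\<integral>\<^sup>+w. ?c2 w \<partial>M) + (\<integral>\<^sup>+w. ?c3 w \<partial>M)"
          by (rule nn_integral_add3; measurable)
        also have "\<dots> \<le> ennreal (\<kappa> * ((1 + \<epsilon>) * G x)) + ennreal (\<beta> * ((1 + \<epsilon>) * G x) * measure M E) + ennreal (\<beta> * (\<epsilon> * G x))"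
          by (intro add_mono i1 i2 i3)
        also have "\<dots> = ennreal (\<kappa> * ((1 + \<epsilon>) * G x) + \<beta> * ((1 + \<epsilon>) * G x) * measure M E + \<beta> * (\<epsilon> * G x))"
        proof -
          have "0 \<le> \<kappa> * ((1 + \<epsilon>) * G x)" "0 \<le> \<beta> * ((1 + \<epsilon>) * G x) * measure M E" "0 \<le> \<beta> * (\<epsilon> * G x)"
            using \<beta> \<kappa> \<epsilon> G_pos[of x] by (auto intro!: mult_nonneg_nonneg)
          then show ?thesis by (simp only: ennreal_plus add_nonneg_nonneg)
        qed
        also have "\<kappa> * ((1 + \<epsilon>) * G x) + \<beta> * ((1 + \<epsilon>) * G x) * measure M E + \<beta> * (\<epsilon> * G x)
          = ((1 + \<epsilon>) * \<kappa> + ((1 + \<epsilon>) * measure M E + \<epsilon>) * \<beta>) * G x"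
          by (simp only: distrib_right distrib_left mult_ac)
        finally show "(\<integral>\<^sup>+w. indicator E w * ennreal (h (x - \<phi> w)) \<partial>M)
           \<le> ennreal (((1 + \<epsilon>) * \<kappa> + ((1 + \<epsilon>) * measure M E + \<epsilon>) * \<beta>) * G x)" .
      qed
    qed
  qed
qed

end

section \<open>Random walks with negative drift\<close>

lemma (in prob_space) distr_pair_snd:
  assumes "sigma_finite_measure N"
  shows "distr (M \<Otimes>\<^sub>M N) N snd = N"
proof (rule measure_eqI)
  interpret N: sigma_finite_measure N by fact
  fix A assume A: "A \<in> sets (distr (M \<Otimes>\<^sub>M N) N snd)"
  then have "emeasure (distr (M \<Otimes>\<^sub>M N) N snd) A = emeasure (M \<Otimes>\<^sub>M N) (snd -` A \<inter> space (M \<Otimes>\<^sub>M N))"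
    by (simp add: emeasure_distr)
  also have "snd -` A \<inter> space (M \<Otimes>\<^sub>M N) = space M \<times> A"
    using A sets.sets_into_space[of A N] by (auto simp: space_pair_measure)
  also have "emeasure (M \<Otimes>\<^sub>M N) (space M \<times> A) = emeasure N A"
    using A by (subst N.emeasure_pair_measure_Times) (auto simp: emeasure_space_1)
  finally show "emeasure (distr (M \<Otimes>\<^sub>M N) N snd) A = emeasure N A" .
qed simp

section \<open>Running maxima and their boundedness under negative drift\<close>

abbreviation psum :: "(nat \<Rightarrow> real) \<Rightarrow> nat \<Rightarrow> real" where
  "psum x n \<equiv> \<Sum>k<n. x k"

text \<open>The maximum of the partial sums up to time \<open>n\<close>, in the form of Lindley's
  recursion: the effect of prepending a step can be read off directly, which is what the
  stationarity argument needs.\<close>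

primrec running_max :: "nat \<Rightarrow> (nat \<Rightarrow> real) \<Rightarrow> real" where
  "running_max 0 x = 0"
| "running_max (Suc n) x = max 0 (x 0 + running_max n (\<lambda>k. x (Suc k)))"

lemma psum_Suc_shift: "psum x (Suc n) = x 0 + psum (\<lambda>k. x (Suc k)) n"
  by (rule sum.lessThan_Suc_shift)

lemma running_max_nonneg: "0 \<le> running_max n x"
  by (cases n) auto

lemma running_max_Suc_mono: "running_max n x \<le> running_max (Suc n) x"
proof (induction n arbitrary: x)
  case (Suc n)
  show ?case using Suc[of "\<lambda>k. x (Suc k)"] by (subst (1 2) running_max.simps) auto
qed simp

lemma running_max_mono: "m \<le> n \<Longrightarrow> running_max m x \<le> running_max n x"
  using running_max_Suc_mono by (rule lift_Suc_mono_le)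

lemma psum_le_running_max: "psum x n \<le> running_max n x"
proof (induction n arbitrary: x)
  case (Suc n)
  show ?case using Suc[of "\<lambda>k. x (Suc k)"] by (subst psum_Suc_shift) simp
qed simp

lemma running_max_le_abs: "running_max n x \<le> (\<Sum>k<n. \<bar>x k\<bar>)"
proof (induction n arbitrary: x)
  case (Suc n)
  show ?case using Suc[of "\<lambda>k. x (Suc k)"]
    by (subst sum.lessThan_Suc_shift) (auto simp: abs_if sum_nonneg intro: order_trans)
qed simp

locale random_walk = real_distribution M for M :: "real measure"
begin

sublocale seq: sequence_space M
  by unfold_locales

abbreviation \<Omega> :: "(nat \<Rightarrow> real) measure" where "\<Omega> \<equiv> \<Pi>\<^sub>M i\<in>UNIV. M"

sublocale MO: pair_prob_space M \<Omega> ..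
sublocale OO: pair_prob_space \<Omega> \<Omega> ..

lemma space_Omega [simp]: "space \<Omega> = UNIV"
  by (simp add: space_PiM)

lemma measurable_coord: "(\<lambda>\<omega>. \<omega> n) \<in> borel_measurable \<Omega>"
proof -
  have "(\<lambda>\<omega>. \<omega> n) \<in> measurable \<Omega> M" by simp
  then show ?thesis by simp
qed

lemma measurable_shift: "(\<lambda>\<omega> k. \<omega> (Suc k)) \<in> measurable \<Omega> \<Omega>"
  by (rule measurable_PiM_single') (simp_all add: measurable_component_singleton)

lemma measurable_running_max [measurable]: "running_max n \<in> borel_measurable \<Omega>"
proof (induction n)
  case (Suc n)
  have "(\<lambda>\<omega>. running_max n (\<lambda>k. \<omega> (Suc k))) \<in> borel_measurable \<Omega>"
    by (rule measurable_compose[OF measurable_shift Suc])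
  then have "(\<lambda>\<omega>. max 0 (\<omega> 0 + running_max n (\<lambda>k. \<omega> (Suc k)))) \<in> borel_measurable \<Omega>"
    by (intro borel_measurable_max borel_measurable_add measurable_coord) auto
  then show ?case by simp
next
  case 0
  have "running_max 0 = (\<lambda>_. 0)" by auto
  then show ?case by simp
qed

lemma measurable_case_nat: "(\<lambda>p. case_nat (fst p) (snd p)) \<in> measurable (M \<Otimes>\<^sub>M \<Omega>) \<Omega>"
proof (rule measurable_PiM_single')
  show "(\<lambda>w. case_nat (fst w) (snd w) i) \<in> measurable (M \<Otimes>\<^sub>M \<Omega>) M" for i
  proof (cases i)
    case (Suc n)
    show ?thesis unfolding Suc
      by (simp add: measurable_compose[OF measurable_snd measurable_component_singleton])
  qed simp
qed simp

lemma distr_case_nat: "distr (M \<Otimes>\<^sub>M \<Omega>) \<Omega> (\<lambda>p. case_nat (fst p) (snd p)) = \<Omega>"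
  using seq.PiM_iter by (simp add: split_beta')

lemma running_max_case_nat: "running_max (Suc n) (case_nat s \<omega>) = max 0 (s + running_max n \<omega>)"
  by simp

lemma integrable_coord:
  assumes "integrable M (\<lambda>x. x)" shows "integrable \<Omega> (\<lambda>\<omega>. \<omega> k)"
proof -
  have "integrable (distr \<Omega> M (\<lambda>\<omega>. \<omega> k)) (\<lambda>x. x)" using assms by (simp add: seq.PiM_component)
  then show ?thesis by (subst (asm) integrable_distr_eq) auto
qed

lemma integrable_running_max:
  assumes "integrable M (\<lambda>x. x)" shows "integrable \<Omega> (running_max n)"
proof (rule Bochner_Integration.integrable_bound)
  show "integrable \<Omega> (\<lambda>\<omega>. \<Sum>k<n. \<bar>\<omega> k\<bar>)"
    using integrable_coord[OF assms] by (intro Bochner_Integration.integrable_sum integrable_abs)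
  show "AE x in \<Omega>. norm (running_max n x) \<le> norm (\<Sum>k<n. \<bar>x k\<bar>)"
    using running_max_le_abs running_max_nonneg
    by (intro AE_I2) (simp add: abs_of_nonneg sum_nonneg)
qed (rule measurable_running_max)

text \<open>On the shift-invariant event \<open>U\<close> that the running maximum diverges,
  \<open>running_max (Suc n) (case_nat s \<omega>) - running_max n \<omega>\<close> tends to \<open>s\<close>. Its integral over \<open>U\<close> is
  nonnegative by stationarity, so the independent \<open>s\<close> would need a nonnegative mean.\<close>

lemma running_max_bounded:
  assumes int: "integrable M (\<lambda>x. x)" and neg: "(LINT x|M. x) < 0"
  shows "AE \<omega> in \<Omega>. \<exists>L::nat. \<forall>n. running_max n \<omega> \<le> real L"
proof -
  define U where "U = {\<omega>. \<forall>L::nat. \<exists>n. real L < running_max n \<omega>}"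
  have U[measurable]: "U \<in> sets \<Omega>"
  proof -
    have "{\<omega> \<in> space \<Omega>. \<forall>L::nat. \<exists>n. real L < running_max n \<omega>} \<in> sets \<Omega>" by measurable
    then show ?thesis by (simp add: U_def)
  qed
  \<comment> \<open>Prepending \<open>s\<close> changes the running maximum by at most
    \<open>\<bar>s\<bar>\<close> and shifts the index by one; neither affects divergence.\<close>
  have U_case: "case_nat s \<omega> \<in> U \<longleftrightarrow> \<omega> \<in> U" for s \<omega>
  proof
    assume u: "case_nat s \<omega> \<in> U"
    show "\<omega> \<in> U" unfolding U_def
    proof safe
      fix L :: nat
      obtain L' :: nat where L': "real L + \<bar>s\<bar> \<le> real L'" by (meson real_arch_simple)
      then obtain n where n: "real L' < running_max n (case_nat s \<omega>)" using u by (auto simp: U_def)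
      then have "n \<noteq> 0" using L' by (cases n) auto
      then obtain m where m: "n = Suc m" by (cases n) auto
      show "\<exists>n. real L < running_max n \<omega>"
        using n L' unfolding m running_max_case_nat by (intro exI[of _ m]) (auto simp: max_def split: if_splits)
    qed
  next
    assume u: "\<omega> \<in> U"
    show "case_nat s \<omega> \<in> U" unfolding U_def
    proof safe
      fix L :: nat
      obtain L' :: nat where L': "real L + \<bar>s\<bar> \<le> real L'" by (meson real_arch_simple)
      then obtain n where n: "real L' < running_max n \<omega>" using u by (auto simp: U_def)
      show "\<exists>n. real L < running_max n (case_nat s \<omega>)"
        using n L' by (intro exI[of _ "Suc n"]) (auto simp: max_def simp del: running_max.simps simp: running_max_case_nat)
    qed
  qed
  let ?P = "M \<Otimes>\<^sub>M \<Omega>"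
  define g where "g n p = indicator U (snd p) * (max 0 (fst p + running_max n (snd p)) - running_max n (snd p))" for n p
  have fst_int: "integrable ?P fst"
  proof -
    have "integrable (distr ?P M fst) (\<lambda>x. x)"
      using int seq.P.distr_pair_fst[of M] by simp
    then show ?thesis by (subst (asm) integrable_distr_eq) auto
  qed
  have dsnd: "distr ?P \<Omega> snd = \<Omega>"
    by (rule distr_pair_snd) unfold_locales
  have iU: "integrable \<Omega> (\<lambda>\<omega>. indicator U \<omega> * running_max n \<omega>)" for n
    using integrable_mult_indicator[OF U integrable_running_max[OF int]] by simp
  \<comment> \<open>Both terms are the same type of functional, applied to sequences that both have
    the law of \<open>\<Omega>\<close>. The integral of \<open>g n\<close> is thus the difference of
    two consecutive terms of a nondecreasing sequence.\<close>
  have g_eq: "g n p = indicator U (case_nat (fst p) (snd p)) * running_max (Suc n) (case_nat (fst p) (snd p))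
      - indicator U (snd p) * running_max n (snd p)" for n p
    by (simp add: g_def U_case indicator_def)
  have i1: "integrable ?P (\<lambda>p. indicator U (case_nat (fst p) (snd p)) * running_max n (case_nat (fst p) (snd p)))" 
    and e1: "(LINT p|?P. indicator U (case_nat (fst p) (snd p)) * running_max n (case_nat (fst p) (snd p)))
       = (LINT \<omega>|\<Omega>. indicator U \<omega> * running_max n \<omega>)" for n
    using integrable_distr_eq[OF measurable_case_nat, of "\<lambda>\<omega>. indicator U \<omega> * running_max n \<omega>"]
      integral_distr[OF measurable_case_nat, of "\<lambda>\<omega>. indicator U \<omega> * running_max n \<omega>"] iU[of n]
    by (simp_all add: distr_case_nat)
  have i2: "integrable ?P (\<lambda>p. indicator U (snd p) * running_max n (snd p))"
    and e2: "(LINT p|?P. indicator U (snd p) * running_max n (snd p)) = (LINT \<omega>|\<Omega>. indicator U \<omega> * running_max n \<omega>)" for n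
    using integrable_distr_eq[OF measurable_snd[of M \<Omega>], of "\<lambda>\<omega>. indicator U \<omega> * running_max n \<omega>"]
      integral_distr[OF measurable_snd[of M \<Omega>], of "\<lambda>\<omega>. indicator U \<omega> * running_max n \<omega>"] iU[of n]
    by (simp_all add: dsnd)
  have g_int: "integrable ?P (g n)" for n
    unfolding g_eq by (intro Bochner_Integration.integrable_diff i1 i2)
  have g_nonneg: "0 \<le> (LINT p|?P. g n p)" for n
  proof -
    have "(LINT p|?P. g n p) = (LINT \<omega>|\<Omega>. indicator U \<omega> * running_max (Suc n) \<omega>) - (LINT \<omega>|\<Omega>. indicator U \<omega> * running_max n \<omega>)"
      unfolding g_eq by (subst Bochner_Integration.integral_diff[OF i1 i2]) (simp only: e1 e2)
    moreover have "(LINT \<omega>|\<Omega>. indicator U \<omega> * running_max n \<omega>) \<le> (LINT \<omega>|\<Omega>. indicator U \<omega> * running_max (Suc n) \<omega>)"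
      by (intro integral_mono iU mult_left_mono running_max_Suc_mono) auto
    ultimately show ?thesis by simp
  qed
  have "(\<lambda>n. LINT p|?P. g n p) \<longlonglongrightarrow> (LINT p|?P. indicator U (snd p) * fst p)"
  proof (rule integral_dominated_convergence[where w="\<lambda>p. \<bar>fst p\<bar>"])
    show "integrable ?P (\<lambda>p. \<bar>fst p\<bar>)" using fst_int by (rule integrable_abs)
    show "AE p in ?P. (\<lambda>n. g n p) \<longlonglongrightarrow> indicator U (snd p) * fst p"
    proof (intro AE_I2)
      fix p :: "real \<times> (nat \<Rightarrow> real)"
      show "(\<lambda>n. g n p) \<longlonglongrightarrow> indicator U (snd p) * fst p"
      proof (cases "snd p \<in> U")
        case True
        obtain L' :: nat where L': "\<bar>fst p\<bar> \<le> real L'" by (meson real_arch_simple)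
        then obtain N where N: "real L' < running_max N (snd p)" using True by (auto simp: U_def)
        \<comment> \<open>Once the running maximum exceeds \<open>\<bar>fst p\<bar>\<close>, the cut
          at 0 is inactive and the difference is exactly \<open>fst p\<close>.\<close>
        have "eventually (\<lambda>n. g n p = indicator U (snd p) * fst p) sequentially"
          using eventually_ge_at_top[of N]
        proof eventually_elim
          case (elim n)
          then show ?case using running_max_mono[OF elim, of "snd p"] N L' True by (simp add: g_def)
        qed
        then show ?thesis by (rule tendsto_eventually)
      qed (simp add: g_def)
    qed
    show "AE p in ?P. norm (g n p) \<le> \<bar>fst p\<bar>" for n
      using running_max_nonneg by (intro AE_I2) (auto simp: g_def indicator_def max_def abs_if; smt)
    show "g n \<in> borel_measurable ?P" for n using g_int by auto
  qed (use fst_int in measurable)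
  then have "0 \<le> (LINT p|?P. indicator U (snd p) * fst p)"
    by (rule LIMSEQ_le_const) (use g_nonneg in auto)
  also have "(LINT p|?P. indicator U (snd p) * fst p) = (LINT s|M. (LINT \<omega>|\<Omega>. indicator U \<omega> * s))"
  proof (subst MO.integral_fst'[symmetric])
    show "integrable ?P (\<lambda>p. indicator U (snd p) * fst p)"
      using fst_int by (rule Bochner_Integration.integrable_bound) (auto simp: indicator_def)
  qed simp
  also have "\<dots> = seq.P.prob U * (LINT s|M. s)"
    by simp
  finally have "seq.P.prob U = 0"
    using neg measure_nonneg[of \<Omega> U] by (simp add: zero_le_mult_iff)
  then have "AE \<omega> in \<Omega>. \<omega> \<notin> U"
    by (intro AE_not_in) (simp add: null_sets_def seq.P.emeasure_eq_measure)
  then show ?thesis by eventually_elim (auto simp: U_def not_less)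
qed

end

section \<open>Integrated tails\<close>

locale heavy_tail =
  fixes F :: "real \<Rightarrow> real"
  assumes F_subexponential: "subexponential F"
    and integrated_tail_subexponential: "subexponential (integrated_tail_df F)"
begin

sublocale Fs: subexponential_df "integrated_tail_df F"
  by unfold_locales (rule integrated_tail_subexponential)

sublocale F: subexponential_df F
  by unfold_locales (rule F_subexponential)

abbreviation G :: "real \<Rightarrow> real" where "G x \<equiv> 1 - integrated_tail_df F x"
abbreviation H :: "real \<Rightarrow> real" where "H x \<equiv> 1 - F x"

text \<open>A non-integrable tail would have Lebesgue integral 0, hence \<open>integrated_tail_df F x = 1\<close>.\<close>

lemma set_integrable_tail: "0 \<le> x \<Longrightarrow> set_integrable lborel {x..} H"
proof (rule ccontr)
  assume "0 \<le> x" "\<not> set_integrable lborel {x..} H"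
  then have "integrated_tail_df F x = 1"
    by (simp add: integrated_tail_df_def set_lebesgue_integral_def set_integrable_def not_integrable_integral_eq)
  then show False using Fs.F_less_1[of x] by simp
qed

lemma tail_integral_split:
  assumes x: "0 \<le> x" and c: "0 \<le> c"
  shows "(LBINT u:{x..}. H u) = (LBINT u:{x..<x+c}. H u) + (LBINT u:{x+c..}. H u)"
proof -
  have "{x..} = {x..<x+c} \<union> {x+c..}" using c by auto
  then show ?thesis
    using x c by (simp only:) (intro set_integral_Un set_integrable_subset[OF set_integrable_tail[OF x]]; auto)
qed

lemma tail_integral_bounds:
  assumes x: "0 \<le> x" and c: "0 \<le> c"
  shows "c * H (x + c) \<le> (LBINT u:{x..<x+c}. H u)" "(LBINT u:{x..<x+c}. H u) \<le> c * H x"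
proof -
  have i: "set_integrable lborel {x..<x+c} H"
    by (rule set_integrable_subset[OF set_integrable_tail[OF x]]) auto
  have k: "set_integrable lborel {x..<x+c} (\<lambda>_. k)" for k :: real
    using c by (simp add: set_integrable_def integrable_indicator_iff)
  have lb: "(LBINT u:{x..<x+c}. k) = c * k" for k :: real
    using c by (simp add: set_lebesgue_integral_def)
  have "(LBINT u:{x..<x+c}. H (x + c)) \<le> (LBINT u:{x..<x+c}. H u)"
    by (intro set_integral_mono k i F.G_antimono) auto
  then show "c * H (x + c) \<le> (LBINT u:{x..<x+c}. H u)" by (simp only: lb)
  have "(LBINT u:{x..<x+c}. H u) \<le> (LBINT u:{x..<x+c}. H x)"
    by (intro set_integral_mono k i F.G_antimono) auto
  then show "(LBINT u:{x..<x+c}. H u) \<le> c * H x" by (simp only: lb)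
qed

text \<open>\<open>G\<close> tends to 0, and a value below 1 shows that the truncation at 1 is
  inactive.\<close>

lemma G_eq_tail_integral: "eventually (\<lambda>x. G x = (LBINT u:{x..}. H u)) at_top"
proof -
  have "eventually (\<lambda>x. G x < 1) at_top"
    by (intro order_tendstoD(2)[OF Fs.G_lim]) simp
  then show ?thesis using eventually_ge_at_top[of 0]
    by eventually_elim (auto simp: integrated_tail_df_def min_def split: if_splits)
qed

lemma G_increment:
  "eventually (\<lambda>x. \<forall>c\<ge>0. c * H (x + c) \<le> G x - G (x + c) \<and> G x - G (x + c) \<le> c * H x) at_top"
proof -
  obtain X where X: "\<And>x. x \<ge> X \<Longrightarrow> G x = (LBINT u:{x..}. H u)"
    using G_eq_tail_integral by (auto simp: eventually_at_top_linorder)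
  show ?thesis using eventually_ge_at_top[of "max 0 X"]
  proof eventually_elim
    case (elim x)
    show ?case
    proof (intro allI impI)
      fix c :: real assume c: "0 \<le> c"
      have "G x = (LBINT u:{x..}. H u)" "G (x + c) = (LBINT u:{x + c..}. H u)"
        using X[of x] X[of "x + c"] elim c by auto
      then show "c * H (x + c) \<le> G x - G (x + c) \<and> G x - G (x + c) \<le> c * H x"
        using tail_integral_split[of x c] tail_integral_bounds[of x c] elim c by simp
    qed
  qed
qed

text \<open>Monotonicity on \<open>[x, x + c]\<close> gives \<open>c * H (x + c) \<le> G x\<close>,
  and since \<open>F\<close> is long-tailed, \<open>H x\<close> is eventually at most
  \<open>2 * H (x + c)\<close>. The interval length \<open>c\<close> is free, which makes the ratio
  as small as desired.\<close>

lemma H_negligible: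
  assumes e: "0 < e"
  shows "eventually (\<lambda>x. H x \<le> e * G x) at_top"
proof -
  define c where "c = 2 / e"
  have c: "0 < c" using e by (simp add: c_def)
  have "eventually (\<lambda>x. H (x - c) \<le> 2 * H x) at_top"
    using c by (intro F.long_tailed) auto
  then have "eventually (\<lambda>x. H ((x + c) - c) \<le> 2 * H (x + c)) at_top"
    by (rule eventually_compose_filterlim) real_asymp
  then show ?thesis using G_increment
  proof eventually_elim
    case (elim x)
    have "c * H (x + c) \<le> G x - G (x + c)" using elim(2) c by auto
    also have "\<dots> \<le> G x" using Fs.G_pos[of "x + c"] by simp
    finally have "H (x + c) \<le> e / 2 * G x" using e by (simp add: c_def field_simps)
    then show ?case using elim(1) by simp
  qed
qed

text \<open>A Riemann sum of mesh \<open>c\<close> for the integrated tail. The term at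
  \<open>x\<close> has no mesh interval to its left inside \<open>[x, \<infinity>)\<close> and is
  paid for by \<open>H_negligible\<close>, whence the \<open>e\<close>.\<close>

lemma H_sum_le:
  assumes c: "0 < c" and e: "0 < e"
  shows "eventually (\<lambda>x. \<forall>N. (\<Sum>n<N. H (x + real n * c)) \<le> (1 / c + e) * G x) at_top"
  using H_negligible[OF e] eventually_all_ge_at_top[OF G_increment]
proof eventually_elim
  case (elim x)
  show ?case
  proof
    fix N
    have "c * (\<Sum>n<Suc N. H (x + real n * c)) \<le> c * H x + (G x - G (x + real N * c))"
    proof (induction N)
      case (Suc N)
      have "c * H ((x + real N * c) + c) \<le> G (x + real N * c) - G ((x + real N * c) + c)"
        using elim(2) c by auto
      then show ?case using Suc unfolding sum.lessThan_Suc[of _ "Suc N"] by (simp add: algebra_simps)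
    qed simp
    moreover have "c * (\<Sum>n<N. H (x + real n * c)) \<le> c * (\<Sum>n<Suc N. H (x + real n * c))"
      using c F.G_pos[of "x + real N * c"] by simp
    ultimately have "c * (\<Sum>n<N. H (x + real n * c)) \<le> c * H x + G x"
      using Fs.G_pos[of "x + real N * c"] by linarith
    also have "\<dots> \<le> c * (e * G x) + G x" using elim(1) c by simp
    finally show "(\<Sum>n<N. H (x + real n * c)) \<le> (1 / c + e) * G x"
      using c by (simp add: field_simps)
  qed
qed

text \<open>The same comparison with the mesh interval to the right of each point. The finite sum
  leaves \<open>G (x + real N * c)\<close>, which vanishes when \<open>N\<close> tends to
  infinity.\<close>

lemma H_sum_ge:
  assumes c: "0 < c"
  shows "eventually (\<lambda>x. \<forall>N. (G x - G (x + real N * c)) / c \<le> (\<Sum>n<N. H (x + real n * c))) at_top"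
  using eventually_all_ge_at_top[OF G_increment]
proof eventually_elim
  case (elim x)
  show ?case
  proof
    fix N
    have "G x - G (x + real N * c) \<le> c * (\<Sum>n<N. H (x + real n * c))"
    proof (induction N)
      case (Suc N)
      have "G (x + real N * c) - G ((x + real N * c) + c) \<le> c * H (x + real N * c)"
        using elim c by auto
      then show ?case using Suc by (simp add: algebra_simps)
    qed simp
    then show "(G x - G (x + real N * c)) / c \<le> (\<Sum>n<N. H (x + real n * c))"
      using c by (simp add: field_simps)
  qed
qed

end

section \<open>Linear boundaries for partial sums of i.i.d. variables\<close>

lemma (in prob_space) distr_iid_sequence:
  assumes "indep_vars (\<lambda>_. N) X (UNIV :: nat set)" "\<And>n. distr M N (X n) = D"
  shows "distr M (\<Pi>\<^sub>M n\<in>UNIV. N) (\<lambda>w n. X n w) = (\<Pi>\<^sub>M n\<in>UNIV. D)"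
  using indep_vars_iff_distr_eq_PiM[where I=UNIV and M'="\<lambda>_. N" and X=X] assms
  by (simp add: indep_vars_def restrict_UNIV)

text \<open>The variables \<open>X n - c\<close> have negative mean, so their partial sums are
  almost surely bounded, and continuity from above yields the level \<open>L\<close>. It is used
  twice: to make a passage over the sloping line unlikely, and to confine the past of a big
  jump.\<close>

lemma (in prob_space) iid_psum_bounded:
  fixes X :: "nat \<Rightarrow> 'a \<Rightarrow> real"
  assumes ind: "indep_vars (\<lambda>_. borel) X UNIV" and id: "\<And>n. distr M borel (X n) = D"
    and int: "integrable M (X 0)" and mean: "expectation (X 0) < c" and \<delta>: "0 < \<delta>"
  obtains L where "0 \<le> L" "prob {w \<in> space M. \<exists>n. L + real n * c < (\<Sum>k<n. X k w)} \<le> \<delta>"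
proof -
  have X[measurable]: "X n \<in> borel_measurable M" for n using ind by (simp add: indep_vars_def)
  define D' where "D' = distr M borel (\<lambda>w. X 0 w - c)"
  interpret D': random_walk D'
    by (simp add: random_walk_def real_distribution_def real_distribution_axioms_def D'_def prob_space_distr)
  have ind': "indep_vars (\<lambda>_. borel) (\<lambda>n w. X n w - c) UNIV"
    using indep_vars_compose2[OF ind, of "\<lambda>_ x. x - c" "\<lambda>_. borel"] by simp
  have id': "distr M borel (\<lambda>w. X n w - c) = D'" for n
  proof -
    have "distr M borel (\<lambda>w. X n w - c) = distr (distr M borel (X n)) borel (\<lambda>x. x - c)" for n
      by (subst distr_distr) (auto simp: comp_def)
    then show ?thesis using id by (simp add: D'_def)
  qed
  have dist: "distr M (\<Pi>\<^sub>M n\<in>UNIV. borel) (\<lambda>w n. X n w - c) = D'.\<Omega>"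
    by (rule distr_iid_sequence[OF ind' id'])
  have "AE \<omega> in D'.\<Omega>. \<exists>L::nat. \<forall>n. running_max n \<omega> \<le> real L"
  proof (rule D'.running_max_bounded)
    show "integrable D' (\<lambda>x. x)" using int by (simp add: D'_def integrable_distr_eq)
    show "(LINT x|D'. x) < 0" using int mean by (simp add: D'_def integral_distr prob_space)
  qed
  then have "AE \<omega> in D'.\<Omega>. \<exists>L::nat. \<forall>n. psum \<omega> n \<le> real L"
    by eventually_elim (meson order_trans psum_le_running_max)
  then have "AE \<omega> in distr M (\<Pi>\<^sub>M n\<in>UNIV. borel) (\<lambda>w n. X n w - c). \<exists>L::nat. \<forall>n. psum \<omega> n \<le> real L"
    by (simp only: dist)
  then have "AE w in M. \<exists>L::nat. \<forall>n. (\<Sum>k<n. X k w - c) \<le> real L"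
    by (rule AE_distrD[rotated]) (rule measurable_PiM_single', auto)
  then have ae: "AE w in M. \<exists>L::nat. \<forall>n. (\<Sum>k<n. X k w) \<le> real L + real n * c"
    by (simp add: sum_subtractf algebra_simps)
  define B where "B L = {w \<in> space M. \<exists>n. real L + real n * c < (\<Sum>k<n. X k w)}" for L :: nat
  have B: "B L \<in> sets M" for L unfolding B_def by measurable
  have "(\<lambda>L. prob (B L)) \<longlonglongrightarrow> prob (\<Inter>L. B L)"
  proof (intro finite_Lim_measure_decseq)
    show "decseq B"
    proof (intro decseq_SucI subsetI)
      fix L w assume "w \<in> B (Suc L)"
      then obtain n where "w \<in> space M" "real (Suc L) + real n * c < (\<Sum>k<n. X k w)" by (auto simp: B_def)
      then show "w \<in> B L" unfolding B_def by (auto intro!: exI[of _ n])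
    qed
  qed (use B in auto)
  also have "prob (\<Inter>L. B L) = 0"
  proof -
    have "AE w in M. w \<notin> (\<Inter>L. B L)" using ae
    proof eventually_elim
      case (elim w)
      then obtain L :: nat where "\<forall>n. (\<Sum>k<n. X k w) \<le> real L + real n * c" by blast
      then have "w \<notin> B L" by (auto simp: B_def not_less)
      then show ?case by blast
    qed
    then show ?thesis using B by (subst prob_eq_0) auto
  qed
  finally have "eventually (\<lambda>L. prob (B L) < \<delta>) sequentially"
    by (rule order_tendstoD(2)) fact
  then obtain L where "prob (B L) < \<delta>" by (auto simp: eventually_sequentially)
  then show thesis by (intro that[of "real L"]) (auto simp: B_def)
qed

section \<open>First passage over a sloping line\<close>

lemma psum_comb_seq_prefix: "n \<le> m \<Longrightarrow> psum (comb_seq m \<omega> \<omega>') n = psum \<omega> n"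
  by (intro sum.cong) (auto simp: comb_seq_def)

lemma psum_comb_seq_add: "psum (comb_seq m \<omega> \<omega>') (m + k) = psum \<omega> m + psum \<omega>' k"
  by (induction k) (auto simp: psum_comb_seq_prefix comb_seq_def)

text \<open>Index \<open>n\<close> stands for time \<open>Suc n\<close>. A passage thus consumes at
  least one step, which is what lowers the remaining horizon by one in
  \<open>hits_Suc_le\<close>.\<close>

definition passes :: "real \<Rightarrow> real \<Rightarrow> nat \<Rightarrow> (nat \<Rightarrow> real) \<Rightarrow> bool" where
  "passes L c n \<omega> \<longleftrightarrow> L - real (Suc n) * c < psum \<omega> (Suc n)"

definition first_passes :: "real \<Rightarrow> real \<Rightarrow> nat \<Rightarrow> (nat \<Rightarrow> real) \<Rightarrow> bool" where
  "first_passes L c n \<omega> \<longleftrightarrow> passes L c n \<omega> \<and> (\<forall>k<n. \<not> passes L c k \<omega>)"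

text \<open>Without a passage the value is unspecified; the height is only evaluated on the event
  that a passage exists.\<close>

definition passage_height :: "real \<Rightarrow> real \<Rightarrow> (nat \<Rightarrow> real) \<Rightarrow> real" where
  "passage_height L c \<omega> = psum \<omega> (Suc (LEAST n. passes L c n \<omega>))"

lemma first_passes_height: "first_passes L c n \<omega> \<Longrightarrow> passage_height L c \<omega> = psum \<omega> (Suc n)"
  unfolding first_passes_def passage_height_def
  by (intro arg_cong[where f="\<lambda>n. psum \<omega> (Suc n)"] Least_equality) (auto simp: not_less[symmetric])

lemma ex_first_passes: "(\<exists>n. passes L c n \<omega>) \<longleftrightarrow> (\<exists>n. first_passes L c n \<omega>)"
  unfolding first_passes_def by (meson exists_least_iff)

lemma first_passes_unique: "first_passes L c n \<omega> \<Longrightarrow> first_passes L c m \<omega> \<Longrightarrow> n = m"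
  unfolding first_passes_def by (meson linorder_neqE_nat)

text \<open>The stopping time property: the event is decided by the first \<open>Suc n\<close>
  coordinates, which \<open>comb_seq\<close> leaves untouched.\<close>

lemma first_passes_comb_seq: "first_passes L c n (comb_seq (Suc n) \<omega> \<omega>') \<longleftrightarrow> first_passes L c n \<omega>"
  unfolding first_passes_def passes_def by (auto simp: psum_comb_seq_prefix simp del: sum.lessThan_Suc)

context random_walk begin

lemma measurable_passes [measurable]: "Measurable.pred \<Omega> (passes L c n)"
  unfolding passes_def by measurable

lemma measurable_first_passes [measurable]: "Measurable.pred \<Omega> (first_passes L c n)"
  unfolding first_passes_def by measurable

lemma measurable_passage_height [measurable]: "passage_height L c \<in> borel_measurable \<Omega>"
proof -
  have l: "(\<lambda>\<omega>. LEAST n. passes L c n \<omega>) \<in> measurable \<Omega> (count_space UNIV)" by measurable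
  show ?thesis unfolding passage_height_def
    by (rule measurable_compose_countable[OF _ l]) measurable
qed

text \<open>The Markov property at a fixed time: the first \<open>m\<close> steps are those of
  \<open>\<omega>\<close>, after which an independent copy \<open>\<omega>'\<close> takes
  over.\<close>

lemma emeasure_comb_seq:
  assumes B: "B \<in> sets \<Omega>"
  shows "emeasure \<Omega> B = (\<integral>\<^sup>+\<omega>. emeasure \<Omega> {\<omega>'. comb_seq m \<omega> \<omega>' \<in> B} \<partial>\<Omega>)"
proof -
  have "emeasure \<Omega> B = emeasure (distr (\<Omega> \<Otimes>\<^sub>M \<Omega>) \<Omega> (\<lambda>(\<omega>, \<omega>'). comb_seq m \<omega> \<omega>')) B"
    by (simp add: seq.PiM_comb_seq)
  also have "\<dots> = emeasure (\<Omega> \<Otimes>\<^sub>M \<Omega>) ((\<lambda>(\<omega>, \<omega>'). comb_seq m \<omega> \<omega>') -` B \<inter> space (\<Omega> \<Otimes>\<^sub>M \<Omega>))"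
    by (rule emeasure_distr[OF measurable_comb_seq B])
  also have "\<dots> = (\<integral>\<^sup>+\<omega>. emeasure \<Omega> (Pair \<omega> -` ((\<lambda>(\<omega>, \<omega>'). comb_seq m \<omega> \<omega>') -` B \<inter> space (\<Omega> \<Otimes>\<^sub>M \<Omega>))) \<partial>\<Omega>)"
    by (rule seq.P.emeasure_pair_measure_alt) (rule measurable_sets[OF measurable_comb_seq B])
  also have "\<dots> = (\<integral>\<^sup>+\<omega>. emeasure \<Omega> {\<omega>'. comb_seq m \<omega> \<omega>' \<in> B} \<partial>\<Omega>)"
    by (intro nn_integral_cong arg_cong[where f="emeasure \<Omega>"]) (auto simp: space_pair_measure)
  finally show ?thesis .
qed

definition hits :: "nat \<Rightarrow> real \<Rightarrow> (nat \<Rightarrow> real) set" where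
  "hits N x = {\<omega>. \<exists>k\<le>N. x < psum \<omega> k}"

definition hits_inf :: "real \<Rightarrow> (nat \<Rightarrow> real) set" where
  "hits_inf x = {\<omega>. \<exists>k. x < psum \<omega> k}"

lemma sets_hits [measurable]: "hits N x \<in> sets \<Omega>"
proof -
  have "{\<omega> \<in> space \<Omega>. \<exists>k\<le>N. x < psum \<omega> k} \<in> sets \<Omega>" by measurable
  then show ?thesis by (simp add: hits_def)
qed

lemma sets_hits_inf [measurable]: "hits_inf x \<in> sets \<Omega>"
proof -
  have "{\<omega> \<in> space \<Omega>. \<exists>k. x < psum \<omega> k} \<in> sets \<Omega>" by measurable
  then show ?thesis by (simp add: hits_inf_def)
qed

lemma sets_passes [measurable]: "{\<omega>. \<exists>n. passes L c n \<omega>} \<in> sets \<Omega>"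
proof -
  have "{\<omega> \<in> space \<Omega>. \<exists>n. passes L c n \<omega>} \<in> sets \<Omega>" by measurable
  then show ?thesis by simp
qed

lemma hits_LIMSEQ: "(\<lambda>N. measure \<Omega> (hits N x)) \<longlonglongrightarrow> measure \<Omega> (hits_inf x)"
proof -
  have "hits_inf x = (\<Union>N. hits N x)" by (auto simp: hits_inf_def hits_def)
  moreover have "(\<lambda>N. measure \<Omega> (hits N x)) \<longlonglongrightarrow> measure \<Omega> (\<Union>N. hits N x)"
    by (intro seq.P.finite_Lim_measure_incseq) (use sets_hits in \<open>auto simp: incseq_def hits_def intro: order_trans\<close>)
  ultimately show ?thesis by simp
qed

text \<open>The strong Markov property at the first passage, obtained by summing over its time. The
  line lies nowhere above \<open>L \<le> x\<close>, so a path exceeding \<open>x\<close> has passed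
  it by then; the fresh walk has to climb from the height reached, with at most \<open>N\<close>
  steps left.\<close>

lemma hits_Suc_le:
  assumes L: "0 \<le> L" and c: "0 \<le> c" and x: "L \<le> x"
  shows "emeasure \<Omega> (hits (Suc N) x) \<le>
    (\<integral>\<^sup>+\<omega>. indicator {\<omega>. \<exists>n. passes L c n \<omega>} \<omega> * ennreal (measure \<Omega> (hits N (x - passage_height L c \<omega>))) \<partial>\<Omega>)"
proof -
  define B where "B n = {\<omega>. first_passes L c n \<omega> \<and> (\<exists>k\<le>N. x < psum \<omega> (Suc n + k))}" for n
  have B[measurable]: "B n \<in> sets \<Omega>" for n
  proof -
    have "{\<omega> \<in> space \<Omega>. first_passes L c n \<omega> \<and> (\<exists>k\<le>N. x < psum \<omega> (Suc n + k))} \<in> sets \<Omega>" by measurable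
    then show ?thesis by (simp add: B_def)
  qed
  have sub: "hits (Suc N) x \<subseteq> (\<Union>n. B n)"
  proof
    fix \<omega> assume "\<omega> \<in> hits (Suc N) x"
    then obtain k where k: "k \<le> Suc N" "x < psum \<omega> k" by (auto simp: hits_def)
    have k0: "k \<noteq> 0" using k L x by (cases k) auto
    then obtain k' where k': "k = Suc k'" by (cases k) auto
    have "passes L c k' \<omega>" using k x c mult_nonneg_nonneg[of "real (Suc k')" c] unfolding passes_def k' by linarith
    then obtain n where n: "first_passes L c n \<omega>" "n \<le> k'"
      using exists_least_iff[of "\<lambda>n. passes L c n \<omega>"] unfolding first_passes_def by (metis not_le)
    then have "k' - n \<le> N" "x < psum \<omega> (Suc n + (k' - n))" using k by (auto simp: k')
    then have "\<omega> \<in> B n" using n unfolding B_def by blast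
    then show "\<omega> \<in> (\<Union>n. B n)" by blast
  qed
  have Bn: "emeasure \<Omega> (B n) = (\<integral>\<^sup>+\<omega>. indicator {\<omega>. first_passes L c n \<omega>} \<omega> *
      ennreal (measure \<Omega> (hits N (x - passage_height L c \<omega>))) \<partial>\<Omega>)" for n
  proof (subst emeasure_comb_seq[OF B, of n "Suc n"], intro nn_integral_cong)
    fix \<omega> :: "nat \<Rightarrow> real"
    show "emeasure \<Omega> {\<omega>'. comb_seq (Suc n) \<omega> \<omega>' \<in> B n} =
      indicator {\<omega>. first_passes L c n \<omega>} \<omega> * ennreal (measure \<Omega> (hits N (x - passage_height L c \<omega>)))"
    proof (cases "first_passes L c n \<omega>")
      case True
      have "{\<omega>'. comb_seq (Suc n) \<omega> \<omega>' \<in> B n} = hits N (x - passage_height L c \<omega>)"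
        using True unfolding B_def hits_def mem_Collect_eq first_passes_comb_seq psum_comb_seq_add
          first_passes_height[OF True] by (auto simp: algebra_simps)
      then show ?thesis using True by (simp add: seq.P.emeasure_eq_measure)
    next
      case False
      then have "{\<omega>'. comb_seq (Suc n) \<omega> \<omega>' \<in> B n} = {}"
        by (auto simp: B_def first_passes_comb_seq)
      then show ?thesis using False by simp
    qed
  qed
  have mh: "(\<lambda>\<omega>. ennreal (measure \<Omega> (hits N (x - passage_height L c \<omega>)))) \<in> borel_measurable \<Omega>"
  proof -
    \<comment> \<open>The hitting probability is antitone in the level, so measurability is derived
      for its negative.\<close>
    have "mono (\<lambda>y. - measure \<Omega> (hits N y))"
      by (intro monoI le_imp_neg_le seq.P.finite_measure_mono sets_hits) (auto simp: hits_def)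
    from borel_measurable_uminus[OF borel_measurable_mono[OF this]]
    have [measurable]: "(\<lambda>y. measure \<Omega> (hits N y)) \<in> borel_measurable borel" by simp
    show ?thesis by measurable
  qed
  have "emeasure \<Omega> (hits (Suc N) x) \<le> emeasure \<Omega> (\<Union>n. B n)"
    by (intro emeasure_mono sub) auto
  also have "\<dots> \<le> (\<Sum>n. emeasure \<Omega> (B n))"
    by (intro emeasure_subadditive_countably) auto
  also have "\<dots> = (\<integral>\<^sup>+\<omega>. (\<Sum>n. indicator {\<omega>. first_passes L c n \<omega>} \<omega> *
      ennreal (measure \<Omega> (hits N (x - passage_height L c \<omega>)))) \<partial>\<Omega>)"
    unfolding Bn
  proof (intro nn_integral_suminf[symmetric] borel_measurable_times_ennreal mh)
    fix n
    have "{\<omega> \<in> space \<Omega>. first_passes L c n \<omega>} \<in> sets \<Omega>" by measurable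
    then show "indicator {\<omega>. first_passes L c n \<omega>} \<in> borel_measurable \<Omega>" by simp
  qed
  also have "\<dots> = (\<integral>\<^sup>+\<omega>. indicator {\<omega>. \<exists>n. passes L c n \<omega>} \<omega> * ennreal (measure \<Omega> (hits N (x - passage_height L c \<omega>))) \<partial>\<Omega>)"
  proof (intro nn_integral_cong)
    fix \<omega> :: "nat \<Rightarrow> real"
    let ?m = "ennreal (measure \<Omega> (hits N (x - passage_height L c \<omega>)))"
    show "(\<Sum>n. indicator {\<omega>. first_passes L c n \<omega>} \<omega> * ?m) = indicator {\<omega>. \<exists>n. passes L c n \<omega>} \<omega> * ?m"
    proof (cases "\<exists>n. passes L c n \<omega>")
      case True
      then obtain n where n: "first_passes L c n \<omega>" by (auto simp: ex_first_passes)
      have "(\<Sum>k. indicator {\<omega>. first_passes L c k \<omega>} \<omega> * ?m) = (\<Sum>k\<in>{n}. indicator {\<omega>. first_passes L c k \<omega>} \<omega> * ?m)"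
        using n first_passes_unique by (intro suminf_finite) (auto simp: indicator_def)
      then show ?thesis using True n by simp
    next
      case False
      then have "\<And>n. \<not> first_passes L c n \<omega>" by (simp add: ex_first_passes)
      then show ?thesis using False by simp
    qed
  qed
  finally show ?thesis .
qed

text \<open>Just before the first passage at index \<open>n\<close> the walk is at most
  \<open>L - n * c\<close>; for \<open>n = 0\<close> this is \<open>0 \<le> L\<close>. A height
  above \<open>y\<close> therefore forces the single step \<open>\<omega> n\<close> above
  \<open>y - L + n * c\<close>, and the union bound over \<open>n\<close> applies.\<close>

lemma passage_tail_le:
  assumes bound: "\<And>N. (\<Sum>n<N. measure M {y - L + real n * c<..}) \<le> b" and L: "0 \<le> L"
  shows "measure \<Omega> {\<omega> \<in> {\<omega>. \<exists>n. passes L c n \<omega>}. y < passage_height L c \<omega>} \<le> b"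
proof -
  define J where "J n = {\<omega>. y - L + real n * c < \<omega> n}" for n :: nat
  have J_eq: "J n = (\<lambda>\<omega>. \<omega> n) -` {y - L + real n * c<..} \<inter> space \<Omega>" for n
    by (auto simp: J_def)
  have J: "J n \<in> sets \<Omega>" for n
    unfolding J_eq by (rule measurable_sets[OF measurable_coord]) simp
  have mJ: "emeasure \<Omega> (J n) = ennreal (measure M {y - L + real n * c<..})" for n
  proof -
    have "emeasure \<Omega> (J n) = emeasure (distr \<Omega> M (\<lambda>\<omega>. \<omega> n)) {y - L + real n * c<..}"
      unfolding J_eq by (rule emeasure_distr[symmetric]) auto
    also have "distr \<Omega> M (\<lambda>\<omega>. \<omega> n) = M" by (rule seq.PiM_component) auto
    finally show ?thesis by (simp add: emeasure_eq_measure)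
  qed
  have sub: "{\<omega> \<in> {\<omega>. \<exists>n. passes L c n \<omega>}. y < passage_height L c \<omega>} \<subseteq> (\<Union>n. J n)"
  proof safe
    fix \<omega> n assume "passes L c n \<omega>" and y: "y < passage_height L c \<omega>"
    then obtain n where n: "first_passes L c n \<omega>" using ex_first_passes by blast
    have "psum \<omega> n \<le> L - real n * c"
    proof (cases n)
      case (Suc k)
      then have "\<not> passes L c k \<omega>" using n by (auto simp: first_passes_def)
      then show ?thesis by (simp add: passes_def Suc)
    qed (use L in simp)
    moreover have "y < psum \<omega> n + \<omega> n" using y first_passes_height[OF n] by simp
    ultimately show "\<omega> \<in> (\<Union>n. J n)" by (auto simp: J_def intro!: exI[of _ n])
  qed
  have b: "0 \<le> b" using bound[of 0] by simp
  have "emeasure \<Omega> {\<omega> \<in> {\<omega>. \<exists>n. passes L c n \<omega>}. y < passage_height L c \<omega>} \<le> emeasure \<Omega> (\<Union>n. J n)"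
    using J by (intro emeasure_mono sub) auto
  also have "\<dots> \<le> (\<Sum>n. emeasure \<Omega> (J n))"
    using J by (intro emeasure_subadditive_countably) auto
  also have "\<dots> \<le> ennreal b"
    using bound by (intro suminf_le_const) (auto simp: mJ sum_ennreal intro: ennreal_leI)
  finally show ?thesis
    using b by (simp add: seq.P.emeasure_eq_measure)
qed

end

section \<open>The upper bound for the maximum of one random walk\<close>

context random_walk begin

lemma distr_coord_borel: "distr \<Omega> borel (\<lambda>\<omega>. \<omega> n) = M"
proof -
  have "distr \<Omega> borel (\<lambda>\<omega>. \<omega> n) = distr \<Omega> M (\<lambda>\<omega>. \<omega> n)"
    by (rule distr_cong) auto
  also have "\<dots> = M" by (rule seq.PiM_component) auto
  finally show ?thesis .
qed

lemma indep_vars_coord: "seq.P.indep_vars (\<lambda>_. borel) (\<lambda>n \<omega>. \<omega> n) (UNIV :: nat set)"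
proof (subst seq.P.indep_vars_iff_distr_eq_PiM)
  have "distr \<Omega> (\<Pi>\<^sub>M i\<in>UNIV. borel) (\<lambda>x. \<lambda>i\<in>UNIV. x i) = distr \<Omega> \<Omega> (\<lambda>x. x)"
    by (rule distr_cong) (auto simp: restrict_UNIV intro!: sets_PiM_cong)
  then show "distr \<Omega> (\<Pi>\<^sub>M i\<in>UNIV. borel) (\<lambda>x. \<lambda>i\<in>UNIV. x i) = (\<Pi>\<^sub>M i\<in>UNIV. distr \<Omega> borel (\<lambda>\<omega>. \<omega> i))"
    by (simp add: distr_coord_borel)
qed (auto intro: measurable_coord)

text \<open>The line descends with slope \<open>- c\<close>, more slowly than the mean of the walk,
  so \<open>iid_psum_bounded\<close> applies with \<open>- c\<close> as its slope.\<close>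

lemma passage_unlikely:
  assumes int: "integrable M (\<lambda>x. x)" and c: "(LINT x|M. x) < - c" and \<delta>: "0 < \<delta>"
  obtains L where "0 \<le> L" "measure \<Omega> {\<omega>. \<exists>n. passes L c n \<omega>} \<le> \<delta>"
proof -
  have "seq.P.expectation (\<lambda>\<omega>. \<omega> 0) = (LINT x|distr \<Omega> borel (\<lambda>\<omega>. \<omega> 0). x)"
    by (rule integral_distr[symmetric]) (auto intro: measurable_coord)
  then have "seq.P.expectation (\<lambda>\<omega>. \<omega> 0) < - c" using c by (simp add: distr_coord_borel)
  from seq.P.iid_psum_bounded[OF indep_vars_coord distr_coord_borel integrable_coord[OF int] this \<delta>]
  obtain L where L: "0 \<le> L" "measure \<Omega> {w \<in> space \<Omega>. \<exists>n. L + real n * - c < psum w n} \<le> \<delta>" .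
  have "{\<omega>. \<exists>n. passes L c n \<omega>} \<subseteq> {w \<in> space \<Omega>. \<exists>n. L + real n * - c < psum w n}"
  proof safe
    fix \<omega> n assume "passes L c n \<omega>"
    then have "L + real (Suc n) * - c < psum \<omega> (Suc n)" by (simp add: passes_def)
    then show "\<exists>n. L + real n * - c < psum \<omega> n" by blast
  qed simp
  moreover have "{w \<in> space \<Omega>. \<exists>n. L + real n * - c < psum w n} \<in> sets \<Omega>" by measurable
  ultimately have "measure \<Omega> {\<omega>. \<exists>n. passes L c n \<omega>} \<le> \<delta>"
    using L(2) seq.P.finite_measure_mono order_trans by blast
  then show thesis using that L(1) by blast
qed

text \<open>The factors have separate origins: \<open>d\<close> bounds the tail of a single step,
  \<open>1 / c + e\<close> comes from the Riemann sum over the times of passage, and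
  \<open>1 + e\<close> absorbs the shift by \<open>L\<close>.\<close>

lemma passage_tail_eventually:
  assumes F: "heavy_tail F" and c: "0 < c" and L: "0 \<le> L" and d: "0 \<le> d" and e: "0 < e"
    and tail: "eventually (\<lambda>x. measure M {x<..} \<le> d * (1 - F x)) at_top"
  shows "eventually (\<lambda>y. measure \<Omega> {\<omega> \<in> {\<omega>. \<exists>n. passes L c n \<omega>}. y < passage_height L c \<omega>}
     \<le> d * (1 / c + e) * (1 + e) * (1 - integrated_tail_df F y)) at_top"
proof -
  interpret heavy_tail F by fact
  have shift: "filterlim (\<lambda>y. y - L) at_top at_top" by real_asymp
  have 1: "eventually (\<lambda>y. \<forall>u\<ge>y - L. measure M {u<..} \<le> d * H u) at_top"
    by (rule eventually_compose_filterlim[OF eventually_all_ge_at_top[OF tail] shift])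
  have 2: "eventually (\<lambda>y. \<forall>N. (\<Sum>n<N. H (y - L + real n * c)) \<le> (1 / c + e) * G (y - L)) at_top"
    by (rule eventually_compose_filterlim[OF H_sum_le[OF c e] shift])
  have 3: "eventually (\<lambda>y. G (y - L) \<le> (1 + e) * G y) at_top"
    using L e by (intro Fs.long_tailed) auto
  show ?thesis using 1 2 3
  proof eventually_elim
    case (elim y)
    show ?case
    proof (rule passage_tail_le[OF _ L])
      fix N
      have "(\<Sum>n<N. measure M {y - L + real n * c<..}) \<le> (\<Sum>n<N. d * H (y - L + real n * c))"
        using elim(1) c by (intro sum_mono) auto
      also have "\<dots> = d * (\<Sum>n<N. H (y - L + real n * c))" by (simp add: sum_distrib_left)
      also have "\<dots> \<le> d * ((1 / c + e) * G (y - L))"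
        using elim(2) d by (intro mult_left_mono) auto
      also have "\<dots> \<le> d * ((1 / c + e) * ((1 + e) * G y))"
        using elim(3) d c e by (intro mult_left_mono) auto
      finally show "(\<Sum>n<N. measure M {y - L + real n * c<..}) \<le> d * (1 / c + e) * (1 + e) * G y"
        by (simp add: mult_ac)
    qed
  qed
qed

text \<open>One restart turns a bound \<open>\<beta> * G\<close> into
  \<open>(K e + \<rho> e * \<beta>) * G\<close>: a large first passage contributes
  \<open>K e\<close>, and \<open>\<rho> e\<close> dominates the probability of any passage.
  Iteration leads to the fixed point \<open>K e / (1 - \<rho> e)\<close>, which tends to
  \<open>d / m\<close> as \<open>e\<close> tends to 0.\<close>

theorem veraverbeke_upper:
  assumes F: "heavy_tail F" and int: "integrable M (\<lambda>x. x)" and mean: "(LINT x|M. x) = - m" and m: "0 < m"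
    and d: "0 \<le> d" and tail: "\<And>e. 0 < e \<Longrightarrow> eventually (\<lambda>x. measure M {x<..} \<le> (d + e) * (1 - F x)) at_top"
    and \<eta>: "0 < \<eta>"
  shows "eventually (\<lambda>x. measure \<Omega> (hits_inf x) \<le> (d / m + \<eta>) * (1 - integrated_tail_df F x)) at_top"
proof -
  interpret heavy_tail F by fact
  \<comment> \<open>\<open>K\<close> and \<open>\<rho>\<close> are the coefficients of
    \<open>convolution_bound\<close>, with \<open>\<kappa>\<close> from
    \<open>passage_tail_eventually\<close> for slope \<open>m - e\<close> and with \<open>e\<close>
    bounding the probability of a passage.\<close>
  define K where "K e = (1 + e) * ((d + e) * (1 / (m - e) + e) * (1 + e))" for e
  define \<rho> where "\<rho> e = (1 + e) * e + e" for e :: real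
  have "((\<lambda>e. K e / (1 - \<rho> e)) \<longlongrightarrow> d / m) (at_right 0)"
    unfolding K_def \<rho>_def using m by (auto intro!: tendsto_eq_intros)
  then have "eventually (\<lambda>e. K e / (1 - \<rho> e) < d / m + \<eta>) (at_right 0)"
    by (rule order_tendstoD(2)) (use \<eta> in simp)
  moreover have "(\<rho> \<longlongrightarrow> 0) (at_right 0)"
    unfolding \<rho>_def by (auto intro!: tendsto_eq_intros)
  then have "eventually (\<lambda>e. \<rho> e < 1) (at_right 0)"
    by (rule order_tendstoD(2)) simp
  moreover have "eventually (\<lambda>e. e \<in> {0<..<m}) (at_right 0)"
    using m by (rule eventually_at_right_real)
  ultimately have "eventually (\<lambda>e. K e / (1 - \<rho> e) < d / m + \<eta> \<and> \<rho> e < 1 \<and> e \<in> {0<..<m}) (at_right 0)"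
    by eventually_elim auto
  then obtain e where e: "K e / (1 - \<rho> e) < d / m + \<eta>" "\<rho> e < 1" "0 < e" "e < m"
    using eventually_happens[of _ "at_right (0::real)"] by auto
  define c where "c = m - e"
  define \<kappa> where "\<kappa> = (d + e) * (1 / c + e) * (1 + e)"
  have c: "0 < c" "(LINT x|M. x) < - c" using e mean by (auto simp: c_def)
  obtain L where L: "0 \<le> L" "measure \<Omega> {\<omega>. \<exists>n. passes L c n \<omega>} \<le> e"
    using passage_unlikely[OF int c(2) e(3)] by blast
  let ?E = "{\<omega>. \<exists>n. passes L c n \<omega>}" and ?\<phi> = "passage_height L c"
  let ?h = "\<lambda>x. measure \<Omega> (hits_inf x)" and ?hN = "\<lambda>N x. measure \<Omega> (hits N x)"
  have \<kappa>: "0 \<le> \<kappa>" unfolding \<kappa>_def using d e c by (intro mult_nonneg_nonneg) auto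
  have Ke: "K e = (1 + e) * \<kappa>" by (simp add: K_def \<kappa>_def c_def)
  have K0: "0 \<le> K e" using \<kappa> e Ke by simp
  have \<rho>0: "0 \<le> \<rho> e" using e by (simp add: \<rho>_def)
  have step: "eventually (\<lambda>A. eventually (\<lambda>x. \<forall>h \<beta>. 0 \<le> \<beta> \<longrightarrow> (\<forall>y. h y \<le> 1) \<longrightarrow> (\<forall>y\<ge>A. h y \<le> \<beta> * G y) \<longrightarrow>
     (\<integral>\<^sup>+w. indicator ?E w * ennreal (h (x - ?\<phi> w)) \<partial>\<Omega>) \<le> ennreal ((K e + \<rho> e * \<beta>) * G x)) at_top) at_top"
    using Fs.convolution_bound[OF seq.P.prob_space_axioms sets_passes measurable_passage_height \<kappa> e(3)
      passage_tail_eventually[OF F c(1) L(1) _ e(3) tail[OF e(3)], folded \<kappa>_def]]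
  proof (rule eventually_mono)
    show "0 \<le> d + e" using d e by simp
    fix A
    assume "eventually (\<lambda>x. \<forall>h \<beta>. 0 \<le> \<beta> \<longrightarrow> (\<forall>y. h y \<le> 1) \<longrightarrow> (\<forall>y\<ge>A. h y \<le> \<beta> * G y) \<longrightarrow>
     (\<integral>\<^sup>+w. indicator ?E w * ennreal (h (x - ?\<phi> w)) \<partial>\<Omega>)
       \<le> ennreal (((1 + e) * \<kappa> + ((1 + e) * measure \<Omega> ?E + e) * \<beta>) * G x)) at_top"
    then show "eventually (\<lambda>x. \<forall>h \<beta>. 0 \<le> \<beta> \<longrightarrow> (\<forall>y. h y \<le> 1) \<longrightarrow> (\<forall>y\<ge>A. h y \<le> \<beta> * G y) \<longrightarrow>
     (\<integral>\<^sup>+w. indicator ?E w * ennreal (h (x - ?\<phi> w)) \<partial>\<Omega>) \<le> ennreal ((K e + \<rho> e * \<beta>) * G x)) at_top"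
    proof (rule eventually_mono, intro allI impI)
      fix x :: real and h :: "real \<Rightarrow> real" and \<beta> :: real
      assume "0 \<le> \<beta>" "\<forall>y. h y \<le> 1" "\<forall>y\<ge>A. h y \<le> \<beta> * G y"
        and *: "\<forall>h \<beta>. 0 \<le> \<beta> \<longrightarrow> (\<forall>y. h y \<le> 1) \<longrightarrow> (\<forall>y\<ge>A. h y \<le> \<beta> * G y) \<longrightarrow>
     (\<integral>\<^sup>+w. indicator ?E w * ennreal (h (x - ?\<phi> w)) \<partial>\<Omega>)
       \<le> ennreal (((1 + e) * \<kappa> + ((1 + e) * measure \<Omega> ?E + e) * \<beta>) * G x)"
      then have "(\<integral>\<^sup>+w. indicator ?E w * ennreal (h (x - ?\<phi> w)) \<partial>\<Omega>)
       \<le> ennreal (((1 + e) * \<kappa> + ((1 + e) * measure \<Omega> ?E + e) * \<beta>) * G x)" by blast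
      also have "\<dots> \<le> ennreal ((K e + \<rho> e * \<beta>) * G x)"
        using L(2) e \<open>0 \<le> \<beta>\<close> Fs.G_pos[of x] unfolding Ke \<rho>_def
        by (intro ennreal_leI mult_right_mono add_mono mult_left_mono) auto
      finally show "(\<integral>\<^sup>+w. indicator ?E w * ennreal (h (x - ?\<phi> w)) \<partial>\<Omega>) \<le> ennreal ((K e + \<rho> e * \<beta>) * G x)" .
    qed
  qed
  have rec: "?hN (Suc N) x \<le> (K e + \<rho> e * \<beta>) * G x"
    if "L \<le> x" "0 \<le> \<beta>" "\<forall>y\<ge>A. h y \<le> \<beta> * G y" "\<forall>y. h y \<le> 1" "\<forall>y. ?hN N y \<le> h y"
      "\<forall>h \<beta>. 0 \<le> \<beta> \<longrightarrow> (\<forall>y. h y \<le> 1) \<longrightarrow> (\<forall>y\<ge>A. h y \<le> \<beta> * G y) \<longrightarrow>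
       (\<integral>\<^sup>+w. indicator ?E w * ennreal (h (x - ?\<phi> w)) \<partial>\<Omega>) \<le> ennreal ((K e + \<rho> e * \<beta>) * G x)"
    for N x \<beta> A h
  proof -
    have "emeasure \<Omega> (hits (Suc N) x) \<le> (\<integral>\<^sup>+w. indicator ?E w * ennreal (?hN N (x - ?\<phi> w)) \<partial>\<Omega>)"
      using hits_Suc_le[OF L(1) _ that(1)] c by auto
    also have "\<dots> \<le> (\<integral>\<^sup>+w. indicator ?E w * ennreal (h (x - ?\<phi> w)) \<partial>\<Omega>)"
      using that(5) by (intro nn_integral_mono mult_left_mono ennreal_leI) auto
    also have "\<dots> \<le> ennreal ((K e + \<rho> e * \<beta>) * G x)" using that by blast
    finally show ?thesis
      using Fs.G_pos[of x] K0 \<rho>0 that(2) by (simp add: seq.P.emeasure_eq_measure)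
  qed
  have h1: "?hN N y \<le> 1" "?h y \<le> 1" "?hN N y \<le> ?h y" for N y
    by (auto intro!: seq.P.prob_le_1 seq.P.finite_measure_mono[OF _ sets_hits_inf])
      (auto simp: hits_def hits_inf_def)
  \<comment> \<open>The first bound of order \<open>G\<close>. Horizon 0 never exceeds a nonnegative
    level, which starts an induction on \<open>N\<close> with \<open>B\<close> independent of
    \<open>N\<close>; \<open>hits_inf\<close> itself offers no such start.\<close>
  obtain B where B: "0 \<le> B" "eventually (\<lambda>x. ?h x \<le> B * G x) at_top"
  proof -
    obtain A where A: "0 \<le> A" "L \<le> A" "eventually (\<lambda>x. \<forall>h \<beta>. 0 \<le> \<beta> \<longrightarrow> (\<forall>y. h y \<le> 1) \<longrightarrow> (\<forall>y\<ge>A. h y \<le> \<beta> * G y) \<longrightarrow>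
     (\<integral>\<^sup>+w. indicator ?E w * ennreal (h (x - ?\<phi> w)) \<partial>\<Omega>) \<le> ennreal ((K e + \<rho> e * \<beta>) * G x)) at_top"
      using eventually_happens[OF eventually_conj[OF step eventually_ge_at_top[of "max 0 L"]]] by auto
    then obtain x1 where x1: "\<And>x. x \<ge> x1 \<Longrightarrow> \<forall>h \<beta>. 0 \<le> \<beta> \<longrightarrow> (\<forall>y. h y \<le> 1) \<longrightarrow> (\<forall>y\<ge>A. h y \<le> \<beta> * G y) \<longrightarrow>
     (\<integral>\<^sup>+w. indicator ?E w * ennreal (h (x - ?\<phi> w)) \<partial>\<Omega>) \<le> ennreal ((K e + \<rho> e * \<beta>) * G x)"
      unfolding eventually_at_top_linorder by blast
    define x0 where "x0 = max x1 A"
    define B where "B = max (1 / G x0) (K e / (1 - \<rho> e))"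
    have B0: "0 \<le> B" using Fs.G_pos[of x0] by (auto simp: B_def le_max_iff_disj)
    have BK: "K e + \<rho> e * B \<le> B"
    proof -
      have "K e / (1 - \<rho> e) \<le> B" by (simp add: B_def)
      then show ?thesis using e(2) by (simp add: field_simps)
    qed
    have small: "t \<le> B * G y" if "t \<le> 1" "y \<le> x0" for t y
    proof -
      have "1 = 1 / G x0 * G x0" using Fs.G_pos[of x0] by simp
      also have "\<dots> \<le> B * G y"
        using that Fs.G_pos[of x0] B0 by (intro mult_mono Fs.G_antimono) (auto simp: B_def)
      finally show ?thesis using that by simp
    qed
    have "\<forall>y\<ge>A. ?hN N y \<le> B * G y" for N
    proof (induction N)
      case 0
      have "hits 0 y = {}" if "A \<le> y" for y using that A by (auto simp: hits_def)
      then show ?case using B0 Fs.G_pos by (simp add: less_imp_le)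
    next
      case (Suc N)
      show ?case
      proof (intro allI impI)
        fix y assume y: "A \<le> y"
        show "?hN (Suc N) y \<le> B * G y"
        proof (cases "y \<le> x0")
          case False
          have "?hN (Suc N) y \<le> (K e + \<rho> e * B) * G y"
            using False A y Suc by (intro rec[OF _ B0 Suc _ _ x1]) (auto simp: x0_def h1)
          also have "\<dots> \<le> B * G y" using BK Fs.G_pos[of y] by (intro mult_right_mono) auto
          finally show ?thesis .
        qed (auto intro!: small h1)
      qed
    qed
    then have "?h y \<le> B * G y" if "A \<le> y" for y
      using that by (intro LIMSEQ_le_const2[OF hits_LIMSEQ]) auto
    then show thesis using B0 by (intro that[of B]) (auto simp: eventually_at_top_linorder)
  qed
  \<comment> \<open>Given some bound of order \<open>G\<close>, the recursion can be run with
    \<open>?h\<close> itself, since \<open>?h\<close> dominates all finite horizons.\<close>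
  have improve: "eventually (\<lambda>x. ?h x \<le> (K e + \<rho> e * \<beta>) * G x) at_top"
    if \<beta>: "0 \<le> \<beta>" "eventually (\<lambda>x. ?h x \<le> \<beta> * G x) at_top" for \<beta>
  proof -
    obtain A where A: "\<forall>y\<ge>A. ?h y \<le> \<beta> * G y" "eventually (\<lambda>x. \<forall>h \<beta>. 0 \<le> \<beta> \<longrightarrow> (\<forall>y. h y \<le> 1) \<longrightarrow> (\<forall>y\<ge>A. h y \<le> \<beta> * G y) \<longrightarrow>
     (\<integral>\<^sup>+w. indicator ?E w * ennreal (h (x - ?\<phi> w)) \<partial>\<Omega>) \<le> ennreal ((K e + \<rho> e * \<beta>) * G x)) at_top"
      using eventually_happens[OF eventually_conj[OF eventually_all_ge_at_top[OF \<beta>(2)] step]] by auto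
    show ?thesis using A(2) eventually_ge_at_top[of L]
    proof eventually_elim
      case (elim x)
      have "?hN (Suc N) x \<le> (K e + \<rho> e * \<beta>) * G x" for N
        by (rule rec[OF elim(2) \<beta>(1) A(1) _ _ elim(1)]) (auto simp: h1)
      then show ?case
        by (intro LIMSEQ_le_const2[OF LIMSEQ_Suc[OF hits_LIMSEQ]]) auto
    qed
  qed
  \<comment> \<open>The orbit of \<open>K e + \<rho> e * \<beta>\<close> that starts at the fixed
    point plus \<open>B\<close>; the excess decays geometrically.\<close>
  define \<beta> where "\<beta> k = K e / (1 - \<rho> e) + \<rho> e ^ k * B" for k
  have \<beta>_step: "K e + \<rho> e * \<beta> k = \<beta> (Suc k)" for k
    using e(2) by (simp add: \<beta>_def field_simps)
  have \<beta>0: "0 \<le> \<beta> k" for k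
    using K0 e(2) \<rho>0 B(1) by (simp add: \<beta>_def)
  have "eventually (\<lambda>x. ?h x \<le> \<beta> k * G x) at_top" for k
  proof (induction k)
    case 0
    show ?case using B(2)
    proof eventually_elim
      case (elim x)
      have "B * G x \<le> \<beta> 0 * G x" using K0 e(2) Fs.G_pos[of x] by (intro mult_right_mono) (auto simp: \<beta>_def)
      then show ?case using elim by simp
    qed
  next
    case (Suc k)
    show ?case using improve[OF \<beta>0 Suc] by (simp only: \<beta>_step)
  qed
  moreover obtain k where "\<beta> k < d / m + \<eta>"
  proof -
    have "(\<lambda>k. \<beta> k) \<longlonglongrightarrow> K e / (1 - \<rho> e) + 0 * B"
      unfolding \<beta>_def using \<rho>0 e(2) by (intro tendsto_intros LIMSEQ_power_zero) auto
    then have "eventually (\<lambda>k. \<beta> k < d / m + \<eta>) sequentially"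
      by (rule order_tendstoD(2)) (use e in simp)
    then show thesis using that by (auto simp: eventually_sequentially)
  qed
  ultimately have "eventually (\<lambda>x. ?h x \<le> \<beta> k * G x) at_top" by blast
  then show ?thesis
  proof eventually_elim
    case (elim x)
    have "\<beta> k * G x \<le> (d / m + \<eta>) * G x"
      using \<open>\<beta> k < d / m + \<eta>\<close> Fs.G_pos[of x] by (intro mult_right_mono) auto
    then show ?case using elim by simp
  qed
qed

end

section \<open>Independence of pairs of processes\<close>

lemma (in prob_space) indep_varsD_inj:
  assumes Z: "indep_vars (\<lambda>_. L) Z UNIV" and h: "inj h"
    and J: "finite J" "J \<noteq> {}" and A: "\<And>k. k \<in> J \<Longrightarrow> A k \<in> sets L"
  shows "prob (\<Inter>k\<in>J. Z (h k) -` A k \<inter> space M) = (\<Prod>k\<in>J. prob (Z (h k) -` A k \<inter> space M))"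
proof -
  have "prob (\<Inter>i\<in>h ` J. Z i -` A (the_inv h i) \<inter> space M) = (\<Prod>i\<in>h ` J. prob (Z i -` A (the_inv h i) \<inter> space M))"
    using J A h by (intro indep_varsD[OF Z]) (auto simp: the_inv_f_f)
  then show ?thesis
    using h J by (simp add: the_inv_f_f prod.reindex inj_on_subset[OF h])
qed

lemma (in prob_space) indep_vars_inj:
  assumes Z: "indep_vars (\<lambda>_. L) Z UNIV" and h: "inj h"
  shows "indep_vars (\<lambda>_. L) (\<lambda>k. Z (h k)) UNIV"
  unfolding indep_vars_def2
proof (intro conjI ballI indep_setsI)
  have m[measurable]: "Z i \<in> measurable M L" for i using Z by (simp add: indep_vars_def)
  show "Z (h i) \<in> measurable M L" for i by measurable
  show "{Z (h i) -` A \<inter> space M |A. A \<in> sets L} \<subseteq> events" for i by auto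
  fix A J assume J: "J \<noteq> {}" "J \<subseteq> UNIV" "finite J" and "\<forall>j\<in>J. A j \<in> {Z (h j) -` A \<inter> space M |A. A \<in> sets L}"
  then have "\<forall>j\<in>J. \<exists>B. A j = Z (h j) -` B \<inter> space M \<and> B \<in> sets L" by auto
  then obtain B where B: "\<And>j. j \<in> J \<Longrightarrow> A j = Z (h j) -` B j \<inter> space M" "\<And>j. j \<in> J \<Longrightarrow> B j \<in> sets L"
    by metis
  show "prob (\<Inter>j\<in>J. A j) = (\<Prod>j\<in>J. prob (A j))"
    using indep_varsD_inj[OF Z h J(3,1) B(2)] B(1) by simp
qed

lemma (in prob_space) indep_processesD:
  assumes "indep_processes M N X N' X'"
    and "A \<in> sets (\<Pi>\<^sub>M n\<in>(UNIV :: int set). N)" "B \<in> sets (\<Pi>\<^sub>M n\<in>(UNIV :: int set). N')"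
  shows "prob (((\<lambda>w n. X n w) -` A \<inter> space M) \<inter> ((\<lambda>w n. X' n w) -` B \<inter> space M))
    = prob ((\<lambda>w n. X n w) -` A \<inter> space M) * prob ((\<lambda>w n. X' n w) -` B \<inter> space M)"
  using assms unfolding indep_processes_def indep_sets2_eq by blast

text \<open>Measurable rectangles are an intersection-stable generator, and on them the probability
  factors, first between the two processes and then within each. The separate injections
  \<open>f\<close> and \<open>g\<close> allow \<open>Y\<close> and \<open>\<tau>\<close> to be
  paired with shifted indices.\<close>

lemma (in prob_space) indep_vars_pair_process:
  fixes X :: "int \<Rightarrow> 'a \<Rightarrow> 's" and X' :: "int \<Rightarrow> 'a \<Rightarrow> 't" and f g :: "nat \<Rightarrow> int"
  assumes ip: "indep_processes M N X N' X'"
    and iX: "indep_vars (\<lambda>_. N) X UNIV" and iX': "indep_vars (\<lambda>_. N') X' UNIV"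
    and f: "inj f" and g: "inj g"
  shows "indep_vars (\<lambda>_. N \<Otimes>\<^sub>M N') (\<lambda>k w. (X (f k) w, X' (g k) w)) UNIV"
proof -
  have X[measurable]: "X n \<in> measurable M N" and X'[measurable]: "X' n \<in> measurable M N'" for n
    using ip by (auto simp: indep_processes_def)
  have joint: "prob ((\<Inter>k\<in>J. X (f k) -` A k \<inter> space M) \<inter> (\<Inter>k\<in>J. X' (g k) -` B k \<inter> space M))
    = prob (\<Inter>k\<in>J. X (f k) -` A k \<inter> space M) * prob (\<Inter>k\<in>J. X' (g k) -` B k \<inter> space M)"
    if J: "finite J" "J \<noteq> {}" and A: "\<And>k. k \<in> J \<Longrightarrow> A k \<in> sets N" and B: "\<And>k. k \<in> J \<Longrightarrow> B k \<in> sets N'" for J A B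
  proof -
    have 1: "(\<Inter>k\<in>J. X (f k) -` A k \<inter> space M) = (\<lambda>w n. X n w) -` {x \<in> space (\<Pi>\<^sub>M n\<in>UNIV. N). \<forall>k\<in>J. x (f k) \<in> A k} \<inter> space M"
      using J measurable_space[OF X] by (auto simp: space_PiM)
    have 2: "{x \<in> space (\<Pi>\<^sub>M n\<in>UNIV. N). \<forall>k\<in>J. x (f k) \<in> A k} \<in> sets (\<Pi>\<^sub>M n\<in>(UNIV :: int set). N)"
      using J A by (intro sets.sets_Collect_finite_All sets_Collect_single) auto
    have 3: "(\<Inter>k\<in>J. X' (g k) -` B k \<inter> space M) = (\<lambda>w n. X' n w) -` {x \<in> space (\<Pi>\<^sub>M n\<in>UNIV. N'). \<forall>k\<in>J. x (g k) \<in> B k} \<inter> space M"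
      using J measurable_space[OF X'] by (auto simp: space_PiM)
    have 4: "{x \<in> space (\<Pi>\<^sub>M n\<in>UNIV. N'). \<forall>k\<in>J. x (g k) \<in> B k} \<in> sets (\<Pi>\<^sub>M n\<in>(UNIV :: int set). N')"
      using J B by (intro sets.sets_Collect_finite_All sets_Collect_single) auto
    show ?thesis unfolding 1 3 by (rule indep_processesD[OF ip 2 4])
  qed
  have fin: "indep_vars (\<lambda>_. N \<Otimes>\<^sub>M N') (\<lambda>k w. (X (f k) w, X' (g k) w)) J" if J: "finite J" "J \<noteq> {}" for J
  proof (subst indep_vars_finite[where E="\<lambda>_. {a \<times> b | a b. a \<in> sets N \<and> b \<in> sets N'}"])
    show "\<forall>C\<in>J \<rightarrow> {a \<times> b |a b. a \<in> sets N \<and> b \<in> sets N'}.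
       prob (\<Inter>k\<in>J. (\<lambda>w. (X (f k) w, X' (g k) w)) -` C k \<inter> space M) =
       (\<Prod>k\<in>J. prob ((\<lambda>w. (X (f k) w, X' (g k) w)) -` C k \<inter> space M))"
    proof
      fix C assume "C \<in> J \<rightarrow> {a \<times> b |a b. a \<in> sets N \<and> b \<in> sets N'}"
      then have "\<forall>k\<in>J. \<exists>a b. C k = a \<times> b \<and> a \<in> sets N \<and> b \<in> sets N'" by (auto simp: Pi_iff)
      then obtain A B where AB: "\<And>k. k \<in> J \<Longrightarrow> C k = A k \<times> B k" "\<And>k. k \<in> J \<Longrightarrow> A k \<in> sets N" "\<And>k. k \<in> J \<Longrightarrow> B k \<in> sets N'"
        by metis
      have "(\<Inter>k\<in>J. (\<lambda>w. (X (f k) w, X' (g k) w)) -` C k \<inter> space M)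
        = (\<Inter>k\<in>J. X (f k) -` A k \<inter> space M) \<inter> (\<Inter>k\<in>J. X' (g k) -` B k \<inter> space M)"
        using AB J by auto
      then have "prob (\<Inter>k\<in>J. (\<lambda>w. (X (f k) w, X' (g k) w)) -` C k \<inter> space M)
        = (\<Prod>k\<in>J. prob (X (f k) -` A k \<inter> space M)) * (\<Prod>k\<in>J. prob (X' (g k) -` B k \<inter> space M))"
        by (simp only: joint[OF J AB(2,3)] indep_varsD_inj[OF iX f J AB(2)] indep_varsD_inj[OF iX' g J AB(3)])
      also have "\<dots> = (\<Prod>k\<in>J. prob (X (f k) -` A k \<inter> space M) * prob (X' (g k) -` B k \<inter> space M))"
        by (rule prod.distrib[symmetric])
      also have "\<dots> = (\<Prod>k\<in>J. prob ((\<lambda>w. (X (f k) w, X' (g k) w)) -` C k \<inter> space M))"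
      proof (intro prod.cong refl)
        fix k assume k: "k \<in> J"
        have "(\<lambda>w. (X (f k) w, X' (g k) w)) -` C k \<inter> space M = (X (f k) -` A k \<inter> space M) \<inter> (X' (g k) -` B k \<inter> space M)"
          using AB k by auto
        then show "prob (X (f k) -` A k \<inter> space M) * prob (X' (g k) -` B k \<inter> space M) =
            prob ((\<lambda>w. (X (f k) w, X' (g k) w)) -` C k \<inter> space M)"
          using joint[of "{k}" A B] AB k by simp
      qed
      finally show "prob (\<Inter>k\<in>J. (\<lambda>w. (X (f k) w, X' (g k) w)) -` C k \<inter> space M) =
       (\<Prod>k\<in>J. prob ((\<lambda>w. (X (f k) w, X' (g k) w)) -` C k \<inter> space M))" .
    qed
  qed (use J in \<open>auto simp: sets_pair_measure space_pair_measure intro!: Int_stable_pair_measure_generator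
       dest: sets.sets_into_space\<close>)
  show ?thesis unfolding indep_vars_def2
  proof (intro conjI ballI)
    show "indep_sets (\<lambda>i. {(\<lambda>w. (X (f i) w, X' (g i) w)) -` A \<inter> space M |A. A \<in> sets (N \<Otimes>\<^sub>M N')}) UNIV"
      by (subst indep_sets_finite_index_sets) (use fin in \<open>auto simp: indep_vars_def2\<close>)
  qed measurable
qed

lemma (in prob_space) distr_pair_process:
  assumes ip: "indep_processes M N X N' X'"
  shows "distr M (N \<Otimes>\<^sub>M N') (\<lambda>w. (X i w, X' j w)) = distr M N (X i) \<Otimes>\<^sub>M distr M N' (X' j)"
proof (rule pair_measure_eqI[symmetric])
  have X[measurable]: "X n \<in> measurable M N" and X'[measurable]: "X' n \<in> measurable M N'" for n
    using ip by (auto simp: indep_processes_def)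
  interpret D: prob_space "distr M N (X i)" by (rule prob_space_distr) measurable
  interpret D': prob_space "distr M N' (X' j)" by (rule prob_space_distr) measurable
  show "sigma_finite_measure (distr M N (X i))" "sigma_finite_measure (distr M N' (X' j))" ..
  fix A B assume "A \<in> sets (distr M N (X i))" "B \<in> sets (distr M N' (X' j))"
  then have A[measurable]: "A \<in> sets N" and B[measurable]: "B \<in> sets N'" by auto
  have 1: "X i -` A \<inter> space M = (\<lambda>w n. X n w) -` {x \<in> space (\<Pi>\<^sub>M n\<in>UNIV. N). x i \<in> A} \<inter> space M"
    using measurable_space[OF X] by (auto simp: space_PiM)
  have 2: "{x \<in> space (\<Pi>\<^sub>M n\<in>UNIV. N). x i \<in> A} \<in> sets (\<Pi>\<^sub>M n\<in>UNIV. N)"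
    using A by (intro sets_Collect_single) auto
  have 3: "X' j -` B \<inter> space M = (\<lambda>w n. X' n w) -` {x \<in> space (\<Pi>\<^sub>M n\<in>UNIV. N'). x j \<in> B} \<inter> space M"
    using measurable_space[OF X'] by (auto simp: space_PiM)
  have 4: "{x \<in> space (\<Pi>\<^sub>M n\<in>UNIV. N'). x j \<in> B} \<in> sets (\<Pi>\<^sub>M n\<in>UNIV. N')"
    using B by (intro sets_Collect_single) auto
  have "prob ((X i -` A \<inter> space M) \<inter> (X' j -` B \<inter> space M)) = prob (X i -` A \<inter> space M) * prob (X' j -` B \<inter> space M)"
    unfolding 1 3 by (rule indep_processesD[OF ip 2 4])
  moreover have "(\<lambda>w. (X i w, X' j w)) -` (A \<times> B) \<inter> space M = (X i -` A \<inter> space M) \<inter> (X' j -` B \<inter> space M)"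
    by auto
  ultimately show "emeasure (distr M N (X i)) A * emeasure (distr M N' (X' j)) B =
      emeasure (distr M (N \<Otimes>\<^sub>M N') (\<lambda>w. (X i w, X' j w))) (A \<times> B)"
    by (simp add: emeasure_distr emeasure_eq_measure ennreal_mult)
qed (simp add: sets_pair_measure)

section \<open>Random walks whose first step has a law of its own\<close>

lemma (in random_walk) measurable_hits_inf: "(\<lambda>y. measure \<Omega> (hits_inf y)) \<in> borel_measurable borel"
proof -
  have "mono (\<lambda>y. - measure \<Omega> (hits_inf y))"
    by (intro monoI le_imp_neg_le seq.P.finite_measure_mono sets_hits_inf) (auto simp: hits_inf_def intro: le_less_trans)
  from borel_measurable_uminus[OF borel_measurable_mono[OF this]] show ?thesis by simp
qed

text \<open>Conditioning on \<open>W 0\<close>: the later steps are independent of it and form an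
  ordinary random walk, which has to climb from \<open>W 0\<close> to \<open>x\<close>.\<close>

lemma (in prob_space) delayed_walk_tail:
  fixes W :: "nat \<Rightarrow> 'a \<Rightarrow> real"
  assumes W: "indep_vars (\<lambda>_. borel) W UNIV" and D: "\<And>n. distr M borel (W (Suc n)) = D"
  shows "emeasure M {w \<in> space M. \<exists>n. x < (\<Sum>k\<le>n. W k w)}
    = (\<integral>\<^sup>+w. ennreal (measure (\<Pi>\<^sub>M i\<in>(UNIV::nat set). D) {\<omega>. \<exists>k. x - W 0 w < psum \<omega> k}) \<partial>M)"
proof -
  have Wm[measurable]: "W n \<in> borel_measurable M" for n using W by (simp add: indep_vars_def)
  interpret D: random_walk D
    unfolding D[of 0, symmetric]
    by (simp add: random_walk_def real_distribution_def real_distribution_axioms_def prob_space_distr)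
  let ?B = "\<Pi>\<^sub>M n\<in>(UNIV::nat set). borel :: real measure"
  have sD: "sets ?B = sets D.\<Omega>" by (intro sets_PiM_cong) auto
  have c: "(\<lambda>w _. w 0) \<in> measurable (\<Pi>\<^sub>M n\<in>{0::nat}. borel :: real measure) ?B"
    by (rule measurable_PiM_single') (auto intro: measurable_component_singleton)
  have s: "(\<lambda>w n. w (Suc n)) \<in> measurable (\<Pi>\<^sub>M n\<in>{1..}. borel :: real measure) ?B"
    by (rule measurable_PiM_single') (auto intro: measurable_component_singleton)
  \<comment> \<open>Both sides of \<open>indep_var\<close> share one value type, so
    \<open>W 0\<close> is carried as a constant sequence.\<close>
  have "indep_var ?B ((\<lambda>w _. w 0) \<circ> (\<lambda>w. restrict (\<lambda>n. W n w) {0})) ?B ((\<lambda>w n. w (Suc n)) \<circ> (\<lambda>w. restrict (\<lambda>n. W n w) {1..}))"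
    by (rule indep_var_compose[OF indep_var_restrict[OF W] c s]) auto
  then have iv: "indep_var ?B (\<lambda>w _. W 0 w) ?B (\<lambda>w n. W (Suc n) w)"
    by (simp add: comp_def)
  have W': "indep_vars (\<lambda>_. borel) (\<lambda>n. W (Suc n)) UNIV"
    by (rule indep_vars_inj[OF W]) simp
  have d2: "distr M ?B (\<lambda>w n. W (Suc n) w) = D.\<Omega>"
    by (rule distr_iid_sequence[OF W' D])
  let ?D1 = "distr M ?B (\<lambda>w _. W 0 w)"
  have joint: "distr M (?B \<Otimes>\<^sub>M ?B) (\<lambda>w. (\<lambda>_. W 0 w, \<lambda>n. W (Suc n) w)) = ?D1 \<Otimes>\<^sub>M D.\<Omega>"
    using iv unfolding indep_var_distribution_eq d2 by auto
  define S where "S = {p \<in> space (?B \<Otimes>\<^sub>M ?B). \<exists>k. x - fst p 0 < psum (snd p) k}"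
  have S: "S \<in> sets (?B \<Otimes>\<^sub>M ?B)"
  proof -
    have [measurable]: "(\<lambda>p. fst p 0) \<in> borel_measurable (?B \<Otimes>\<^sub>M ?B)"
      by (rule measurable_compose[OF measurable_fst measurable_component_singleton]) simp
    have [measurable]: "(\<lambda>p. psum (snd p) k) \<in> borel_measurable (?B \<Otimes>\<^sub>M ?B)" for k
      by (intro borel_measurable_sum measurable_compose[OF measurable_snd measurable_component_singleton]) simp
    show ?thesis unfolding S_def by measurable
  qed
  have m0: "(\<lambda>w (_::nat). W 0 w) \<in> measurable M ?B" and m1: "(\<lambda>w n. W (Suc n) w) \<in> measurable M ?B"
    by (rule measurable_PiM_single'; simp)+
  have "emeasure M {w \<in> space M. \<exists>n. x < (\<Sum>k\<le>n. W k w)}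
      = emeasure M ((\<lambda>w. (\<lambda>_. W 0 w, \<lambda>n. W (Suc n) w)) -` S \<inter> space M)"
    by (intro arg_cong[where f="emeasure M"])
      (auto simp: S_def space_pair_measure space_PiM sum.atMost_shift algebra_simps)
  also have "\<dots> = emeasure (distr M (?B \<Otimes>\<^sub>M ?B) (\<lambda>w. (\<lambda>_. W 0 w, \<lambda>n. W (Suc n) w))) S"
    by (rule emeasure_distr[symmetric, OF measurable_Pair[OF m0 m1] S])
  also have "\<dots> = (\<integral>\<^sup>+y. emeasure D.\<Omega> (Pair y -` S) \<partial>?D1)"
    unfolding joint
  proof (rule D.seq.P.emeasure_pair_measure_alt)
    show "S \<in> sets (?D1 \<Otimes>\<^sub>M D.\<Omega>)"
      using S by (simp add: sD cong: sets_pair_measure_cong)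
  qed
  also have "\<dots> = (\<integral>\<^sup>+y. ennreal (measure D.\<Omega> (D.hits_inf (x - y 0))) \<partial>?D1)"
  proof (intro nn_integral_cong)
    fix y
    have "Pair y -` S = D.hits_inf (x - y 0)"
      by (auto simp: S_def D.hits_inf_def space_pair_measure space_PiM)
    then show "emeasure D.\<Omega> (Pair y -` S) = ennreal (measure D.\<Omega> (D.hits_inf (x - y 0)))"
      by (simp add: D.seq.P.emeasure_eq_measure)
  qed
  also have "\<dots> = (\<integral>\<^sup>+w. ennreal (measure D.\<Omega> (D.hits_inf (x - W 0 w))) \<partial>M)"
  proof -
    note D.measurable_hits_inf[measurable]
    have [measurable]: "(\<lambda>y. y 0) \<in> borel_measurable ?B" by (rule measurable_component_singleton) simp
    have "(\<lambda>y. ennreal (measure D.\<Omega> (D.hits_inf (x - y 0)))) \<in> borel_measurable ?D1"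
      by (subst measurable_distr_eq1) measurable
    from nn_integral_distr[OF m0 this] show ?thesis .
  qed
  finally show ?thesis by (simp add: D.hits_inf_def)
qed

text \<open>The tail of \<open>W 0\<close> is of smaller order than \<open>G\<close>, so convolving
  the bound for the ordinary walk with it changes the constant by an arbitrarily small
  amount.\<close>

theorem (in prob_space) delayed_walk_upper:
  fixes W :: "nat \<Rightarrow> 'a \<Rightarrow> real"
  assumes F: "heavy_tail F"
    and W: "indep_vars (\<lambda>_. borel) W UNIV" and D: "\<And>n. distr M borel (W (Suc n)) = distr M borel (W 1)"
    and int: "integrable M (W 1)" and mean: "expectation (W 1) = - m" and m: "0 < m" and d: "0 \<le> d"
    and tail: "\<And>e. 0 < e \<Longrightarrow> eventually (\<lambda>x. prob {w \<in> space M. x < W 1 w} \<le> (d + e) * (1 - F x)) at_top"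
    and b: "0 \<le> b" and tail0: "eventually (\<lambda>x. prob {w \<in> space M. x < W 0 w} \<le> b * (1 - F x)) at_top"
    and \<eta>: "0 < \<eta>"
  shows "eventually (\<lambda>x. prob {w \<in> space M. \<exists>n. x < (\<Sum>k\<le>n. W k w)} \<le> (d / m + \<eta>) * (1 - integrated_tail_df F x)) at_top"
proof -
  have Wm[measurable]: "W n \<in> borel_measurable M" for n using W by (simp add: indep_vars_def)
  interpret heavy_tail F by fact
  define D1 where "D1 = distr M borel (W 1)"
  interpret D: random_walk D1
    by (simp add: D1_def random_walk_def real_distribution_def real_distribution_axioms_def prob_space_distr)
  have up: "eventually (\<lambda>x. measure D.\<Omega> (D.hits_inf x) \<le> (d / m + \<eta> / 2) * G x) at_top"
  proof (rule D.veraverbeke_upper[OF F _ _ m d])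
    show "integrable D1 (\<lambda>x. x)" using int by (simp add: D1_def integrable_distr_eq)
    show "(LINT x|D1. x) = - m" using int mean by (simp add: D1_def integral_distr)
    fix e :: real assume "0 < e"
    have "measure D1 {x<..} = prob {w \<in> space M. x < W 1 w}" for x
      by (simp add: D1_def measure_distr vimage_def Int_def conj_commute)
    then show "eventually (\<lambda>x. measure D1 {x<..} \<le> (d + e) * (1 - F x)) at_top"
      using tail[OF \<open>0 < e\<close>] by simp
  qed (use \<eta> in simp)
  define \<beta> where "\<beta> = d / m + \<eta> / 2"
  have \<beta>: "0 \<le> \<beta>" using d m \<eta> by (simp add: \<beta>_def)
  have "((\<lambda>e. (1 + e) * e + ((1 + e) * 1 + e) * \<beta>) \<longlongrightarrow> \<beta>) (at_right 0)"
    by (auto intro!: tendsto_eq_intros)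
  then have "eventually (\<lambda>e. (1 + e) * e + ((1 + e) * 1 + e) * \<beta> < d / m + \<eta>) (at_right 0)"
    by (rule order_tendstoD(2)) (use \<eta> in \<open>simp add: \<beta>_def\<close>)
  moreover have "eventually (\<lambda>e. e \<in> {0<..<1}) (at_right (0::real))"
    by (rule eventually_at_right_real) simp
  ultimately have "eventually (\<lambda>e. (1 + e) * e + ((1 + e) * 1 + e) * \<beta> < d / m + \<eta> \<and> 0 < e) (at_right 0)"
    by eventually_elim auto
  then obtain e where e: "(1 + e) * e + ((1 + e) * 1 + e) * \<beta> < d / m + \<eta>" "0 < e"
    using eventually_happens[of _ "at_right (0::real)"] by auto
  have "eventually (\<lambda>x. prob {w \<in> space M. x < W 0 w} \<le> e * G x) at_top"
    using tail0 H_negligible[of "e / (b + 1)"]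
  proof (rule eventually_elim2)
    fix x assume 1: "prob {w \<in> space M. x < W 0 w} \<le> b * (1 - F x)" and "1 - F x \<le> e / (b + 1) * G x"
    then have "(b + 1) * H x \<le> (b + 1) * (e / (b + 1) * G x)" using b by (intro mult_left_mono) auto
    also have "\<dots> = e * G x" using b by simp
    finally show "prob {w \<in> space M. x < W 0 w} \<le> e * G x"
      using 1 F.G_pos[of x] by (simp add: algebra_simps)
  qed (use b e in simp)
  \<comment> \<open>The restart event is the whole space here, so nothing contracts; the gain is
    that \<open>\<kappa> = e\<close> can be taken arbitrarily small.\<close>
  note conv = Fs.convolution_bound[OF prob_space_axioms sets.top Wm less_imp_le[OF e(2)] e(2) this]
  obtain A where A: "\<forall>y\<ge>A. measure D.\<Omega> (D.hits_inf y) \<le> \<beta> * G y"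
    "eventually (\<lambda>x. \<forall>h \<beta>. 0 \<le> \<beta> \<longrightarrow> (\<forall>y. h y \<le> 1) \<longrightarrow> (\<forall>y\<ge>A. h y \<le> \<beta> * G y) \<longrightarrow>
     (\<integral>\<^sup>+w. indicator (space M) w * ennreal (h (x - W 0 w)) \<partial>M)
       \<le> ennreal (((1 + e) * e + ((1 + e) * prob (space M) + e) * \<beta>) * G x)) at_top"
    using eventually_happens[OF eventually_conj[OF eventually_all_ge_at_top[OF up[folded \<beta>_def]] conv]] trivial_limit_at_top_linorder
    by blast
  from A(2) show ?thesis
  proof eventually_elim
    case (elim x)
    have "emeasure M {w \<in> space M. \<exists>n. x < (\<Sum>k\<le>n. W k w)} = (\<integral>\<^sup>+w. ennreal (measure D.\<Omega> (D.hits_inf (x - W 0 w))) \<partial>M)"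
      unfolding D.hits_inf_def by (rule delayed_walk_tail[OF W D[folded D1_def]])
    also have "\<dots> = (\<integral>\<^sup>+w. indicator (space M) w * ennreal (measure D.\<Omega> (D.hits_inf (x - W 0 w))) \<partial>M)"
      by (intro nn_integral_cong) simp
    also have "\<dots> \<le> ennreal (((1 + e) * e + ((1 + e) * prob (space M) + e) * \<beta>) * G x)"
      by (rule elim[THEN spec[of _ "\<lambda>y. measure D.\<Omega> (D.hits_inf y)"], rule_format, OF \<beta>])
        (use A(1) D.seq.P.prob_le_1 in auto)
    finally have "prob {w \<in> space M. \<exists>n. x < (\<Sum>k\<le>n. W k w)} \<le> ((1 + e) * e + ((1 + e) * 1 + e) * \<beta>) * G x"
      using e(2) \<beta> Fs.G_pos[of x] by (simp add: emeasure_eq_measure prob_space less_imp_le)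
    also have "\<dots> \<le> (d / m + \<eta>) * G x"
      using e(1) Fs.G_pos[of x] by (intro mult_right_mono) auto
    finally show ?case .
  qed
qed

section \<open>The single big jump\<close>

text \<open>The correction runs over ordered pairs and so counts each pair twice. This cruder form
  suffices, and it can be completed to the square of a sum.\<close>

lemma (in finite_measure) bonferroni_lower:
  assumes "finite I" "\<And>i. i \<in> I \<Longrightarrow> A i \<in> sets M"
  shows "(\<Sum>i\<in>I. measure M (A i)) - (\<Sum>i\<in>I. \<Sum>j\<in>I - {i}. measure M (A i \<inter> A j)) \<le> measure M (\<Union>i\<in>I. A i)"
  using assms
proof (induction I)
  case (insert k I)
  have "measure M (A k \<inter> (\<Union>i\<in>I. A i)) \<le> (\<Sum>i\<in>I. measure M (A k \<inter> A i))"
    using insert by (subst Int_UN_distrib) (intro finite_measure_subadditive_finite; auto)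
  moreover have "measure M (A k \<union> (\<Union>i\<in>I. A i)) = measure M (A k) + measure M (\<Union>i\<in>I. A i) - measure M (A k \<inter> (\<Union>i\<in>I. A i))"
    using insert by (intro measure_Un3) (auto simp: fmeasurable_eq_sets)
  moreover have "(\<Sum>i\<in>I. \<Sum>j\<in>I - {i}. measure M (A i \<inter> A j)) \<le> (\<Sum>i\<in>I. \<Sum>j\<in>insert k I - {i}. measure M (A i \<inter> A j))"
    using insert by (intro sum_mono sum_mono2) auto
  moreover have "insert k I - {k} = I" using insert by auto
  ultimately show ?case using insert by simp
qed simp

lemma (in prob_space) indep_blocks:
  assumes "indep_vars (\<lambda>_. N) P UNIV" "A \<inter> B = {}"
    and "Xa \<in> sets (\<Pi>\<^sub>M i\<in>A. N)" "Xb \<in> sets (\<Pi>\<^sub>M i\<in>B. N)"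
  shows "prob {w \<in> space M. restrict (\<lambda>i. P i w) A \<in> Xa \<and> restrict (\<lambda>i. P i w) B \<in> Xb}
    = prob {w \<in> space M. restrict (\<lambda>i. P i w) A \<in> Xa} * prob {w \<in> space M. restrict (\<lambda>i. P i w) B \<in> Xb}"
  using indep_varD[OF indep_var_restrict[OF assms(1,2) subset_UNIV subset_UNIV] assms(3,4)]
  by (simp add: vimage_def Int_def conj_commute)

lemma (in prob_space) prob_same_distr:
  assumes "X \<in> measurable M N" "X' \<in> measurable M N" "distr M N X = distr M N X'" "A \<in> sets N"
  shows "prob {w \<in> space M. X w \<in> A} = prob {w \<in> space M. X' w \<in> A}"
proof -
  have "prob {w \<in> space M. Z w \<in> A} = measure (distr M N Z) A" if "Z \<in> measurable M N" for Z
    using that assms(4) by (simp add: measure_distr vimage_def Int_def conj_commute)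
  then show ?thesis using assms by simp
qed

text \<open>Bonferroni's inequality for the events "component \<open>j\<close> jumps at index
  \<open>n\<close> after an ordinary past". Their probabilities add up to nearly
  \<open>d j / m j * G x\<close> for each \<open>j\<close>. Intersections are negligible: at
  different indices they sum to at most the square of a quantity of order \<open>G x\<close>, at
  equal indices \<open>pair\<close> makes them small.\<close>

theorem (in prob_space) multi_walk_lower:
  fixes U :: "nat \<Rightarrow> nat \<Rightarrow> 'a \<Rightarrow> real" and V :: "nat \<Rightarrow> 'a \<Rightarrow> real"
  assumes F: "heavy_tail F" and J: "finite J"
    and iid: "indep_vars (\<lambda>_. (\<Pi>\<^sub>M j\<in>J. borel) \<Otimes>\<^sub>M borel) (\<lambda>n w. (\<lambda>j\<in>J. U j n w, V n w)) UNIV"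
    and dist: "\<And>n. distr M ((\<Pi>\<^sub>M j\<in>J. borel) \<Otimes>\<^sub>M borel) (\<lambda>w. (\<lambda>j\<in>J. U j n w, V n w)) = D"
    and intU: "\<And>j. j \<in> J \<Longrightarrow> integrable M (U j 0)" and intV: "integrable M (V 0)"
    and mean: "\<And>j. j \<in> J \<Longrightarrow> expectation (\<lambda>w. V 0 w - U j 0 w) = m j" and m: "\<And>j. j \<in> J \<Longrightarrow> 0 < m j"
    and d: "\<And>j. j \<in> J \<Longrightarrow> 0 \<le> d j"
    and low: "\<And>j e. j \<in> J \<Longrightarrow> 0 < e \<Longrightarrow> e < 1 \<Longrightarrow>
       eventually (\<lambda>x. (1 - e) * d j * (1 - F x) \<le> prob {w \<in> space M. x < U j 0 w}) at_top"
    and up: "\<And>j. j \<in> J \<Longrightarrow> eventually (\<lambda>x. prob {w \<in> space M. x < U j 0 w} \<le> (d j + 1) * (1 - F x)) at_top"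
    and pair: "\<And>i j e. i \<in> J \<Longrightarrow> j \<in> J \<Longrightarrow> i \<noteq> j \<Longrightarrow> 0 < e \<Longrightarrow>
       eventually (\<lambda>x. prob {w \<in> space M. x < U i 0 w \<and> x < U j 0 w} \<le> e * (1 - F x)) at_top"
    and \<eta>: "0 < \<eta>"
  shows "eventually (\<lambda>x. ((\<Sum>j\<in>J. d j / m j) - \<eta>) * (1 - integrated_tail_df F x)
    \<le> prob {w \<in> space M. \<exists>j\<in>J. \<exists>n. x < (\<Sum>k\<le>n. U j k w) - (\<Sum>k<n. V k w)}) at_top"
proof -
  interpret heavy_tail F by fact
  let ?N = "(\<Pi>\<^sub>M j\<in>J. borel) \<Otimes>\<^sub>M borel :: ((nat \<Rightarrow> real) \<times> real) measure"
  let ?P = "\<lambda>n w. (\<lambda>j\<in>J. U j n w, V n w)"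
  have P: "?P n \<in> measurable M ?N" for n using iid by (simp add: indep_vars_def)
  have Um[measurable]: "U j n \<in> borel_measurable M" if "j \<in> J" for j n
  proof -
    have "(\<lambda>w. fst (?P n w) j) \<in> borel_measurable M"
      by (rule measurable_compose[OF measurable_compose[OF P measurable_fst] measurable_component_singleton[OF that]])
    then show ?thesis using that by simp
  qed
  have Vm[measurable]: "V n \<in> borel_measurable M" for n
    using measurable_compose[OF P measurable_snd] by simp
  have fm: "(\<lambda>p. fst p j) \<in> borel_measurable ?N" if "j \<in> J" for j
    by (rule measurable_compose[OF measurable_fst measurable_component_singleton[OF that]])
  define t where "t j x = prob {w \<in> space M. x < U j 0 w}" for j x
  define s where "s i j x = prob {w \<in> space M. x < U i 0 w \<and> x < U j 0 w}" for i j x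
  have t_eq: "prob {w \<in> space M. x < U j n w} = t j x" if j: "j \<in> J" for j n x
  proof -
    have "{p \<in> space ?N. x < fst p j} \<in> sets ?N" using fm[OF j] by measurable
    from prob_same_distr[OF P P _ this, of n 0] dist show ?thesis
      using j measurable_space[OF P] by (auto simp: t_def cong: conj_cong)
  qed
  have s_eq: "prob {w \<in> space M. x < U i n w \<and> x < U j n w} = s i j x" if j: "i \<in> J" "j \<in> J" for i j n x
  proof -
    have "{p \<in> space ?N. x < fst p i \<and> x < fst p j} \<in> sets ?N" using fm[OF j(1)] fm[OF j(2)] by measurable
    from prob_same_distr[OF P P _ this, of n 0] dist show ?thesis
      using j measurable_space[OF P] by (auto simp: s_def cong: conj_cong)
  qed
  have indep_UU: "prob {w \<in> space M. x < U i n w \<and> y < U j n' w} = t i x * t j y"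
    if ij: "i \<in> J" "j \<in> J" "n \<noteq> n'" for i j n n' x y
  proof -
    have X: "{p \<in> space (\<Pi>\<^sub>M i\<in>{n}. ?N). x < fst (p n) j} \<in> sets (\<Pi>\<^sub>M i\<in>{n}. ?N)" if "j \<in> J" for x j n
      using measurable_compose[OF measurable_component_singleton[of n "{n}" "\<lambda>_. ?N"] fm[OF that]] by measurable
    have sp: "restrict (\<lambda>i. ?P i w) {n} \<in> space (\<Pi>\<^sub>M i\<in>{n}. ?N)" if "w \<in> space M" for w n
      using measurable_space[OF P that] by (auto simp: space_PiM)
    have "prob {w \<in> space M. x < U i n w \<and> y < U j n' w} =
       prob {w \<in> space M. x < U i n w} * prob {w \<in> space M. y < U j n' w}"
      using indep_blocks[OF iid _ X[OF ij(1)] X[OF ij(2)], of n n' x y] ij sp by (simp cong: conj_cong)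
    then show ?thesis using ij by (simp add: t_eq)
  qed
  have indep_UD: "prob {w \<in> space M. x < U j n w \<and> (\<Sum>k<n. V k w - U j k w) \<le> y} =
      t j x * prob {w \<in> space M. (\<Sum>k<n. V k w - U j k w) \<le> y}" if j: "j \<in> J" for j n x y
  proof -
    have X: "{p \<in> space (\<Pi>\<^sub>M i\<in>{n}. ?N). x < fst (p n) j} \<in> sets (\<Pi>\<^sub>M i\<in>{n}. ?N)"
      using measurable_compose[OF measurable_component_singleton[of n "{n}" "\<lambda>_. ?N"] fm[OF j]] by measurable
    have "(\<lambda>p. \<Sum>k<n. snd (p k) - fst (p k) j) \<in> borel_measurable (\<Pi>\<^sub>M i\<in>{..<n}. ?N)"
    proof (intro borel_measurable_sum borel_measurable_diff)
      fix k assume "k \<in> {..<n}"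
      then have c: "(\<lambda>p. p k) \<in> measurable (\<Pi>\<^sub>M i\<in>{..<n}. ?N) ?N" by (rule measurable_component_singleton)
      show "(\<lambda>p. fst (p k) j) \<in> borel_measurable (\<Pi>\<^sub>M i\<in>{..<n}. ?N)" by (rule measurable_compose[OF c fm[OF j]])
      show "(\<lambda>p. snd (p k)) \<in> borel_measurable (\<Pi>\<^sub>M i\<in>{..<n}. ?N)" by (rule measurable_compose[OF c measurable_snd])
    qed
    then have X': "{p \<in> space (\<Pi>\<^sub>M i\<in>{..<n}. ?N). (\<Sum>k<n. snd (p k) - fst (p k) j) \<le> y} \<in> sets (\<Pi>\<^sub>M i\<in>{..<n}. ?N)"
      by measurable
    have sp: "restrict (\<lambda>i. ?P i w) A \<in> space (\<Pi>\<^sub>M i\<in>A. ?N)" if "w \<in> space M" for w A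
      using measurable_space[OF P that] by (auto simp: space_PiM)
    have "prob {w \<in> space M. x < U j n w \<and> (\<Sum>k<n. V k w - U j k w) \<le> y} =
      prob {w \<in> space M. x < U j n w} * prob {w \<in> space M. (\<Sum>k<n. V k w - U j k w) \<le> y}"
      using indep_blocks[OF iid _ X X'] j sp by (simp cong: conj_cong)
    then show ?thesis using j by (simp add: t_eq)
  qed
  \<comment> \<open>The three factors \<open>1 - e\<close> come from the lower tail bound, the
    probability of an ordinary past and the shift by \<open>C\<close>. The slope is
    \<open>m j + e\<close>, and the subtracted \<open>e\<close> pays for pairs of jumps.\<close>
  have "((\<lambda>e. (\<Sum>j\<in>J. (1 - e) ^ 3 * d j / (m j + e)) - e) \<longlongrightarrow> (\<Sum>j\<in>J. d j / m j)) (at_right 0)"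
    using m by (auto intro!: tendsto_eq_intros sum.cong simp: less_imp_neq[symmetric])
  then have "eventually (\<lambda>e. (\<Sum>j\<in>J. d j / m j) - \<eta> < (\<Sum>j\<in>J. (1 - e) ^ 3 * d j / (m j + e)) - e) (at_right 0)"
    by (rule order_tendstoD(1)) (use \<eta> in simp)
  moreover have "eventually (\<lambda>e. e \<in> {0<..<1}) (at_right (0::real))"
    by (rule eventually_at_right_real) simp
  ultimately have "eventually (\<lambda>e. (\<Sum>j\<in>J. d j / m j) - \<eta> < (\<Sum>j\<in>J. (1 - e) ^ 3 * d j / (m j + e)) - e \<and> 0 < e \<and> e < 1) (at_right 0)"
    by eventually_elim auto
  then obtain e where e: "(\<Sum>j\<in>J. d j / m j) - \<eta> < (\<Sum>j\<in>J. (1 - e) ^ 3 * d j / (m j + e)) - e" "0 < e" "e < 1"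
    using eventually_happens[of _ "at_right (0::real)"] by auto
  define c where "c j = m j + e" for j
  have c: "0 < c j" if "j \<in> J" for j using m[OF that] e by (simp add: c_def)
  \<comment> \<open>The increments \<open>V - U j\<close> have mean \<open>m j\<close>, below the
    slope \<open>c j\<close>, so a suitable line confines their sums at all times simultaneously up
    to probability \<open>e\<close>.\<close>
  have "\<forall>j\<in>J. \<exists>C. 0 \<le> C \<and> prob {w \<in> space M. \<exists>n. C + real n * c j < (\<Sum>k<n. V k w - U j k w)} \<le> e"
  proof
    fix j assume j: "j \<in> J"
    have g: "(\<lambda>p. snd p - fst p j) \<in> borel_measurable ?N" using fm[OF j] by measurable
    have 1: "indep_vars (\<lambda>_. borel) (\<lambda>n w. V n w - U j n w) UNIV"
      using indep_vars_compose2[OF iid, of "\<lambda>_ p. snd p - fst p j" "\<lambda>_. borel"] g j by simp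
    have 2: "distr M borel (\<lambda>w. V n w - U j n w) = distr D borel (\<lambda>p. snd p - fst p j)" for n
      unfolding dist[of n, symmetric] using j by (subst distr_distr[OF g P]) (simp add: comp_def)
    show "\<exists>C. 0 \<le> C \<and> prob {w \<in> space M. \<exists>n. C + real n * c j < (\<Sum>k<n. V k w - U j k w)} \<le> e"
      by (rule iid_psum_bounded[OF 1 2 Bochner_Integration.integrable_diff[OF intV intU[OF j]], of "c j" e])
        (use mean[OF j] e in \<open>auto simp: c_def\<close>)
  qed
  from bchoice[OF this] obtain C' where C': "\<And>j. j \<in> J \<Longrightarrow> 0 \<le> C' j"
    "\<And>j. j \<in> J \<Longrightarrow> prob {w \<in> space M. \<exists>n. C' j + real n * c j < (\<Sum>k<n. V k w - U j k w)} \<le> e"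
    by blast
  define C where "C = sum C' J"
  have C: "0 \<le> C" "C' j \<le> C" if "j \<in> J" for j
    using C'(1) that J by (auto simp: C_def intro!: sum_nonneg member_le_sum)
  have C0: "0 \<le> C" using C'(1) by (simp add: C_def sum_nonneg)
  have good: "1 - e \<le> prob {w \<in> space M. (\<Sum>k<n. V k w - U j k w) \<le> C + real n * c j}" if j: "j \<in> J" for j n
  proof -
    let ?D = "{w \<in> space M. (\<Sum>k<n. V k w - U j k w) \<le> C + real n * c j}"
    let ?B = "{w \<in> space M. \<exists>n. C' j + real n * c j < (\<Sum>k<n. V k w - U j k w)}"
    have B: "?B \<in> events" and D: "?D \<in> events" using j by measurable
    have "space M - ?B \<subseteq> ?D"
    proof
      fix w assume "w \<in> space M - ?B"
      then have "w \<in> space M" "(\<Sum>k<n. V k w - U j k w) \<le> C' j + real n * c j" by (auto simp: not_less)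
      then show "w \<in> ?D" using C(2)[OF j] by simp
    qed
    then have "prob (space M - ?B) \<le> prob ?D" using D by (rule finite_measure_mono)
    then show ?thesis using prob_compl[OF B] C'(2)[OF j] by simp
  qed
  define R where "R x = {w \<in> space M. \<exists>j\<in>J. \<exists>n. x < (\<Sum>k\<le>n. U j k w) - (\<Sum>k<n. V k w)}" for x
  have R: "R x \<in> events" for x unfolding R_def using J by measurable
  \<comment> \<open>For \<open>p = (n, j)\<close> the past involves indices below \<open>n\<close>
    only, so the two conditions are independent. Subtracting the second from the first leaves a walk
    above \<open>x\<close>.\<close>
  define A where "A x p = {w \<in> space M. x + C + real (fst p) * c (snd p) < U (snd p) (fst p) w \<and>
      (\<Sum>k<fst p. V k w - U (snd p) k w) \<le> C + real (fst p) * c (snd p)}" for x p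
  have A_events: "A x p \<in> events" if "snd p \<in> J" for x p
    unfolding A_def using that by measurable
  have A_sub: "A x p \<subseteq> R x" if "snd p \<in> J" for x p
  proof
    fix w assume w: "w \<in> A x p"
    have "x < (\<Sum>k\<le>fst p. U (snd p) k w) - (\<Sum>k<fst p. V k w)"
      using w by (simp add: A_def sum_subtractf lessThan_Suc_atMost[symmetric])
    then show "w \<in> R x" using w that unfolding R_def A_def by blast
  qed
  \<comment> \<open>A common slope not above any \<open>c j\<close>, so that all jump levels compare
    with \<open>x + n * c0\<close>; the inserted 1 gives the minimum a value for empty
    \<open>J\<close> too.\<close>
  define c0 where "c0 = Min (insert 1 (m ` J))"
  have c0: "0 < c0" "\<And>j. j \<in> J \<Longrightarrow> c0 \<le> c j"
  proof -
    show "0 < c0" using J m by (auto simp: c0_def)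
    fix j assume "j \<in> J"
    then have "c0 \<le> m j" using J by (auto simp: c0_def)
    then show "c0 \<le> c j" using e by (simp add: c_def)
  qed
  \<comment> \<open>\<open>T * G x\<close> will bound the sum of all jump probabilities, uniformly
    in the number of indices; its square is \<open>o(G x)\<close>.\<close>
  define T where "T = (\<Sum>j\<in>J. d j + 1) * (1 / c0 + 1)"
  have T0: "0 \<le> T" unfolding T_def using d c0 by (intro mult_nonneg_nonneg sum_nonneg) auto
  \<comment> \<open>Calibrated so that simultaneous jumps, at most \<open>card J ^ 2\<close> ordered
    pairs for each index, cost no more than \<open>e / 2 * G x\<close> in total.\<close>
  define e1 where "e1 = e / (2 * (real (card J) ^ 2 + 1) * (1 / c0 + 1))"
  have e1: "0 < e1" unfolding e1_def using e c0 by (intro divide_pos_pos mult_pos_pos) (auto intro: add_nonneg_pos)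
  have e1': "real (card J) ^ 2 * e1 * (1 / c0 + 1) \<le> e / 2"
  proof -
    have "(real (card J) ^ 2 + 1) * e1 * (1 / c0 + 1) = e / 2"
      using c0 unfolding e1_def by (simp add: divide_simps) (smt (verit) zero_le_power2)
    moreover have "real (card J) ^ 2 * e1 * (1 / c0 + 1) \<le> (real (card J) ^ 2 + 1) * e1 * (1 / c0 + 1)"
      using e1 c0 by (intro mult_right_mono) auto
    ultimately show ?thesis by linarith
  qed
  have ev1: "eventually (\<lambda>x. \<forall>j\<in>J. \<forall>u\<ge>x. (1 - e) * d j * H u \<le> t j u) at_top"
    using J low[OF _ e(2,3)] unfolding t_def by (intro eventually_ball_finite ballI eventually_all_ge_at_top) auto
  have ev2: "eventually (\<lambda>x. \<forall>j\<in>J. \<forall>u\<ge>x. t j u \<le> (d j + 1) * H u) at_top"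
    using J up unfolding t_def by (intro eventually_ball_finite ballI eventually_all_ge_at_top) auto
  have ev3: "eventually (\<lambda>x. \<forall>i\<in>J. \<forall>j\<in>J - {i}. \<forall>u\<ge>x. s i j u \<le> e1 * H u) at_top"
    using J pair[OF _ _ _ e1] unfolding s_def by (intro eventually_ball_finite ballI eventually_all_ge_at_top) auto
  have ev4: "eventually (\<lambda>x. \<forall>N. (\<Sum>n<N. H (x + real n * c0)) \<le> (1 / c0 + 1) * G x) at_top"
    by (rule H_sum_le[OF c0(1)]) simp
  have shift: "filterlim (\<lambda>x. x + C) at_top at_top" by real_asymp
  have ev5: "eventually (\<lambda>x. \<forall>j\<in>J. \<forall>N. (G (x + C) - G (x + C + real N * c j)) / c j \<le> (\<Sum>n<N. H (x + C + real n * c j))) at_top"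
    using J c by (intro eventually_ball_finite ballI eventually_compose_filterlim[OF H_sum_ge shift]) auto
  have ev6: "eventually (\<lambda>x. (1 - e) * G x \<le> G (x + C)) at_top"
  proof -
    have "eventually (\<lambda>x. G (x - C) \<le> (1 / (1 - e)) * G x) at_top"
      using C0 e by (intro Fs.long_tailed) auto
    from eventually_compose_filterlim[OF this shift]
    show ?thesis by eventually_elim (use e in \<open>simp add: field_simps\<close>)
  qed
  have ev7: "eventually (\<lambda>x. T ^ 2 * G x \<le> e / 2) at_top"
  proof -
    have "((\<lambda>x. T ^ 2 * G x) \<longlongrightarrow> T ^ 2 * 0) at_top" by (intro tendsto_intros Fs.G_lim)
    then have "eventually (\<lambda>x. T ^ 2 * G x < e / 2) at_top" by (rule order_tendstoD(2)) (use e in simp)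
    then show ?thesis by eventually_elim simp
  qed
  from ev1 ev2 ev3 ev4 ev5 ev6 ev7 have "eventually (\<lambda>x. ((\<Sum>j\<in>J. d j / m j) - \<eta>) * G x \<le> prob (R x)) at_top"
  proof eventually_elim
    case (elim x)
    have lower: "(\<Sum>j\<in>J. (1 - e) ^ 2 * d j * ((G (x + C) - G (x + C + real N * c j)) / c j)) - e * G x \<le> prob (R x)" for N
    proof -
      let ?I = "{..<N} \<times> J"
      let ?u = "\<lambda>p. x + C + real (fst p) * c (snd p)"
      have I: "finite ?I" using J by simp
      have u_ge: "x + real (fst p) * c0 \<le> ?u p" if "p \<in> ?I" for p
        using mult_left_mono[OF c0(2)[of "snd p"], of "real (fst p)"] that C0 by auto
      have u_ge': "x \<le> x + real n * c0" for n using c0 by simp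
      have sumA: "(\<Sum>j\<in>J. (1 - e) ^ 2 * d j * ((G (x + C) - G (x + C + real N * c j)) / c j)) \<le> (\<Sum>p\<in>?I. prob (A x p))"
      proof -
        have "(\<Sum>j\<in>J. (1 - e) ^ 2 * d j * ((G (x + C) - G (x + C + real N * c j)) / c j))
          \<le> (\<Sum>j\<in>J. (1 - e) ^ 2 * d j * (\<Sum>n<N. H (x + C + real n * c j)))"
          using elim(5) d by (intro sum_mono mult_left_mono) auto
        also have "\<dots> = (\<Sum>n<N. \<Sum>j\<in>J. (1 - e) * ((1 - e) * d j * H (x + C + real n * c j)))"
          by (subst sum.swap) (simp add: sum_distrib_left power2_eq_square mult_ac)
        also have "\<dots> \<le> (\<Sum>n<N. \<Sum>j\<in>J. prob (A x (n, j)))"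
        proof (intro sum_mono)
          fix n j assume j: "j \<in> J"
          have "x \<le> x + C + real n * c j" using C0 c[OF j] by simp
          then have "(1 - e) * ((1 - e) * d j * H (x + C + real n * c j)) \<le> (1 - e) * t j (x + C + real n * c j)"
            using elim(1) j e by (intro mult_left_mono) auto
          also have "\<dots> \<le> prob {w \<in> space M. (\<Sum>k<n. V k w - U j k w) \<le> C + real n * c j} * t j (x + C + real n * c j)"
            using good[OF j, of n] by (intro mult_right_mono) (auto simp: t_def)
          also have "\<dots> = prob (A x (n, j))"
            unfolding A_def using indep_UD[OF j, of "x + C + real n * c j" n "C + real n * c j"] by simp
          finally show "(1 - e) * ((1 - e) * d j * H (x + C + real n * c j)) \<le> prob (A x (n, j))" .
        qed
        also have "\<dots> = (\<Sum>p\<in>?I. prob (A x p))" by (simp add: sum.cartesian_product)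
        finally show ?thesis .
      qed
      have sum_t: "(\<Sum>p\<in>?I. t (snd p) (?u p)) \<le> T * G x"
      proof -
        have "(\<Sum>p\<in>?I. t (snd p) (?u p)) \<le> (\<Sum>p\<in>?I. (d (snd p) + 1) * H (x + real (fst p) * c0))"
        proof (intro sum_mono)
          fix p assume p: "p \<in> ?I"
          then have j: "snd p \<in> J" by auto
          have "t (snd p) (?u p) \<le> (d (snd p) + 1) * H (?u p)"
            using elim(2) j order_trans[OF u_ge' u_ge[OF p]] by blast
          also have "\<dots> \<le> (d (snd p) + 1) * H (x + real (fst p) * c0)"
            using d[OF j] u_ge[OF p] by (intro mult_left_mono F.G_antimono) auto
          finally show "t (snd p) (?u p) \<le> (d (snd p) + 1) * H (x + real (fst p) * c0)" .
        qed
        also have "\<dots> = (\<Sum>n<N. \<Sum>j\<in>J. (d j + 1) * H (x + real n * c0))"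
          by (simp add: sum.cartesian_product split_beta')
        also have "\<dots> = (\<Sum>j\<in>J. d j + 1) * (\<Sum>n<N. H (x + real n * c0))"
          by (simp only: sum_distrib_right[symmetric] sum_distrib_left[symmetric])
        also have "\<dots> \<le> (\<Sum>j\<in>J. d j + 1) * ((1 / c0 + 1) * G x)"
          using elim(4) d by (intro mult_left_mono sum_nonneg) auto
        finally show ?thesis by (simp add: T_def mult_ac)
      qed
      let ?v = "\<lambda>p q :: nat \<times> nat. if fst p = fst q then e1 * H (x + real (fst p) * c0) else 0"
      \<comment> \<open>For equal indices the components may be dependent, and the assumption on
        \<open>s\<close> gives \<open>?v\<close>; for different indices independence gives the
        product.\<close>
      have pairs: "prob (A x p \<inter> A x q) \<le> t (snd p) (?u p) * t (snd q) (?u q) + ?v p q"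
        if pq: "p \<in> ?I" "q \<in> ?I" "q \<noteq> p" for p q
      proof -
        have j: "snd p \<in> J" "snd q \<in> J" using pq by auto
        show ?thesis
        proof (cases "fst p = fst q")
          case True
          then have ne: "snd p \<noteq> snd q" using pq by (auto simp: prod_eq_iff)
          have "A x p \<inter> A x q \<subseteq> {w \<in> space M. x + real (fst p) * c0 < U (snd p) (fst p) w \<and> x + real (fst p) * c0 < U (snd q) (fst p) w}"
            using u_ge[OF pq(1)] u_ge[OF pq(2)] True by (auto simp: A_def)
          then have "prob (A x p \<inter> A x q) \<le> prob {w \<in> space M. x + real (fst p) * c0 < U (snd p) (fst p) w \<and> x + real (fst p) * c0 < U (snd q) (fst p) w}"
            using j by (intro finite_measure_mono) measurable
          also have "\<dots> = s (snd p) (snd q) (x + real (fst p) * c0)" by (rule s_eq[OF j])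
          also have "\<dots> \<le> e1 * H (x + real (fst p) * c0)" 
            by (intro elim(3)[rule_format]) (use j ne u_ge' in auto)
          finally show ?thesis using True by (simp add: t_def add_increasing)
        next
          case False
          have "A x p \<inter> A x q \<subseteq> {w \<in> space M. ?u p < U (snd p) (fst p) w \<and> ?u q < U (snd q) (fst q) w}"
            by (auto simp: A_def)
          then have "prob (A x p \<inter> A x q) \<le> prob {w \<in> space M. ?u p < U (snd p) (fst p) w \<and> ?u q < U (snd q) (fst q) w}"
            using j by (intro finite_measure_mono) measurable
          also have "\<dots> = t (snd p) (?u p) * t (snd q) (?u q)" by (rule indep_UU[OF j False])
          finally show ?thesis using False by simp
        qed
      qed
      have "(\<Sum>p\<in>?I. \<Sum>q\<in>?I - {p}. prob (A x p \<inter> A x q)) \<le> (\<Sum>p\<in>?I. \<Sum>q\<in>?I - {p}. t (snd p) (?u p) * t (snd q) (?u q) + ?v p q)"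
        by (intro sum_mono pairs) auto
      \<comment> \<open>Adding the nonnegative diagonal terms completes the square.\<close>
      also have "\<dots> \<le> (\<Sum>p\<in>?I. \<Sum>q\<in>?I. t (snd p) (?u p) * t (snd q) (?u q) + ?v p q)"
      proof (intro sum_mono sum_mono2)
        fix p q
        show "0 \<le> t (snd p) (?u p) * t (snd q) (?u q) + ?v p q"
          using e1 F.G_pos[of "x + real (fst p) * c0"] by (intro add_nonneg_nonneg mult_nonneg_nonneg) (auto simp: t_def less_imp_le)
      qed (use I in auto)
      also have "\<dots> = (\<Sum>p\<in>?I. t (snd p) (?u p)) ^ 2 + (\<Sum>p\<in>?I. \<Sum>q\<in>?I. ?v p q)"
        by (simp only: sum.distrib sum_product power2_eq_square)
      also have "(\<Sum>p\<in>?I. \<Sum>q\<in>?I. ?v p q) = real (card J) ^ 2 * e1 * (\<Sum>n<N. H (x + real n * c0))"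
      proof -
        have "(\<Sum>q\<in>?I. ?v p q) = real (card J) * (e1 * H (x + real (fst p) * c0))" if "p \<in> ?I" for p
        proof -
          have "(\<Sum>q\<in>?I. ?v p q) = (\<Sum>n<N. \<Sum>j\<in>J. if fst p = n then e1 * H (x + real (fst p) * c0) else 0)"
            by (subst sum.cartesian_product) (simp add: split_beta')
          also have "\<dots> = (\<Sum>n<N. if fst p = n then real (card J) * (e1 * H (x + real (fst p) * c0)) else 0)"
            by (intro sum.cong) auto
          also have "\<dots> = real (card J) * (e1 * H (x + real (fst p) * c0))"
            using that by (subst sum.delta') auto
          finally show ?thesis .
        qed
        then have "(\<Sum>p\<in>?I. \<Sum>q\<in>?I. ?v p q) = (\<Sum>p\<in>?I. real (card J) * (e1 * H (x + real (fst p) * c0)))"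
          by (intro sum.cong) auto
        also have "\<dots> = (\<Sum>n<N. \<Sum>j\<in>J. real (card J) * (e1 * H (x + real n * c0)))"
          by (subst sum.cartesian_product) (simp add: split_beta')
        also have "\<dots> = real (card J) ^ 2 * e1 * (\<Sum>n<N. H (x + real n * c0))"
          by (simp add: sum_distrib_left power2_eq_square mult_ac)
        finally show ?thesis .
      qed
      also have "(\<Sum>p\<in>?I. t (snd p) (?u p)) ^ 2 \<le> (T * G x) ^ 2"
        by (intro power_mono sum_t sum_nonneg) (simp add: t_def)
      also have "(T * G x) ^ 2 \<le> e / 2 * G x"
        using mult_right_mono[OF elim(7), of "G x"] Fs.G_pos[of x] by (simp add: power2_eq_square mult_ac)
      also have "real (card J) ^ 2 * e1 * (\<Sum>n<N. H (x + real n * c0)) \<le> real (card J) ^ 2 * e1 * ((1 / c0 + 1) * G x)"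
        using elim(4) e1 by (intro mult_left_mono) auto
      also have "\<dots> \<le> e / 2 * G x"
        using mult_right_mono[OF e1', of "G x"] Fs.G_pos[of x] by (simp add: mult_ac)
      finally have err: "(\<Sum>p\<in>?I. \<Sum>q\<in>?I - {p}. prob (A x p \<inter> A x q)) \<le> e * G x" by simp
      have "(\<Sum>p\<in>?I. prob (A x p)) - (\<Sum>p\<in>?I. \<Sum>q\<in>?I - {p}. prob (A x p \<inter> A x q)) \<le> prob (\<Union>p\<in>?I. A x p)"
        using A_events by (intro bonferroni_lower I) auto
      also have "\<dots> \<le> prob (R x)"
        by (intro finite_measure_mono R UN_least A_sub) auto
      finally show ?thesis using sumA err by simp
    qed
    \<comment> \<open>Finitely many jump indices were needed for Bonferroni's inequality; the error
      \<open>e * G x\<close> does not depend on \<open>N\<close>, so the missing tail can be sent to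
      0.\<close>
    have "(\<lambda>N. (\<Sum>j\<in>J. (1 - e) ^ 2 * d j * ((G (x + C) - G (x + C + real N * c j)) / c j)) - e * G x)
      \<longlonglongrightarrow> (\<Sum>j\<in>J. (1 - e) ^ 2 * d j * ((G (x + C) - 0) / c j)) - e * G x"
    proof (intro tendsto_intros)
      fix j assume "j \<in> J"
      then have "0 < c j" by (rule c)
      then have "filterlim (\<lambda>N. x + C + real N * c j) at_top sequentially" by real_asymp
      then show "(\<lambda>N. G (x + C + real N * c j)) \<longlonglongrightarrow> 0" by (rule filterlim_compose[OF Fs.G_lim])
      show "c j \<noteq> 0" using \<open>0 < c j\<close> by simp
    qed
    then have "(\<Sum>j\<in>J. (1 - e) ^ 2 * d j * ((G (x + C) - 0) / c j)) - e * G x \<le> prob (R x)"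
      by (rule LIMSEQ_le_const2) (use lower in auto)
    moreover have "(\<Sum>j\<in>J. (1 - e) ^ 3 * d j / (m j + e)) * G x \<le> (\<Sum>j\<in>J. (1 - e) ^ 2 * d j * ((G (x + C) - 0) / c j))"
      unfolding sum_distrib_right
    proof (intro sum_mono)
      fix j assume j: "j \<in> J"
      have "(1 - e) ^ 2 * d j / c j * ((1 - e) * G x) \<le> (1 - e) ^ 2 * d j / c j * G (x + C)"
        using elim(6) d[OF j] c[OF j] by (intro mult_left_mono) auto
      then show "(1 - e) ^ 3 * d j / (m j + e) * G x \<le> (1 - e) ^ 2 * d j * ((G (x + C) - 0) / c j)"
        by (simp add: c_def power2_eq_square power3_eq_cube mult_ac)
    qed
    moreover have "((\<Sum>j\<in>J. d j / m j) - \<eta>) * G x \<le> ((\<Sum>j\<in>J. (1 - e) ^ 3 * d j / (m j + e)) - e) * G x"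
      using e(1) Fs.G_pos[of x] by (intro mult_right_mono) auto
    ultimately show ?case by (simp only: left_diff_distrib)
  qed
  then show ?thesis by (simp only: R_def)
qed

section \<open>Monotone-separable networks\<close>

lemma last_activity_cong:
  assumes "\<And>k. m \<le> k \<Longrightarrow> k \<le> n \<Longrightarrow> T k = T' k"
  shows "last_activity f z T m n = last_activity f z T' m n"
  unfolding last_activity_def using assms by (intro arg_cong[where f="f _"] restrict_ext) auto

context
  fixes f :: "nat \<Rightarrow> (nat \<Rightarrow> real \<times> 'k) \<Rightarrow> real" and z :: "int \<Rightarrow> 'k"
  assumes ms: "monotone_separable f z"
begin

lemma last_activity_ge: "mono T \<Longrightarrow> m \<le> n \<Longrightarrow> T n \<le> last_activity f z T m n"
  using ms by (auto simp: monotone_separable_def)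

lemma last_activity_mono:
  "mono T \<Longrightarrow> mono T' \<Longrightarrow> m \<le> n \<Longrightarrow> (\<And>k. T k \<le> T' k) \<Longrightarrow> last_activity f z T m n \<le> last_activity f z T' m n"
  using ms by (auto simp: monotone_separable_def)

lemma last_activity_shift: "mono T \<Longrightarrow> m \<le> n \<Longrightarrow> last_activity f z (\<lambda>k. c + T k) m n = last_activity f z T m n + c"
  using ms by (auto simp: monotone_separable_def)

lemma last_activity_separable:
  "mono T \<Longrightarrow> m \<le> l \<Longrightarrow> l < n \<Longrightarrow> last_activity f z T m l \<le> T (l + 1) \<Longrightarrow>
    last_activity f z T m n = last_activity f z T (l + 1) n"
  using ms unfolding monotone_separable_def by (meson less_imp_le order_trans)

lemma last_activity_const: "m \<le> n \<Longrightarrow> last_activity f z (\<lambda>_. c) m n = last_activity f z (\<lambda>_. 0) m n + c"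
  using last_activity_shift[of "\<lambda>_. 0" m n c] by (simp add: mono_def)

lemma maximal_dater_nonneg: "mono T \<Longrightarrow> m \<le> n \<Longrightarrow> 0 \<le> maximal_dater f z T m n"
  using last_activity_ge by (simp add: maximal_dater_def)

lemma maximal_dater_single: "maximal_dater f z T i i = maximal_dater f z (\<lambda>_. 0) i i"
  using last_activity_cong[of i i T "\<lambda>_. T i" f z] last_activity_const[of i i "T i"]
  by (simp add: maximal_dater_def)

text \<open>Moving the first arrival far enough to the left separates it from the others without
  delaying anything.\<close>

lemma maximal_dater_Suc_le:
  assumes T: "mono T" and mn: "m < n"
  shows "maximal_dater f z T (m + 1) n \<le> maximal_dater f z T m n"
proof -
  define c where "c = last_activity f z (\<lambda>_. 0) m m"
  define T' where "T' k = (if k \<le> m then min (T k) (T (m + 1) - c) else T k)" for k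
  have c: "0 \<le> c" using last_activity_ge[of "\<lambda>_. 0" m m] by (simp add: c_def mono_def)
  have T': "mono T'"
  proof (rule monoI)
    fix i j :: int assume ij: "i \<le> j"
    show "T' i \<le> T' j" using monoD[OF T ij] ij by (auto simp: T'_def)
  qed
  have "last_activity f z T' m m = T' m + c"
    using last_activity_cong[of m m T' "\<lambda>_. T' m" f z] last_activity_const[of m m "T' m"] by (simp add: c_def)
  also have "\<dots> \<le> T' (m + 1)" by (simp add: T'_def)
  finally have "last_activity f z T' m n = last_activity f z T' (m + 1) n"
    using last_activity_separable[OF T', of m m n] mn by simp
  also have "\<dots> = last_activity f z T (m + 1) n" by (rule last_activity_cong) (simp add: T'_def)
  finally have "last_activity f z T (m + 1) n \<le> last_activity f z T m n"
    using last_activity_mono[OF T' T, of m n] mn by (simp add: T'_def)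
  then show ?thesis by (simp add: maximal_dater_def)
qed

text \<open>All arrivals of the window are moved back to \<open>T m\<close>, which by monotonicity
  cannot delay the last activity. Monotonicity compares whole inputs, so \<open>T\<close> is first
  raised to \<open>T m\<close> before the window, where it does not matter.\<close>

lemma maximal_dater_ge_degenerate:
  assumes T: "mono T" and mn: "m \<le> n"
  shows "maximal_dater f z (\<lambda>_. 0) m n - (T n - T m) \<le> maximal_dater f z T m n"
proof -
  define T' where "T' k = max (T k) (T m)" for k
  have T': "mono T'" using T by (auto simp: mono_def T'_def max_def intro: order_trans)
  have "last_activity f z (\<lambda>_. T m) m n \<le> last_activity f z T' m n"
    using mn by (intro last_activity_mono T') (auto simp: T'_def mono_def)
  also have "\<dots> = last_activity f z T m n"
    by (rule last_activity_cong) (use monoD[OF T] in \<open>force simp: T'_def max_def intro: antisym\<close>)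
  finally show ?thesis using last_activity_const[OF mn, of "T m"] by (simp add: maximal_dater_def)
qed

text \<open>Holding back the second batch until the first is finished only delays the last activity,
  and separability then removes the first batch.\<close>

lemma maximal_dater_subadditive:
  assumes "m \<le> l" "l < n"
  shows "maximal_dater f z (\<lambda>_. 0) m n \<le> maximal_dater f z (\<lambda>_. 0) m l + maximal_dater f z (\<lambda>_. 0) (l + 1) n"
proof -
  define c where "c = last_activity f z (\<lambda>_. 0) m l"
  define T' where "T' k = (if k \<le> l then 0 else c)" for k
  have c: "0 \<le> c" using last_activity_ge[of "\<lambda>_. 0" m l] assms by (simp add: c_def mono_def)
  have T': "mono T'" using c by (auto simp: mono_def T'_def)
  have "last_activity f z (\<lambda>_. 0) m n \<le> last_activity f z T' m n"
    using assms c by (intro last_activity_mono T') (auto simp: T'_def mono_def)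
  also have "last_activity f z T' m n = last_activity f z T' (l + 1) n"
  proof (rule last_activity_separable[OF T' assms])
    have "last_activity f z T' m l = c" unfolding c_def by (rule last_activity_cong) (simp add: T'_def)
    then show "last_activity f z T' m l \<le> T' (l + 1)" by (simp add: T'_def)
  qed
  also have "\<dots> = last_activity f z (\<lambda>_. c) (l + 1) n"
    by (rule last_activity_cong) (simp add: T'_def)
  also have "\<dots> = last_activity f z (\<lambda>_. 0) (l + 1) n + c" using assms by (intro last_activity_const) simp
  finally show ?thesis by (simp add: maximal_dater_def c_def)
qed

lemma maximal_dater_le_sum: "maximal_dater f z (\<lambda>_. 0) m (m + int k) \<le> (\<Sum>i=m..m + int k. maximal_dater f z (\<lambda>_. 0) i i)"
proof (induction k)
  case (Suc k)
  have "{m..m + int (Suc k)} = insert (m + int (Suc k)) {m..m + int k}" by auto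
  then have "(\<Sum>i=m..m + int (Suc k). maximal_dater f z (\<lambda>_. 0) i i)
      = maximal_dater f z (\<lambda>_. 0) (m + int (Suc k)) (m + int (Suc k)) + (\<Sum>i=m..m + int k. maximal_dater f z (\<lambda>_. 0) i i)"
    by simp
  moreover have "maximal_dater f z (\<lambda>_. 0) m (m + int (Suc k))
      \<le> maximal_dater f z (\<lambda>_. 0) m (m + int k) + maximal_dater f z (\<lambda>_. 0) (m + int (Suc k)) (m + int (Suc k))"
    using maximal_dater_subadditive[of m "m + int k" "m + int (Suc k)"] by (simp add: add_ac)
  ultimately show ?case using Suc by linarith
qed simp

text \<open>The daters increase with the window, so the limit is a supremum and a strict inequality
  is attained at a finite stage.\<close>

lemma less_stationary_maximal_dater_iff:
  assumes T: "mono T"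
  shows "ereal x < stationary_maximal_dater f z T \<longleftrightarrow> (\<exists>n. x < maximal_dater f z T (- int n) 0)"
proof -
  have "incseq (\<lambda>n. ereal (maximal_dater f z T (- int n) 0))"
  proof (rule incseq_SucI)
    fix n
    show "ereal (maximal_dater f z T (- int n) 0) \<le> ereal (maximal_dater f z T (- int (Suc n)) 0)"
      using maximal_dater_Suc_le[OF T, of "- int (Suc n)" 0] by simp
  qed
  from LIMSEQ_SUP[OF this]
  have "stationary_maximal_dater f z T = (SUP n. ereal (maximal_dater f z T (- int n) 0))"
    unfolding stationary_maximal_dater_def by (rule limI)
  then show ?thesis by (simp add: less_SUP_iff)
qed

end

section \<open>Measurability, stationarity and the comparison of means with
  \<open>\<gamma>0\<close>\<close>

lemma maximal_dater_measurable:
  assumes f: "network_measurable K f" and T[measurable]: "\<And>n. T n \<in> borel_measurable M"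
    and z[measurable]: "\<And>n. \<zeta> n \<in> measurable M K" and mn: "m \<le> n"
  shows "(\<lambda>w. maximal_dater f (\<lambda>k. \<zeta> k w) (\<lambda>k. T k w) m n) \<in> borel_measurable M"
proof -
  have A: "(\<lambda>w. \<lambda>i\<in>{..<nat (n - m + 1)}. (T (m + int i) w, \<zeta> (m + int i) w))
      \<in> measurable M (\<Pi>\<^sub>M i\<in>{..<nat (n - m + 1)}. borel \<Otimes>\<^sub>M K)"
    by (rule measurable_restrict) measurable
  have B: "f (nat (n - m + 1)) \<in> borel_measurable (\<Pi>\<^sub>M i\<in>{..<nat (n - m + 1)}. borel \<Otimes>\<^sub>M K)"
    using f mn by (auto simp: network_measurable_def)
  show ?thesis
    using borel_measurable_diff[OF measurable_compose[OF A B] T[of n]]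
    by (simp add: maximal_dater_def last_activity_def)
qed

text \<open>\<open>\<gamma>0\<close> is defined by windows ending at -1, the lower bound in (AA) by
  windows ending at 0. The dater is a functional of the path, so stationarity bridges the shift by
  one.\<close>

lemma (in prob_space) degenerate_dater_integral_shift:
  fixes f :: "nat \<Rightarrow> (nat \<Rightarrow> real \<times> 'k) \<Rightarrow> real" and \<tau> :: "int \<Rightarrow> 'a \<Rightarrow> real"
  assumes f: "network_measurable K f"
    and st: "stationary_process M (borel \<Otimes>\<^sub>M K) (\<lambda>n w. (\<tau> n w, \<zeta> n w))" and n: "1 \<le> n"
  shows "(LINT w|M. maximal_dater f (\<lambda>i. \<zeta> i w) (\<lambda>_. 0) (- int n) (- 1))
    = (LINT w|M. maximal_dater f (\<lambda>i. \<zeta> i w) (\<lambda>_. 0) (- int n + 1) 0)"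
proof -
  let ?S = "borel \<Otimes>\<^sub>M K :: (real \<times> 'k) measure"
  let ?P = "\<Pi>\<^sub>M n\<in>(UNIV :: int set). ?S"
  let ?X = "\<lambda>n w. (\<tau> n w, \<zeta> n w)"
  define g where "g x = f n (\<lambda>i\<in>{..<n}. (0, snd (x (- int n + int i))))" for x :: "int \<Rightarrow> real \<times> 'k"
  have X: "?X i \<in> measurable M ?S" for i using st by (auto simp: stationary_process_def)
  have g: "g \<in> borel_measurable ?P"
  proof -
    have "(\<lambda>x. snd (x k)) \<in> measurable ?P K" for k :: int
      by (rule measurable_compose[where f="\<lambda>x. x k" and N="?S"]) (simp_all add: measurable_component_singleton)
    then have "(\<lambda>x. \<lambda>i\<in>{..<n}. (0 :: real, snd (x (- int n + int i)))) \<in> measurable ?P (\<Pi>\<^sub>M i\<in>{..<n}. ?S)"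
      by (intro measurable_restrict measurable_Pair) simp_all
    moreover have "f n \<in> borel_measurable (\<Pi>\<^sub>M i\<in>{..<n}. ?S)" using f n by (auto simp: network_measurable_def)
    ultimately show ?thesis unfolding g_def by (rule measurable_compose)
  qed
  have seq: "(\<lambda>w i. ?X (h i) w) \<in> measurable M ?P" for h :: "int \<Rightarrow> int"
    by (rule measurable_PiM_single') (use X measurable_space[OF X] in auto)
  have "(LINT w|M. maximal_dater f (\<lambda>i. \<zeta> i w) (\<lambda>_. 0) (- int n) (- 1)) = (LINT w|M. g (\<lambda>i. ?X i w))"
    by (simp add: maximal_dater_def last_activity_def g_def)
  also have "\<dots> = (LINT x|process_law M ?S ?X. g x)"
    unfolding process_law_def by (rule integral_distr[OF seq g, symmetric])
  also have "process_law M ?S ?X = process_law M ?S (\<lambda>n. ?X (n + 1))"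
    using st by (simp add: stationary_process_def)
  also have "(LINT x|process_law M ?S (\<lambda>n. ?X (n + 1)). g x) = (LINT w|M. g (\<lambda>i. ?X (i + 1) w))"
    unfolding process_law_def by (rule integral_distr[OF seq g])
  also have "\<dots> = (LINT w|M. maximal_dater f (\<lambda>i. \<zeta> i w) (\<lambda>_. 0) (- int n + 1) 0)"
    by (simp add: maximal_dater_def last_activity_def g_def algebra_simps)
  finally show ?thesis .
qed

text \<open>A window of \<open>n\<close> indices ending at 0 gives \<open>n * b\<close> as a lower
  bound for the mean of the degenerate dater; division by \<open>n\<close> and the limit yield the
  claim.\<close>

lemma (in prob_space) mean_le_gamma0:
  fixes f :: "nat \<Rightarrow> (nat \<Rightarrow> real \<times> 'k) \<Rightarrow> real" and \<tau> :: "int \<Rightarrow> 'a \<Rightarrow> real" and B :: "int \<Rightarrow> 'a \<Rightarrow> real"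
  assumes f: "network_measurable K f" and z: "\<And>n. \<zeta> n \<in> measurable M K"
    and ms: "\<And>w. w \<in> space M \<Longrightarrow> monotone_separable f (\<lambda>n. \<zeta> n w)"
    and st: "stationary_process M (borel \<Otimes>\<^sub>M K) (\<lambda>n w. (\<tau> n w, \<zeta> n w))"
    and int: "\<And>n. integrable M (\<lambda>w. maximal_dater f (\<lambda>k. \<zeta> k w) (\<lambda>_. 0) n n)"
    and g: "is_gamma0 M f \<zeta> \<gamma>0"
    and B: "\<And>i. integrable M (B i)" "\<And>i. expectation (B i) = b"
    and le: "\<And>n. n \<le> 0 \<Longrightarrow> AE w in M. (\<Sum>i=n..0. B i w) \<le> maximal_dater f (\<lambda>k. \<zeta> k w) (\<lambda>_. 0) n 0"
  shows "b \<le> \<gamma>0"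
proof -
  let ?Z = "\<lambda>m n w. maximal_dater f (\<lambda>k. \<zeta> k w) (\<lambda>_. 0) m n"
  have "b \<le> (LINT w|M. ?Z (- int n) (- 1) w) / real n" if n: "1 \<le> n" for n
  proof -
    define m where "m = - int n + 1"
    have m0: "m + int (n - 1) = 0" using n by (simp add: m_def)
    \<comment> \<open>Comparing expectations requires integrability: the dater lies between 0 and
      the sum of the single daters.\<close>
    have Zi: "integrable M (?Z m 0)"
    proof (rule Bochner_Integration.integrable_bound)
      show "integrable M (\<lambda>w. \<Sum>i=m..0. ?Z i i w)" by (intro Bochner_Integration.integrable_sum int)
      show "?Z m 0 \<in> borel_measurable M"
        by (intro maximal_dater_measurable[OF f _ z]) (use n in \<open>auto simp: m_def\<close>)
      show "AE w in M. norm (?Z m 0 w) \<le> norm (\<Sum>i=m..0. ?Z i i w)"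
      proof (intro AE_I2)
        fix w assume w: "w \<in> space M"
        have "0 \<le> ?Z m 0 w" using n by (intro maximal_dater_nonneg[OF ms[OF w]]) (auto simp: mono_def m_def)
        moreover have "?Z m 0 w \<le> (\<Sum>i=m..0. ?Z i i w)"
          using maximal_dater_le_sum[OF ms[OF w], of m "n - 1"] by (simp only: m0)
        ultimately show "norm (?Z m 0 w) \<le> norm (\<Sum>i=m..0. ?Z i i w)" by simp
      qed
    qed
    have "real n * b = expectation (\<lambda>w. \<Sum>i=m..0. B i w)"
      using n B by (subst Bochner_Integration.integral_sum) (auto simp: m_def)
    also have "\<dots> \<le> expectation (?Z m 0)"
      using le[of m] n B(1) by (intro integral_mono_AE Zi Bochner_Integration.integrable_sum) (auto simp: m_def)
    also have "\<dots> = (LINT w|M. ?Z (- int n) (- 1) w)"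
      unfolding m_def by (rule degenerate_dater_integral_shift[OF f st n, symmetric])
    finally show ?thesis using n by (simp add: field_simps)
  qed
  then show ?thesis
    using g unfolding is_gamma0_def by (blast intro: LIMSEQ_le_const)
qed

section \<open>The coupled walks\<close>

lemma tail_equiv_upper:
  assumes t: "tail_equiv t d H" and H: "\<And>x. 0 < H x" and e: "0 < e"
  shows "eventually (\<lambda>x. t x \<le> (d + e) * H x) at_top"
proof (cases "d = 0")
  case True
  then have "t \<in> o[at_top](H)" using t by (simp add: tail_equiv_def)
  from landau_o.smallD[OF this e] have "eventually (\<lambda>x. norm (t x) \<le> e * norm (H x)) at_top" .
  then show ?thesis
  proof eventually_elim
    case (elim x)
    then show ?case using H[of x] True by simp
  qed
next
  case False
  then have "((\<lambda>x. t x / H x) \<longlongrightarrow> d) at_top" using t by (simp add: tail_equiv_def)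
  from order_tendstoD(2)[OF this, of "d + e"] have "eventually (\<lambda>x. t x / H x < d + e) at_top" using e by simp
  then show ?thesis
  proof eventually_elim
    case (elim x)
    then show ?case using H[of x] by (simp add: field_simps)
  qed
qed

text \<open>The loss is multiplicative, so that for \<open>d = 0\<close> the bound holds trivially
  and little-o information is not asked for.\<close>

lemma tail_equiv_lower:
  assumes t: "tail_equiv t d H" and H: "\<And>x. 0 < H x" and d: "0 \<le> d" and e: "0 < e" and t0: "\<And>x. 0 \<le> t x"
  shows "eventually (\<lambda>x. (1 - e) * d * H x \<le> t x) at_top"
proof (cases "d = 0")
  case False
  then have d0: "0 < d" and "((\<lambda>x. t x / H x) \<longlongrightarrow> d) at_top" using t d by (simp_all add: tail_equiv_def)
  from order_tendstoD(1)[OF this(2), of "(1 - e) * d"] have "eventually (\<lambda>x. (1 - e) * d < t x / H x) at_top"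
    using e d0 by simp
  then show ?thesis
  proof eventually_elim
    case (elim x)
    then show ?case using H[of x] by (simp add: field_simps)
  qed
qed (use t0 in simp)

text \<open>Condition (H) forces the components to be asymptotically disjoint: the sum of the
  probabilities minus the probability of the union dominates every pairwise intersection.\<close>

lemma (in prob_space) cond_H_pair:
  assumes H: "cond_H M r Y F d" and Y: "\<And>j. j \<in> {1..r} \<Longrightarrow> Y j 1 \<in> borel_measurable M"
    and d: "0 < (\<Sum>j=1..r. d j)" and F: "\<And>x. F x < 1"
    and ij: "i \<in> {1..r}" "j \<in> {1..r}" "i \<noteq> j" and e: "0 < e"
  shows "eventually (\<lambda>x. prob {w \<in> space M. x < Y i 1 w \<and> x < Y j 1 w} \<le> e * (1 - F x)) at_top"
proof -
  let ?J = "{1..r}"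
  let ?A = "\<lambda>x j. {w \<in> space M. x < Y j 1 w}"
  let ?d = "\<Sum>j=1..r. d j" and ?S = "\<lambda>x. \<Sum>j\<in>?J. prob (?A x j)"
  have A: "?A x j \<in> events" if "j \<in> ?J" for x j using Y[OF that] by measurable
  have "((\<lambda>x. prob {w \<in> space M. (MAX j\<in>{1..r}. Y j 1 w) > x} / ?S x) \<longlongrightarrow> 1) at_top"
    using H by (simp add: cond_H_def tail_equiv_def)
  \<comment> \<open>Eventually \<open>?S x \<le> 2 * ?d * (1 - F x)\<close>, so a relative deficit
    \<open>e / (2 * ?d)\<close> of the union is at most \<open>e * (1 - F x)\<close>.\<close>
  from order_tendstoD(1)[OF this, of "1 - e / (2 * ?d)"]
  have 1: "eventually (\<lambda>x. 1 - e / (2 * ?d) < prob {w \<in> space M. (MAX j\<in>{1..r}. Y j 1 w) > x} / ?S x) at_top"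
    using e d by simp
  have "tail_equiv ?S ?d (\<lambda>x. 1 - F x)" using H by (simp add: cond_H_def)
  from tail_equiv_upper[OF this _ d] have 2: "eventually (\<lambda>x. ?S x \<le> (?d + ?d) * (1 - F x)) at_top"
    using F by simp
  show ?thesis using 1 2
  proof eventually_elim
    case (elim x)
    have max: "{w \<in> space M. (MAX j\<in>{1..r}. Y j 1 w) > x} = (\<Union>j\<in>?J. ?A x j)"
      using ij(1) by (subst Max_gr_iff) auto
    have S0: "0 \<le> ?S x" by (simp add: sum_nonneg)
    \<comment> \<open>The quotient says nothing when \<open>?S x = 0\<close>, a division by zero,
      but then the left side is 0.\<close>
    have "(1 - e / (2 * ?d)) * ?S x \<le> prob (\<Union>j\<in>?J. ?A x j)"
    proof (cases "?S x = 0")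
      case False
      then have "0 < ?S x" using S0 by linarith
      from less_imp_le[OF iffD1[OF pos_less_divide_eq[OF this] elim(1)]] show ?thesis
        by (simp only: max)
    qed simp
    moreover have "prob (\<Union>j\<in>?J. ?A x j) + prob (?A x i \<inter> ?A x j) \<le> ?S x"
    proof -
      have "(\<Union>j\<in>?J. ?A x j) = (\<Union>k\<in>?J - {i}. ?A x k) \<union> (?A x i - ?A x j)"
        using ij by auto
      then have "prob (\<Union>j\<in>?J. ?A x j) \<le> prob (\<Union>k\<in>?J - {i}. ?A x k) + prob (?A x i - ?A x j)"
        using A ij by (simp only:) (intro measure_Un_le; auto)
      also have "prob (\<Union>k\<in>?J - {i}. ?A x k) \<le> (\<Sum>k\<in>?J - {i}. prob (?A x k))"
        using A by (intro finite_measure_subadditive_finite) auto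
      also have "prob (?A x i - ?A x j) = prob (?A x i) - prob (?A x i \<inter> ?A x j)"
        using A ij by (intro finite_measure_Diff') auto
      also have "(\<Sum>k\<in>?J - {i}. prob (?A x k)) + (prob (?A x i) - prob (?A x i \<inter> ?A x j)) = ?S x - prob (?A x i \<inter> ?A x j)"
      proof -
        have "?S x = prob (?A x i) + (\<Sum>k\<in>?J - {i}. prob (?A x k))"
          by (rule sum.remove) (use ij in auto)
        then show ?thesis by linarith
      qed
      finally show ?thesis by simp
    qed
    ultimately have "prob (?A x i \<inter> ?A x j) \<le> e / (2 * ?d) * ?S x" by (simp add: algebra_simps)
    also have "\<dots> \<le> e / (2 * ?d) * ((?d + ?d) * (1 - F x))"
      using elim(2) e d by (intro mult_left_mono) auto
    also have "\<dots> = e * (1 - F x)" using d by (simp add: field_simps)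
    also have "?A x i \<inter> ?A x j = {w \<in> space M. x < Y i 1 w \<and> x < Y j 1 w}" by auto
    finally show ?case .
  qed
qed

section \<open>The tail of \<open>R_lower\<close>\<close>

lemma sum_int_reverse: "(\<Sum>i=- int n..0. h i) = (\<Sum>k\<le>n. h (- int k))"
  by (rule sum.reindex_bij_witness[of _ "\<lambda>k. - int k" "\<lambda>i. nat (- i)"]) auto

lemma sum_int_reverse': "(\<Sum>i=- int n..-1. h i) = (\<Sum>k<n. h (- int k - 1))"
  by (rule sum.reindex_bij_witness[of _ "\<lambda>k. - int k - 1" "\<lambda>i. nat (- i - 1)"]) auto

lemma less_R_lower_iff:
  assumes r: "1 \<le> r"
  shows "ereal x < R_lower r Y \<tau> w \<longleftrightarrow>
    (\<exists>j\<in>{1..r}. \<exists>n. x < (\<Sum>k\<le>n. Y j (- int k) w) - (\<Sum>k<n. \<tau> (- int k - 1) w))"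
proof -
  have "(\<exists>n\<in>{..0::int}. P n) \<longleftrightarrow> (\<exists>n. P (- int n))" for P
    by (metis atMost_iff int_nat_eq minus_minus neg_0_le_iff_le nonpos_int_cases of_nat_0_le_iff)
  then show ?thesis
    using r unfolding R_lower_def
    by (subst Max_gr_iff) (auto simp: less_SUP_iff sum_int_reverse sum_int_reverse')
qed

lemma (in prob_space) iid_processD:
  assumes "iid_process M S X"
  shows "indep_vars (\<lambda>_. S) X UNIV" "X n \<in> measurable M S" "distr M S (X n) = distr M S (X m)"
proof -
  show "indep_vars (\<lambda>_. S) X UNIV" "X n \<in> measurable M S"
    using assms by (simp_all add: iid_process_def indep_vars_def)
  have "distr M S (X k) = distr M S (X 0)" for k using assms by (simp add: iid_process_def)
  from this[of n] this[of m] show "distr M S (X n) = distr M S (X m)" by simp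
qed

text \<open>The two bounds group the variables differently. Above, \<open>Y j (- n)\<close> goes
  with \<open>\<tau> (- n)\<close>, which gives a walk with delayed first step \<open>Y j 0\<close>.
  Below, it goes with \<open>\<tau> (- n - 1)\<close>, so that the sums with one \<open>Y\<close>
  more than \<open>\<tau>\<close> consist of a jump and complete earlier pairs.\<close>

theorem (in prob_space) R_lower_asymptotics:
  fixes \<tau> :: "int \<Rightarrow> 'a \<Rightarrow> real" and Y :: "nat \<Rightarrow> int \<Rightarrow> 'a \<Rightarrow> real"
  assumes r: "1 \<le> r" and \<tau>: "iid_process M borel \<tau>" and \<tau>0: "\<And>n w. w \<in> space M \<Longrightarrow> 0 \<le> \<tau> n w"
    and \<tau>_int: "\<And>n. integrable M (\<tau> n)" "\<And>n. expectation (\<tau> n) = a"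
    and Y: "iid_process M (\<Pi>\<^sub>M j\<in>{1..r}. borel) (\<lambda>i w. \<lambda>j\<in>{1..r}. Y j i w)"
    and ip: "indep_processes M (\<Pi>\<^sub>M j\<in>{1..r}. borel) (\<lambda>i w. \<lambda>j\<in>{1..r}. Y j i w) borel \<tau>"
    and Y_int: "\<And>j i. j \<in> {1..r} \<Longrightarrow> integrable M (Y j i)" "\<And>j i. j \<in> {1..r} \<Longrightarrow> expectation (Y j i) = b j"
    and ab: "\<And>j. j \<in> {1..r} \<Longrightarrow> b j < a"
    and SE: "cond_SE M r Y F d" and H: "cond_H M r Y F d"
  shows "((\<lambda>x. prob {w \<in> space M. R_lower r Y \<tau> w > ereal x} / (1 - integrated_tail_df F x))
     \<longlongrightarrow> (\<Sum>j=1..r. d j / (a - b j))) at_top"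
proof -
  let ?J = "{1..r}" and ?N = "\<Pi>\<^sub>M j\<in>{1..r}. borel :: real measure"
  let ?Yv = "\<lambda>i w. \<lambda>j\<in>{1..r}. Y j i w"
  have F: "heavy_tail F" using SE by (simp add: heavy_tail_def cond_SE_def)
  interpret heavy_tail F by fact
  have d: "0 \<le> d j" if "j \<in> ?J" for j using SE that by (auto simp: cond_SE_def)
  have te: "tail_equiv (\<lambda>x. prob {w \<in> space M. x < Y j 1 w}) (d j) H" if "j \<in> ?J" for j
    using SE that by (auto simp: cond_SE_def)
  have dsum: "0 < (\<Sum>j=1..r. d j)" using SE by (simp add: cond_SE_def)
  have Ym: "Y j i \<in> borel_measurable M" if "j \<in> ?J" for j i
    using Y_int(1)[OF that] by simp
  have \<tau>m: "\<tau> i \<in> borel_measurable M" for i using \<tau>_int(1)[of i] by simp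
  have Y_prob: "prob {w \<in> space M. Q (?Yv i w)} = prob {w \<in> space M. Q (?Yv 1 w)}"
    if "{y \<in> space ?N. Q y} \<in> sets ?N" for i Q
  proof -
    have "prob {w \<in> space M. ?Yv i w \<in> {y \<in> space ?N. Q y}} = prob {w \<in> space M. ?Yv 1 w \<in> {y \<in> space ?N. Q y}}"
      by (rule prob_same_distr[OF iid_processD(2)[OF Y] iid_processD(2)[OF Y] iid_processD(3)[OF Y] that])
    then show ?thesis by (auto simp: space_PiM cong: conj_cong)
  qed
  have Y1: "prob {w \<in> space M. x < Y j i w} = prob {w \<in> space M. x < Y j 1 w}" if "j \<in> ?J" for j i x
    using Y_prob[of "\<lambda>y. x < y j" i] that by simp
  have Y2: "prob {w \<in> space M. x < Y k i w \<and> x < Y j i w} = prob {w \<in> space M. x < Y k 1 w \<and> x < Y j 1 w}"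
    if "j \<in> ?J" "k \<in> ?J" for j k i x
    using Y_prob[of "\<lambda>y. x < y k \<and> x < y j" i] that by simp
  have inj: "inj (\<lambda>k. - int k)" "inj (\<lambda>k. - int k - 1)" by (auto simp: inj_on_def)
  let ?E = "\<lambda>x j. {w \<in> space M. \<exists>n. x < (\<Sum>k\<le>n. Y j (- int k) w) - (\<Sum>k<n. \<tau> (- int k - 1) w)}"
  have E: "?E x j \<in> events" if "j \<in> ?J" for x j
    using Ym[OF that] \<tau>m by measurable
  have R_eq: "{w \<in> space M. R_lower r Y \<tau> w > ereal x} = (\<Union>j\<in>?J. ?E x j)" for x
    unfolding less_R_lower_iff[OF r] by auto
  have upper: "eventually (\<lambda>x. prob (?E x j) \<le> (d j / (a - b j) + \<eta>) * G x) at_top"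
    if j: "j \<in> ?J" and \<eta>: "0 < \<eta>" for j \<eta>
  proof -
    define W where "W n w = (if n = 0 then Y j 0 w else Y j (- int n) w - \<tau> (- int n) w)" for n w
    have fj: "(\<lambda>p. fst p j) \<in> borel_measurable (?N \<Otimes>\<^sub>M borel)"
      by (rule measurable_compose[OF measurable_fst measurable_component_singleton[OF j]])
    have pj: "(\<lambda>p. fst p j - snd p) \<in> borel_measurable (?N \<Otimes>\<^sub>M borel)"
      by (intro borel_measurable_diff fj measurable_snd)
    have pr: "(\<lambda>p. if n = 0 then fst p j else fst p j - snd p) \<in> borel_measurable (?N \<Otimes>\<^sub>M borel)" for n :: nat
      using fj pj by (cases "n = 0") auto
    have iv: "indep_vars (\<lambda>_. ?N \<Otimes>\<^sub>M borel) (\<lambda>n w. (?Yv (- int n) w, \<tau> (- int n) w)) UNIV"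
      by (rule indep_vars_pair_process[OF ip iid_processD(1)[OF Y] iid_processD(1)[OF \<tau>] inj(1) inj(1)])
    have W: "indep_vars (\<lambda>_. borel) W UNIV"
    proof -
      have "W = (\<lambda>n w. if n = 0 then fst (?Yv (- int n) w, \<tau> (- int n) w) j
          else fst (?Yv (- int n) w, \<tau> (- int n) w) j - snd (?Yv (- int n) w, \<tau> (- int n) w))"
        using j by (intro ext) (simp add: W_def)
      then show ?thesis using indep_vars_compose2[OF iv pr] by (simp only:)
    qed
    have D: "distr M borel (W (Suc n)) = distr M borel (W 1)" for n
    proof -
      have "distr M borel (W (Suc n)) = distr (distr M (?N \<Otimes>\<^sub>M borel) (\<lambda>w. (?Yv (- int (Suc n)) w, \<tau> (- int (Suc n)) w))) borel (\<lambda>p. fst p j - snd p)" for n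
        using j iid_processD(2)[OF Y] \<tau>m by (subst distr_distr[OF pj]) (auto simp: W_def[abs_def] comp_def)
      then have "distr M borel (W (Suc n)) = distr (distr M ?N (?Yv 0) \<Otimes>\<^sub>M distr M borel (\<tau> 0)) borel (\<lambda>p. fst p j - snd p)" for n
        by (simp only: distr_pair_process[OF ip] iid_processD(3)[OF Y, of "- int (Suc n)" 0] iid_processD(3)[OF \<tau>, of "- int (Suc n)" 0])
      from this[of n] this[of 0] show ?thesis by simp
    qed
    have eq: "?E x j = {w \<in> space M. \<exists>n. x < (\<Sum>k\<le>n. W k w)}" for x
    proof -
      have "(\<Sum>k\<le>n. W k w) = (\<Sum>k\<le>n. Y j (- int k) w) - (\<Sum>k<n. \<tau> (- int k - 1) w)" for n w
      proof (induction n)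
        case (Suc n)
        have e: "- int (Suc n) = - int n - 1" by simp
        show ?case using Suc by (simp add: W_def e del: of_nat_Suc)
      qed (simp add: W_def)
      then show ?thesis by simp
    qed
    have "eventually (\<lambda>x. prob {w \<in> space M. \<exists>n. x < (\<Sum>k\<le>n. W k w)} \<le> (d j / (a - b j) + \<eta>) * (1 - integrated_tail_df F x)) at_top"
    proof (rule delayed_walk_upper[OF F W D, of "a - b j" "d j" "d j + 1"])
      show "integrable M (W 1)" using Y_int(1)[OF j] \<tau>_int(1) by (simp add: W_def[abs_def])
      show "expectation (W 1) = - (a - b j)"
        using Y_int[OF j] \<tau>_int by (simp add: W_def[abs_def])
      show "eventually (\<lambda>x. prob {w \<in> space M. x < W 0 w} \<le> (d j + 1) * H x) at_top"
        using tail_equiv_upper[OF te[OF j] F.G_pos, of 1] by (simp add: W_def Y1[OF j, of _ 0])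
      fix e :: real assume e: "0 < e"
      show "eventually (\<lambda>x. prob {w \<in> space M. x < W 1 w} \<le> (d j + e) * H x) at_top"
        using tail_equiv_upper[OF te[OF j] F.G_pos e]
      proof eventually_elim
        case (elim x)
        \<comment> \<open>Interarrival times are nonnegative, so dropping one only enlarges the
          event.\<close>
        have "prob {w \<in> space M. x < W 1 w} \<le> prob {w \<in> space M. x < Y j (- 1) w}"
        proof (rule finite_measure_mono)
          show "{w \<in> space M. x < W 1 w} \<subseteq> {w \<in> space M. x < Y j (- 1) w}"
            using \<tau>0[of _ "- 1"] by (force simp: W_def)
          show "{w \<in> space M. x < Y j (- 1) w} \<in> events" using Ym[OF j] by measurable
        qed
        then show ?case using elim by (simp add: Y1[OF j, of _ "- 1"])
      qed
    qed (use ab[OF j] d[OF j] \<eta> in auto)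
    then show ?thesis by (simp only: eq)
  qed
  have lower: "eventually (\<lambda>x. ((\<Sum>j\<in>?J. d j / (a - b j)) - \<eta>) * G x \<le> prob (\<Union>j\<in>?J. ?E x j)) at_top"
    if \<eta>: "0 < \<eta>" for \<eta>
  proof -
    have "eventually (\<lambda>x. ((\<Sum>j\<in>?J. d j / (a - b j)) - \<eta>) * (1 - integrated_tail_df F x)
      \<le> prob {w \<in> space M. \<exists>j\<in>?J. \<exists>n. x < (\<Sum>k\<le>n. Y j (- int k) w) - (\<Sum>k<n. \<tau> (- int k - 1) w)}) at_top"
    proof (rule multi_walk_lower[OF F, where D="distr M ?N (?Yv 0) \<Otimes>\<^sub>M distr M borel (\<tau> 0)" and U="\<lambda>j k. Y j (- int k)" and V="\<lambda>k. \<tau> (- int k - 1)"])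
      show "indep_vars (\<lambda>_. ?N \<Otimes>\<^sub>M borel) (\<lambda>n w. (?Yv (- int n) w, \<tau> (- int n - 1) w)) UNIV"
        by (rule indep_vars_pair_process[OF ip iid_processD(1)[OF Y] iid_processD(1)[OF \<tau>] inj])
      show "distr M (?N \<Otimes>\<^sub>M borel) (\<lambda>w. (?Yv (- int n) w, \<tau> (- int n - 1) w)) = distr M ?N (?Yv 0) \<Otimes>\<^sub>M distr M borel (\<tau> 0)" for n
        by (simp only: distr_pair_process[OF ip] iid_processD(3)[OF Y, of "- int n" 0] iid_processD(3)[OF \<tau>, of "- int n - 1" 0])
      fix j assume j: "j \<in> ?J"
      show "integrable M (Y j (- int 0))" by (rule Y_int(1)[OF j])
      show "expectation (\<lambda>w. \<tau> (- int 0 - 1) w - Y j (- int 0) w) = a - b j"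
        using Y_int[OF j] \<tau>_int by simp
      show "0 < a - b j" using ab[OF j] by simp
      show "0 \<le> d j" by (rule d[OF j])
      show "eventually (\<lambda>x. prob {w \<in> space M. x < Y j (- int 0) w} \<le> (d j + 1) * H x) at_top"
        unfolding Y1[OF j, of _ "- int 0"] by (rule tail_equiv_upper[OF te[OF j] F.G_pos]) simp
      show "eventually (\<lambda>x. (1 - e) * d j * H x \<le> prob {w \<in> space M. x < Y j (- int 0) w}) at_top" if "0 < e" for e
        unfolding Y1[OF j, of _ "- int 0"] by (rule tail_equiv_lower[OF te[OF j] F.G_pos d[OF j] that]) simp
    next
      fix i j e assume ij: "i \<in> ?J" "j \<in> ?J" "i \<noteq> j" and e: "0 < (e :: real)"
      show "eventually (\<lambda>x. prob {w \<in> space M. x < Y i (- int 0) w \<and> x < Y j (- int 0) w} \<le> e * H x) at_top"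
        unfolding Y2[OF ij(2,1), of _ "- int 0"] by (rule cond_H_pair[OF H Ym dsum F.F_less_1 ij e])
    qed (use \<tau>_int \<eta> in auto)
    moreover have "{w \<in> space M. \<exists>j\<in>?J. \<exists>n. x < (\<Sum>k\<le>n. Y j (- int k) w) - (\<Sum>k<n. \<tau> (- int k - 1) w)} = (\<Union>j\<in>?J. ?E x j)" for x
      by auto
    ultimately show ?thesis by (simp only:)
  qed
  show ?thesis
  proof (rule order_tendstoI)
    fix l assume l: "l < (\<Sum>j\<in>?J. d j / (a - b j))"
    define \<eta> where "\<eta> = ((\<Sum>j\<in>?J. d j / (a - b j)) - l) / 2"
    have \<eta>: "0 < \<eta>" "l < (\<Sum>j\<in>?J. d j / (a - b j)) - \<eta>" using l by (auto simp: \<eta>_def field_simps)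
    show "eventually (\<lambda>x. l < prob {w \<in> space M. R_lower r Y \<tau> w > ereal x} / G x) at_top"
      using lower[OF \<eta>(1)]
    proof eventually_elim
      case (elim x)
      then have "(\<Sum>j\<in>?J. d j / (a - b j)) - \<eta> \<le> prob {w \<in> space M. R_lower r Y \<tau> w > ereal x} / G x"
        using Fs.G_pos[of x] by (simp only: R_eq pos_le_divide_eq)
      then show ?case using \<eta>(2) by linarith
    qed
  next
    fix u assume u: "(\<Sum>j\<in>?J. d j / (a - b j)) < u"
    \<comment> \<open>The union bound incurs the error \<open>\<eta>\<close> once for each of the
      \<open>r\<close> walks; half of the available gap keeps the final inequality strict.\<close>
    define \<eta> where "\<eta> = (u - (\<Sum>j\<in>?J. d j / (a - b j))) / (2 * real r)"
    have r0: "0 < real r" using r by simp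
    have \<eta>: "0 < \<eta>" "(\<Sum>j\<in>?J. d j / (a - b j)) + real r * \<eta> < u"
      using u r0 by (auto simp: \<eta>_def field_simps)
    have "eventually (\<lambda>x. \<forall>j\<in>?J. prob (?E x j) \<le> (d j / (a - b j) + \<eta>) * G x) at_top"
      by (intro eventually_ball_finite ballI upper \<eta>(1)) auto
    then show "eventually (\<lambda>x. prob {w \<in> space M. R_lower r Y \<tau> w > ereal x} / G x < u) at_top"
    proof eventually_elim
      case (elim x)
      have "prob (\<Union>j\<in>?J. ?E x j) \<le> (\<Sum>j\<in>?J. prob (?E x j))"
        using E by (intro finite_measure_subadditive_finite) auto
      also have "\<dots> \<le> (\<Sum>j\<in>?J. (d j / (a - b j) + \<eta>) * G x)"
        using elim by (intro sum_mono) blast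
      also have "\<dots> = ((\<Sum>j\<in>?J. d j / (a - b j)) + real r * \<eta>) * G x"
        by (subst sum_distrib_right[symmetric]) (simp add: sum.distrib)
      finally have "prob {w \<in> space M. R_lower r Y \<tau> w > ereal x} / G x \<le> (\<Sum>j\<in>?J. d j / (a - b j)) + real r * \<eta>"
        using Fs.G_pos[of x] by (simp only: R_eq pos_divide_le_eq)
      then show ?case using \<eta>(2) by linarith
    qed
  qed
qed

section \<open>Transfer to the stationary maximal dater\<close>

theorem theorem6:
  fixes M :: "'w measure" and K :: "'k measure"
    and f :: "nat \<Rightarrow> (nat \<Rightarrow> real \<times> 'k) \<Rightarrow> real"
    and T :: "int \<Rightarrow> 'w \<Rightarrow> real" and \<zeta> :: "int \<Rightarrow> 'w \<Rightarrow> 'k"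
    and a \<gamma>0 :: real
    and r :: nat and Y :: "nat \<Rightarrow> int \<Rightarrow> 'w \<Rightarrow> real"
    and F :: "real \<Rightarrow> real" and b d :: "nat \<Rightarrow> real"
  assumes "prob_space M"
    and "network_measurable K f"
    and "\<And>n. T n \<in> borel_measurable M"
    and "\<And>n. \<zeta> n \<in> measurable M K"
    and "\<And>w. w \<in> space M \<Longrightarrow> mono (\<lambda>n. T n w)"
    and "\<And>w. w \<in> space M \<Longrightarrow> monotone_separable f (\<lambda>n. \<zeta> n w)"
    and "stationary_process M (borel \<Otimes>\<^sub>M K) (\<lambda>n w. (interarrival T n w, \<zeta> n w))"
    and "ergodic_process M (borel \<Otimes>\<^sub>M K) (\<lambda>n w. (interarrival T n w, \<zeta> n w))"
    and "\<And>n. integrable M (interarrival T n)"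
    and "\<And>n. (LINT w|M. interarrival T n w) = a"
    and "\<And>n. integrable M (\<lambda>w. maximal_dater f (\<lambda>k. \<zeta> k w) (\<lambda>k. T k w) n n)"
    and "is_gamma0 M f \<zeta> \<gamma>0"
    and "\<gamma>0 < a"
    and "cond_IA M K \<zeta> (interarrival T)"
    and "cond_AA M f \<zeta> T r Y"
    and "cond_SE M r Y F d"
    and "cond_H M r Y F d"
    and "\<And>j. j \<in> {1..r} \<Longrightarrow> b j = (LINT w|M. Y j 1 w)"
  shows "Liminf at_top (\<lambda>x. ereal
             (measure M {w \<in> space M. stationary_maximal_dater f (\<lambda>k. \<zeta> k w) (\<lambda>k. T k w) > ereal x}
                / (1 - integrated_tail_df F x)))
           \<ge> ereal (\<Sum>j=1..r. d j / (a - b j))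
       \<and> ((\<lambda>x. measure M {w \<in> space M. R_lower r Y (interarrival T) w > ereal x}
                / (1 - integrated_tail_df F x))
           \<longlongrightarrow> (\<Sum>j=1..r. d j / (a - b j))) at_top"
proof -
  interpret prob_space M by fact
  note f = assms(2) and Tm = assms(3) and zm = assms(4) and Tmono = assms(5) and ms = assms(6)
  let ?J = "{1..r}" and ?\<tau> = "interarrival T"
  let ?N = "\<Pi>\<^sub>M j\<in>?J. borel :: real measure" and ?Yv = "\<lambda>i w. \<lambda>j\<in>?J. Y j i w"
  let ?Z = "\<lambda>m n w. maximal_dater f (\<lambda>k. \<zeta> k w) (\<lambda>k. T k w) m n"
  let ?Q = "\<lambda>m n w. maximal_dater f (\<lambda>k. \<zeta> k w) (\<lambda>_. 0) m n"
  have r: "1 \<le> r" and Z_sum: "\<And>i. AE w in M. ?Z i i w = (\<Sum>j=1..r. Y j i w)"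
    and Y0: "\<And>j i. j \<in> ?J \<Longrightarrow> AE w in M. 0 \<le> Y j i w"
    and Y: "iid_process M ?N ?Yv" and ip: "indep_processes M ?N ?Yv borel ?\<tau>"
    and Q_ge: "\<And>n. n \<le> 0 \<Longrightarrow> AE w in M. (MAX j\<in>?J. \<Sum>i=n..0. Y j i w) \<le> ?Q n 0 w"
    using assms(15) by (auto simp: cond_AA_def)
  have Ym: "Y j i \<in> borel_measurable M" if "j \<in> ?J" for j i
    using measurable_compose[OF iid_processD(2)[OF Y, of i] measurable_component_singleton[OF that]] that by simp
  \<comment> \<open>The components are nonnegative almost surely and add up to the single dater,
    whose integrability is assumed.\<close>
  have Y_int: "integrable M (Y j i)" if j: "j \<in> ?J" for j i
  proof (rule Bochner_Integration.integrable_bound[OF assms(11)[of i] Ym[OF j]])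
    have "AE w in M. \<forall>j\<in>?J. 0 \<le> Y j i w" using Y0 by (intro AE_finite_allI) auto
    then show "AE w in M. norm (Y j i w) \<le> norm (?Z i i w)" using Z_sum[of i]
    proof eventually_elim
      case (elim w)
      have "Y j i w \<le> (\<Sum>j=1..r. Y j i w)" using elim(1) j by (intro member_le_sum) auto
      then show ?case using elim j by simp
    qed
  qed
  have Y_mean: "expectation (Y j i) = b j" if j: "j \<in> ?J" for j i
  proof -
    have e: "expectation (Y j i) = (LINT y|distr M ?N (?Yv i). y j)" for i
      using integral_distr[OF iid_processD(2)[OF Y, of i] measurable_component_singleton[OF j, of "\<lambda>_. borel :: real measure"]] j
      by simp
    show ?thesis using e[of i] e[of 1] iid_processD(3)[OF Y, of i 1] assms(18)[OF j] by simp
  qed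
  have sum_le_Q: "AE w in M. (\<Sum>i=n..0. Y j i w) \<le> ?Q n 0 w" if "n \<le> 0" "j \<in> ?J" for n j
    using Q_ge[OF that(1)]
  proof eventually_elim
    case (elim w)
    then show ?case using that(2) by (intro order_trans[OF Max_ge elim]) auto
  qed
  have b_less: "b j < a" if j: "j \<in> ?J" for j
  proof -
    have "b j \<le> \<gamma>0"
    proof (rule mean_le_gamma0[where B="Y j", OF f zm ms assms(7) _ assms(12) Y_int[OF j] Y_mean[OF j]])
      show "integrable M (?Q n n)" for n
      proof (rule Bochner_Integration.integrable_cong[THEN iffD1, OF refl _ assms(11)[of n]])
        show "?Z n n w = ?Q n n w" if "w \<in> space M" for w by (rule maximal_dater_single[OF ms[OF that]])
      qed
    qed (use sum_le_Q j in auto)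
    then show ?thesis using assms(13) by simp
  qed
  have R: "((\<lambda>x. prob {w \<in> space M. R_lower r Y ?\<tau> w > ereal x} / (1 - integrated_tail_df F x))
           \<longlongrightarrow> (\<Sum>j=1..r. d j / (a - b j))) at_top"
  proof (rule R_lower_asymptotics[OF r _ _ assms(9,10) Y ip Y_int Y_mean b_less assms(16,17)])
    show "iid_process M borel ?\<tau>" using assms(14) by (simp add: cond_IA_def)
    show "0 \<le> ?\<tau> n w" if "w \<in> space M" for n w
      using monoD[OF Tmono[OF that], of n "n + 1"] by (simp add: interarrival_def)
  qed
  let ?SZ = "\<lambda>x. {w \<in> space M. stationary_maximal_dater f (\<lambda>k. \<zeta> k w) (\<lambda>k. T k w) > ereal x}"
  let ?SR = "\<lambda>x. {w \<in> space M. R_lower r Y ?\<tau> w > ereal x}"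
  \<comment> \<open>(AA) gives an exceptional null set for each window; countably many of them are
    merged, so that the index \<open>n\<close> may depend on \<open>w\<close>.\<close>
  have "AE w in M. \<forall>n. \<forall>j\<in>?J. (\<Sum>i=- int n..0. Y j i w) \<le> ?Q (- int n) 0 w"
    unfolding AE_all_countable using sum_le_Q by (intro allI AE_finite_allI) auto
  then have sub: "AE w in M. w \<in> ?SR x \<longrightarrow> w \<in> ?SZ x" for x
    using AE_space
  proof eventually_elim
    case (elim w)
    show ?case
    proof
      assume "w \<in> ?SR x"
      then obtain j n where jn: "j \<in> ?J" "x < (\<Sum>k\<le>n. Y j (- int k) w) - (\<Sum>k<n. ?\<tau> (- int k - 1) w)"
        unfolding mem_Collect_eq less_R_lower_iff[OF r] by blast
      \<comment> \<open>The interarrival times telescope to precisely the amount lost when the input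
        is replaced by the degenerate one.\<close>
      have "(\<Sum>k<n. ?\<tau> (- int k - 1) w) = T 0 w - T (- int n) w"
      proof (induction n)
        case (Suc n)
        have e: "- int (Suc n) = - int n - 1" by simp
        show ?case using Suc by (simp add: interarrival_def e del: of_nat_Suc)
      qed simp
      then have "x < ?Q (- int n) 0 w - (T 0 w - T (- int n) w)"
        using jn elim(1) sum_int_reverse[of "\<lambda>i. Y j i w" n] by (metis diff_right_mono order_less_le_trans)
      also have "\<dots> \<le> ?Z (- int n) 0 w"
        by (rule maximal_dater_ge_degenerate[OF ms[OF elim(2)] Tmono[OF elim(2)]]) simp
      finally show "w \<in> ?SZ x"
        using elim(2) less_stationary_maximal_dater_iff[OF ms Tmono] by auto
    qed
  qed
  have SZ: "?SZ x \<in> events" for x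
  proof -
    have "?SZ x = (\<Union>n. {w \<in> space M. x < ?Z (- int n) 0 w})"
      using less_stationary_maximal_dater_iff[OF ms Tmono] by auto
    moreover have "{w \<in> space M. x < ?Z (- int n) 0 w} \<in> events" for n
      using maximal_dater_measurable[OF f Tm zm, of "- int n" 0] by measurable
    ultimately show ?thesis by auto
  qed
  have "ereal (\<Sum>j=1..r. d j / (a - b j)) = Liminf at_top (\<lambda>x. ereal (prob (?SR x) / (1 - integrated_tail_df F x)))"
    by (rule lim_imp_Liminf[symmetric]) (use R in auto)
  also have "\<dots> \<le> Liminf at_top (\<lambda>x. ereal (prob (?SZ x) / (1 - integrated_tail_df F x)))"
  proof (intro Liminf_mono always_eventually allI)
    fix x
    have "integrated_tail_df F x < 1"
      using assms(16) by (simp add: cond_SE_def subexponential_def)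
    then show "ereal (prob (?SR x) / (1 - integrated_tail_df F x)) \<le> ereal (prob (?SZ x) / (1 - integrated_tail_df F x))"
      using finite_measure_mono_AE[OF sub SZ] by (simp add: divide_right_mono)
  qed
  finally show ?thesis using R by blast
qed

end
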